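(* Assume that the Hamiltonian vector field $\vec H$ is monotone and that its flow $\varphi_t$ has no conjugate point on $M$. Then there are (measurable) Lagrangian distributions $\Delta^+$ and $\Delta^-$ on $M$ which are invariant under $d\varphi_t$, i.e. $d\varphi_t(\Delta^\pm_\alpha)=\Delta^\pm_{\varphi_t(\alpha)}$ for all $\alpha\in M$ and all $t\in\mathbb{R}$.
   Context: $M$ is a smooth manifold of dimension $2n$ with symplectic form $\omega$, and $\Lambda\subset TM$ is a smooth Lagrangian distribution (a rank $n$ subbundle whose fibers are Lagrangian). $H:M\to\mathbb{R}$ is a smooth function, $\vec H$ is its Hamiltonian vector field, defined by $\omega(\vec H,\cdot)=-dH$, and $\varphi_t$ is the flow of $\vec H$, assumed complete. On $\Lambda$ one has the symmetric bilinear form $\langle V_1,V_2\rangle=\omega([\vec H,V_1],V_2)$ for sections $V_1,V_2$ of $\Lambda$ (it is tensorial). $\vec H$ is monotone if this form is positive definite at every point, i.e. is a Riemannian metric on $\Lambda$. The flow has no conjugate point on $M$ if for every $\alpha\in M$ and every $t\neq 0$ the subspaces $d\varphi_t(\Lambda_\alpha)$ and $\Lambda_{\varphi_t(\alpha)}$ of $T_{\varphi_t(\alpha)}M$ are transversal (intersect only in $0$). A measurable Lagrangian distribution is a measurable assignment $\alpha\mapsto\Delta_\alpha$ of a Lagrangian subspace of $T_\alpha M$ to each point $\alpha$. *)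

theory Defs
  imports "HOL-Analysis.Analysis" "HOL-Library.Function_Algebras"
begin

text \<open>
  Pointwise real vector space structure on functions; tangent vectors are encoded below as
  functions from charts to coordinate vectors.
\<close>

instantiation "fun" :: (type, real_vector) real_vector
begin

definition scaleR_fun :: "real \<Rightarrow> ('a \<Rightarrow> 'b) \<Rightarrow> 'a \<Rightarrow> 'b"
  where "scaleR_fun r f = (\<lambda>x. r *\<^sub>R f x)"

instance
  by standard (simp_all add: scaleR_fun_def fun_eq_iff scaleR_add_right scaleR_add_left)

end

section \<open>Smooth functions on open subsets of a normed space\<close>

text \<open>Both notions are only meant for open \<open>S\<close>.\<close>

primrec Ck_on :: "nat \<Rightarrow> 'a::real_normed_vector set \<Rightarrow> ('a \<Rightarrow> 'b::real_normed_vector) \<Rightarrow> bool"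
  where
    "Ck_on 0 S f \<longleftrightarrow> continuous_on S f"
  | "Ck_on (Suc k) S f \<longleftrightarrow>
       (\<forall>x\<in>S. f differentiable (at x)) \<and> (\<forall>v. Ck_on k S (\<lambda>x. frechet_derivative f (at x) v))"

definition smooth_on :: "'a::real_normed_vector set \<Rightarrow> ('a \<Rightarrow> 'b::real_normed_vector) \<Rightarrow> bool"
  where "smooth_on S f \<longleftrightarrow> (\<forall>k. Ck_on k S f)"

section \<open>Smooth manifolds\<close>

text \<open>
  The manifold is the whole type \<open>'m\<close> (Hausdorff and second countable by its sort), modelled
  on the Euclidean space \<open>'e\<close>. A chart is a domain together with a coordinate map, whose values
  outside the domain are irrelevant. The smooth structure is given by an atlas, which need not
  be maximal.
\<close>

type_synonym ('m, 'e) chart = "'m set \<times> ('m \<Rightarrow> 'e)"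

abbreviation chart_dom :: "('m, 'e) chart \<Rightarrow> 'm set" where "chart_dom \<equiv> fst"

abbreviation chart_map :: "('m, 'e) chart \<Rightarrow> 'm \<Rightarrow> 'e" where "chart_map \<equiv> snd"

definition chart_image :: "('m, 'e) chart \<Rightarrow> 'e set"
  where "chart_image c = chart_map c ` chart_dom c"

definition chart_inv :: "('m, 'e) chart \<Rightarrow> 'e \<Rightarrow> 'm"
  where "chart_inv c = inv_into (chart_dom c) (chart_map c)"

definition is_chart :: "('m::topological_space, 'e::euclidean_space) chart \<Rightarrow> bool"
  where "is_chart c \<longleftrightarrow> open (chart_dom c) \<and> open (chart_image c) \<and>
    homeomorphism (chart_dom c) (chart_image c) (chart_map c) (chart_inv c)"

definition smooth_atlas ::
    "('m::{t2_space, second_countable_topology}, 'e::euclidean_space) chart set \<Rightarrow> bool"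
  where "smooth_atlas A \<longleftrightarrow>
    (\<forall>c\<in>A. is_chart c) \<and> (\<Union>c\<in>A. chart_dom c) = UNIV \<and>
    (\<forall>c\<in>A. \<forall>d\<in>A. smooth_on (chart_map c ` (chart_dom c \<inter> chart_dom d)) (chart_map d \<circ> chart_inv c))"

definition charts_at :: "('m, 'e) chart set \<Rightarrow> 'm \<Rightarrow> ('m, 'e) chart set"
  where "charts_at A p = {c \<in> A. p \<in> chart_dom c}"

definition some_chart :: "('m, 'e) chart set \<Rightarrow> 'm \<Rightarrow> ('m, 'e) chart"
  where "some_chart A p = (SOME c. c \<in> charts_at A p)"

definition smooth_function :: "('m, 'e::euclidean_space) chart set \<Rightarrow> ('m \<Rightarrow> real) \<Rightarrow> bool"
  where "smooth_function A f \<longleftrightarrow> (\<forall>c\<in>A. smooth_on (chart_image c) (f \<circ> chart_inv c))"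

section \<open>Tangent vectors and vector fields\<close>

text \<open>
  A tangent vector at \<open>p\<close> assigns to every chart at \<open>p\<close> a coordinate vector, such that the
  coordinate vectors transform by the derivatives of the transition maps. It is \<open>0\<close> on all
  other charts, so that a tangent vector is determined by its coordinates in one chart at \<open>p\<close>.
\<close>

type_synonym ('m, 'e) tvec = "('m, 'e) chart \<Rightarrow> 'e"

definition tangent_space :: "('m, 'e::euclidean_space) chart set \<Rightarrow> 'm \<Rightarrow> ('m, 'e) tvec set"
  where "tangent_space A p = {v.
    (\<forall>c. c \<notin> charts_at A p \<longrightarrow> v c = 0) \<and>
    (\<forall>c\<in>charts_at A p. \<forall>d\<in>charts_at A p.
       v d = frechet_derivative (chart_map d \<circ> chart_inv c) (at (chart_map c p)) (v c))}"

text \<open>The tangent vector at \<open>p\<close> with coordinates \<open>e\<close> in the chart \<open>c\<close>.\<close>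

definition coord_vec ::
    "('m, 'e::euclidean_space) chart set \<Rightarrow> ('m, 'e) chart \<Rightarrow> 'm \<Rightarrow> 'e \<Rightarrow> ('m, 'e) tvec"
  where "coord_vec A c p e = (\<lambda>d. if d \<in> charts_at A p
    then frechet_derivative (chart_map d \<circ> chart_inv c) (at (chart_map c p)) e else 0)"

text \<open>
  The differentials of a smooth function and of a smooth self-map; by the chain rule they do not
  depend on the chosen chart at \<open>p\<close>.
\<close>

definition differential ::
    "('m, 'e::euclidean_space) chart set \<Rightarrow> ('m \<Rightarrow> real) \<Rightarrow> 'm \<Rightarrow> ('m, 'e) tvec \<Rightarrow> real"
  where "differential A f p v =
    (let c = some_chart A p
     in frechet_derivative (f \<circ> chart_inv c) (at (chart_map c p)) (v c))"

definition tangent_map ::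
    "('m, 'e::euclidean_space) chart set \<Rightarrow> ('m \<Rightarrow> 'm) \<Rightarrow> 'm \<Rightarrow> ('m, 'e) tvec \<Rightarrow> ('m, 'e) tvec"
  where "tangent_map A F p v =
    (let c = some_chart A p
     in (\<lambda>d. if d \<in> charts_at A (F p)
           then frechet_derivative (chart_map d \<circ> F \<circ> chart_inv c) (at (chart_map c p)) (v c)
           else 0))"

definition smooth_vector_field_on ::
    "('m, 'e::euclidean_space) chart set \<Rightarrow> 'm set \<Rightarrow> ('m \<Rightarrow> ('m, 'e) tvec) \<Rightarrow> bool"
  where "smooth_vector_field_on A U X \<longleftrightarrow>
    (\<forall>p\<in>U. X p \<in> tangent_space A p) \<and>
    (\<forall>c\<in>A. smooth_on (chart_map c ` (chart_dom c \<inter> U)) (\<lambda>x. X (chart_inv c x) c))"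

definition measurable_vector_field_on ::
    "('m::topological_space, 'e::euclidean_space) chart set \<Rightarrow> 'm set \<Rightarrow> ('m \<Rightarrow> ('m, 'e) tvec) \<Rightarrow> bool"
  where "measurable_vector_field_on A U X \<longleftrightarrow>
    (\<forall>p\<in>U. X p \<in> tangent_space A p) \<and>
    (\<forall>c\<in>A. (\<lambda>p. X p c) \<in> borel_measurable (restrict_space borel (chart_dom c \<inter> U)))"

text \<open>
  Convention \<open>[X, Y] f = X (Y f) - Y (X f)\<close>, i.e. \<open>[X, Y] = DY X - DX Y\<close> in coordinates.
\<close>

definition lie_bracket ::
    "('m, 'e::euclidean_space) chart set \<Rightarrow> ('m \<Rightarrow> ('m, 'e) tvec) \<Rightarrow> ('m \<Rightarrow> ('m, 'e) tvec)
      \<Rightarrow> 'm \<Rightarrow> ('m, 'e) tvec"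
  where "lie_bracket A X Y p = (\<lambda>c. if c \<in> charts_at A p
    then frechet_derivative (\<lambda>x. Y (chart_inv c x) c) (at (chart_map c p)) (X p c)
       - frechet_derivative (\<lambda>x. X (chart_inv c x) c) (at (chart_map c p)) (Y p c)
    else 0)"

text \<open>
  \<open>\<Phi>\<close> is the flow of the complete vector field \<open>X\<close>: a smooth action of the additive group of
  reals whose infinitesimal generator is \<open>X\<close>.
\<close>

definition complete_flow ::
    "('m::topological_space, 'e::euclidean_space) chart set \<Rightarrow> ('m \<Rightarrow> ('m, 'e) tvec)
      \<Rightarrow> (real \<Rightarrow> 'm \<Rightarrow> 'm) \<Rightarrow> bool"
  where "complete_flow A X \<Phi> \<longleftrightarrow>
    continuous_on UNIV (\<lambda>(t, p). \<Phi> t p) \<and>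
    (\<forall>c\<in>A. \<forall>d\<in>A. smooth_on {(t, x). x \<in> chart_image c \<and> \<Phi> t (chart_inv c x) \<in> chart_dom d}
                     (\<lambda>(t, x). chart_map d (\<Phi> t (chart_inv c x)))) \<and>
    (\<forall>p. \<Phi> 0 p = p) \<and>
    (\<forall>s t p. \<Phi> (s + t) p = \<Phi> s (\<Phi> t p)) \<and>
    (\<forall>p t. \<forall>c\<in>charts_at A (\<Phi> t p).
       ((\<lambda>s. chart_map c (\<Phi> s p)) has_vector_derivative X (\<Phi> t p) c) (at t))"

section \<open>Symplectic forms\<close>

text \<open>Only the values of \<open>\<omega> p\<close> on the tangent space at \<open>p\<close> are relevant.\<close>

definition form_coord ::
    "('m, 'e::euclidean_space) chart set \<Rightarrow> ('m \<Rightarrow> ('m, 'e) tvec \<Rightarrow> ('m, 'e) tvec \<Rightarrow> real)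
      \<Rightarrow> ('m, 'e) chart \<Rightarrow> 'e \<Rightarrow> 'e \<Rightarrow> 'e \<Rightarrow> real"
  where "form_coord A \<omega> c x u v =
    (let p = chart_inv c x in \<omega> p (coord_vec A c p u) (coord_vec A c p v))"

definition smooth_two_form ::
    "('m, 'e::euclidean_space) chart set \<Rightarrow> ('m \<Rightarrow> ('m, 'e) tvec \<Rightarrow> ('m, 'e) tvec \<Rightarrow> real) \<Rightarrow> bool"
  where "smooth_two_form A \<omega> \<longleftrightarrow>
    (\<forall>p. \<forall>u\<in>tangent_space A p. \<forall>v\<in>tangent_space A p. \<forall>w\<in>tangent_space A p. \<forall>a b.
       \<omega> p (a *\<^sub>R u + b *\<^sub>R v) w = a * \<omega> p u w + b * \<omega> p v w) \<and>
    (\<forall>p. \<forall>u\<in>tangent_space A p. \<forall>v\<in>tangent_space A p. \<omega> p u v = - \<omega> p v u) \<and>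
    (\<forall>c\<in>A. \<forall>u v. smooth_on (chart_image c) (\<lambda>x. form_coord A \<omega> c x u v))"

text \<open>
  The exterior derivative of \<open>\<omega>\<close> in the chart \<open>c\<close>, on the constant coordinate fields \<open>u\<close>, \<open>v\<close>,
  \<open>w\<close> (whose brackets vanish).
\<close>

definition ext_deriv_coord ::
    "('m, 'e::euclidean_space) chart set \<Rightarrow> ('m \<Rightarrow> ('m, 'e) tvec \<Rightarrow> ('m, 'e) tvec \<Rightarrow> real)
      \<Rightarrow> ('m, 'e) chart \<Rightarrow> 'e \<Rightarrow> 'e \<Rightarrow> 'e \<Rightarrow> 'e \<Rightarrow> real"
  where "ext_deriv_coord A \<omega> c x u v w =
      frechet_derivative (\<lambda>y. form_coord A \<omega> c y v w) (at x) u
    - frechet_derivative (\<lambda>y. form_coord A \<omega> c y u w) (at x) v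
    + frechet_derivative (\<lambda>y. form_coord A \<omega> c y u v) (at x) w"

definition symplectic_form ::
    "('m, 'e::euclidean_space) chart set \<Rightarrow> ('m \<Rightarrow> ('m, 'e) tvec \<Rightarrow> ('m, 'e) tvec \<Rightarrow> real) \<Rightarrow> bool"
  where "symplectic_form A \<omega> \<longleftrightarrow>
    smooth_two_form A \<omega> \<and>
    (\<forall>p. \<forall>u\<in>tangent_space A p. (\<forall>v\<in>tangent_space A p. \<omega> p u v = 0) \<longrightarrow> u = 0) \<and>
    (\<forall>c\<in>A. \<forall>x\<in>chart_image c. \<forall>u v w. ext_deriv_coord A \<omega> c x u v w = 0)"

definition hamiltonian_vector_field ::
    "('m, 'e::euclidean_space) chart set \<Rightarrow> ('m \<Rightarrow> ('m, 'e) tvec \<Rightarrow> ('m, 'e) tvec \<Rightarrow> real)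
      \<Rightarrow> ('m \<Rightarrow> real) \<Rightarrow> ('m \<Rightarrow> ('m, 'e) tvec) \<Rightarrow> bool"
  where "hamiltonian_vector_field A \<omega> H X \<longleftrightarrow>
    (\<forall>p. X p \<in> tangent_space A p \<and>
         (\<forall>v\<in>tangent_space A p. \<omega> p (X p) v = - differential A H p v))"

section \<open>Lagrangian distributions\<close>

definition lagrangian_subspace ::
    "('m, 'e::euclidean_space) chart set \<Rightarrow> ('m \<Rightarrow> ('m, 'e) tvec \<Rightarrow> ('m, 'e) tvec \<Rightarrow> real)
      \<Rightarrow> 'm \<Rightarrow> ('m, 'e) tvec set \<Rightarrow> bool"
  where "lagrangian_subspace A \<omega> p L \<longleftrightarrow>
    subspace L \<and> L = {v \<in> tangent_space A p. \<forall>w\<in>L. \<omega> p v w = 0}"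

definition frame_on ::
    "nat \<Rightarrow> 'm set \<Rightarrow> (nat \<Rightarrow> 'm \<Rightarrow> ('m, 'e::euclidean_space) tvec) \<Rightarrow> ('m \<Rightarrow> ('m, 'e) tvec set) \<Rightarrow> bool"
  where "frame_on n U X D \<longleftrightarrow>
    (\<forall>p\<in>U. inj_on (\<lambda>i. X i p) {..<n} \<and> independent ((\<lambda>i. X i p) ` {..<n}) \<and>
            span ((\<lambda>i. X i p) ` {..<n}) = D p)"

definition smooth_lagrangian_distribution ::
    "nat \<Rightarrow> ('m::topological_space, 'e::euclidean_space) chart set
      \<Rightarrow> ('m \<Rightarrow> ('m, 'e) tvec \<Rightarrow> ('m, 'e) tvec \<Rightarrow> real) \<Rightarrow> ('m \<Rightarrow> ('m, 'e) tvec set) \<Rightarrow> bool"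
  where "smooth_lagrangian_distribution n A \<omega> \<Lambda> \<longleftrightarrow>
    (\<forall>p. lagrangian_subspace A \<omega> p (\<Lambda> p)) \<and>
    (\<forall>p. \<exists>U X. open U \<and> p \<in> U \<and> (\<forall>i<n. smooth_vector_field_on A U (X i)) \<and> frame_on n U X \<Lambda>)"

text \<open>
  Measurability means Borel measurability. A map into the Grassmannian of \<open>n\<close>-planes is Borel
  measurable iff it locally has a Borel measurable frame.
\<close>

definition measurable_lagrangian_distribution ::
    "nat \<Rightarrow> ('m::topological_space, 'e::euclidean_space) chart set
      \<Rightarrow> ('m \<Rightarrow> ('m, 'e) tvec \<Rightarrow> ('m, 'e) tvec \<Rightarrow> real) \<Rightarrow> ('m \<Rightarrow> ('m, 'e) tvec set) \<Rightarrow> bool"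
  where "measurable_lagrangian_distribution n A \<omega> \<Delta> \<longleftrightarrow>
    (\<forall>p. lagrangian_subspace A \<omega> p (\<Delta> p)) \<and>
    (\<forall>p. \<exists>U X. open U \<and> p \<in> U \<and> (\<forall>i<n. measurable_vector_field_on A U (X i)) \<and> frame_on n U X \<Delta>)"

definition smooth_section_on ::
    "('m, 'e::euclidean_space) chart set \<Rightarrow> ('m \<Rightarrow> ('m, 'e) tvec set) \<Rightarrow> 'm set
      \<Rightarrow> ('m \<Rightarrow> ('m, 'e) tvec) \<Rightarrow> bool"
  where "smooth_section_on A \<Lambda> U V \<longleftrightarrow> smooth_vector_field_on A U V \<and> (\<forall>p\<in>U. V p \<in> \<Lambda> p)"

text \<open>
  The form \<open>\<langle>V1, V2\<rangle> = \<omega>([X, V1], V2)\<close> on sections of \<open>\<Lambda>\<close>. It is tensorial, and every vector of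
  \<open>\<Lambda> p\<close> extends to a section of \<open>\<Lambda>\<close> near \<open>p\<close>, so it is positive definite on \<open>\<Lambda> p\<close> iff
  \<open>\<langle>V, V\<rangle>\<close> is positive at \<open>p\<close> for every local section \<open>V\<close> that does not vanish at \<open>p\<close>.
\<close>

definition bracket_form ::
    "('m, 'e::euclidean_space) chart set \<Rightarrow> ('m \<Rightarrow> ('m, 'e) tvec \<Rightarrow> ('m, 'e) tvec \<Rightarrow> real)
      \<Rightarrow> ('m \<Rightarrow> ('m, 'e) tvec) \<Rightarrow> ('m \<Rightarrow> ('m, 'e) tvec) \<Rightarrow> ('m \<Rightarrow> ('m, 'e) tvec) \<Rightarrow> 'm \<Rightarrow> real"
  where "bracket_form A \<omega> X V1 V2 p = \<omega> p (lie_bracket A X V1 p) (V2 p)"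

definition monotone_field ::
    "('m::topological_space, 'e::euclidean_space) chart set
      \<Rightarrow> ('m \<Rightarrow> ('m, 'e) tvec \<Rightarrow> ('m, 'e) tvec \<Rightarrow> real) \<Rightarrow> ('m \<Rightarrow> ('m, 'e) tvec set)
      \<Rightarrow> ('m \<Rightarrow> ('m, 'e) tvec) \<Rightarrow> bool"
  where "monotone_field A \<omega> \<Lambda> X \<longleftrightarrow>
    (\<forall>p U V. open U \<and> p \<in> U \<and> smooth_section_on A \<Lambda> U V \<and> V p \<noteq> 0
       \<longrightarrow> bracket_form A \<omega> X V V p > 0)"

definition no_conjugate_points ::
    "('m, 'e::euclidean_space) chart set \<Rightarrow> ('m \<Rightarrow> ('m, 'e) tvec set) \<Rightarrow> (real \<Rightarrow> 'm \<Rightarrow> 'm) \<Rightarrow> bool"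
  where "no_conjugate_points A \<Lambda> \<Phi> \<longleftrightarrow>
    (\<forall>p t. t \<noteq> 0 \<longrightarrow> tangent_map A (\<Phi> t) p ` \<Lambda> p \<inter> \<Lambda> (\<Phi> t p) = {0})"

definition invariant_distribution ::
    "('m, 'e::euclidean_space) chart set \<Rightarrow> (real \<Rightarrow> 'm \<Rightarrow> 'm) \<Rightarrow> ('m \<Rightarrow> ('m, 'e) tvec set) \<Rightarrow> bool"
  where "invariant_distribution A \<Phi> \<Delta> \<longleftrightarrow>
    (\<forall>p t. tangent_map A (\<Phi> t) p ` \<Delta> p = \<Delta> (\<Phi> t p))"

end

theory Submission
  imports Defs
begin

text \<open>
  Pulling \<open>\<Lambda>\<close> back along the orbit of \<open>p\<close> gives the curve \<open>L t = d\<Phi>\<^bsub>-t\<^esub> (\<Lambda> (\<Phi> t p))\<close> of Lagrangian subspaces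
  of the symplectic vector space \<open>T\<^sub>p M\<close>. Absence of conjugate points says that it is pairwise transversal,
  and its velocity at \<open>t\<close> is the form \<open>\<omega> ([X, V], V)\<close>, so monotonicity makes the curve increasing. For
  \<open>s < r < t\<close> write \<open>x \<in> L r\<close> as \<open>a + b\<close> with \<open>a \<in> L s\<close>, \<open>b \<in> L t\<close>. The quadratic form \<open>\<omega> (a, x)\<close> on \<open>L r\<close> is
  nondegenerate by transversality and negative definite for \<open>t\<close> slightly above \<open>r\<close> by monotonicity, hence
  negative definite for all \<open>t > r\<close> by connectedness. Applied to the triples \<open>(-1, t, t')\<close> and \<open>(-2, -1, t)\<close>,
  this shows that the quadratic forms describing \<open>L t\<close> as a graph over \<open>L 0\<close> along \<open>L (-1)\<close> are monotone and
  bounded in \<open>t\<close>. So \<open>L t\<close> converges as \<open>t\<close> tends to infinity; the limit is Lagrangian, invariant because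
  \<open>d\<Phi>\<^sub>s (L t) = L (t - s)\<close> at \<open>\<Phi> s p\<close>, and measurable as a pointwise limit of continuous distributions. As
  \<open>\<Delta>\<^sup>+\<close> and \<open>\<Delta>\<^sup>-\<close> need not differ, this limit serves as both.
\<close>

section \<open>Monotone curves of Lagrangian subspaces\<close>

text \<open>The Lagrangian subspaces transversal to a fixed \<open>L s\<close> form an affine chart
  of the Lagrangian Grassmannian, with the quadratic forms on another member \<open>L r\<close> as
  coordinates. In it convergence of \<open>L t\<close> becomes convergence of one real function of t
  for each x in \<open>L r\<close>. The obstacle is escape from the chart as t tends to infinity;
  the barrier against it is a member of the curve from before time s. Compactness of the
  Grassmannian would only give limits along subsequences, which need not respect the time shift
  behind invariance. The construction is that of the Green bundles of geodesic flows without
  conjugate points.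

  The reference times have separate roles: at 0 the curve is \<open>\<Lambda> p\<close> itself, so a
  frame of \<Lambda> turns into a frame of the limit; -1 differs from all integer times along which
  measurability is tested; -2 supplies the barrier.

  The link to the manifold is made by two first-order computations in a chart, invariance of the
  symplectic form and velocity of pulled back sections. Both rest on the symmetry of the second
  derivatives of the flow in time and space.\<close>

lemma direct_sum_unique:
  fixes a b a' b' :: "'a::real_vector"
  assumes "subspace A" "subspace B" "A \<inter> B = {0}" "a \<in> A" "a' \<in> A" "b \<in> B" "b' \<in> B" "a + b = a' + b'"
  shows "a = a'" "b = b'"
proof -
  have "a - a' = b' - b" using assms(8) by (simp add: algebra_simps)
  moreover have "a - a' \<in> A" "b' - b \<in> B" using assms by (auto intro: subspace_diff)
  ultimately have "a - a' \<in> A \<inter> B" by auto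
  then show "a = a'" using assms(3) by auto
  then show "b = b'" using assms(8) by simp
qed

text \<open>If the summands \<open>A k\<close>, \<open>B k\<close> contain vectors converging to the components of each basis vector, then
  the maps assembled from these vectors converge to the identity and are eventually invertible.\<close>

lemma decomposition_tendsto:
  fixes A B :: "'k \<Rightarrow> 'e::euclidean_space set" and a b :: "'k \<Rightarrow> 'e"
  assumes sum: "\<And>v. \<exists>a\<in>A0. \<exists>b\<in>B0. v = a + b"
    and sub0: "subspace A0" "subspace B0" "A0 \<inter> B0 = {0}"
    and lscA: "\<And>v. v \<in> A0 \<Longrightarrow> \<exists>f. (\<forall>\<^sub>F k in F. f k \<in> A k) \<and> (f \<longlongrightarrow> v) F"
    and lscB: "\<And>v. v \<in> B0 \<Longrightarrow> \<exists>f. (\<forall>\<^sub>F k in F. f k \<in> B k) \<and> (f \<longlongrightarrow> v) F"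
    and sub: "\<forall>\<^sub>F k in F. subspace (A k) \<and> subspace (B k) \<and> A k \<inter> B k = {0}"
    and mem: "\<forall>\<^sub>F k in F. a k \<in> A k \<and> b k \<in> B k"
    and lim: "((\<lambda>k. a k + b k) \<longlongrightarrow> a0 + b0) F"
    and mem0: "a0 \<in> A0" "b0 \<in> B0"
  shows "(a \<longlongrightarrow> a0) F"
proof -
  obtain aa bb where ab: "\<And>v. aa v \<in> A0" "\<And>v. bb v \<in> B0" "\<And>v. v = aa v + bb v"
    using sum by metis
  obtain fA where fA: "\<And>v. \<forall>\<^sub>F k in F. fA v k \<in> A k" "\<And>v. (fA v \<longlongrightarrow> aa v) F"
    using lscA[OF ab(1)] by metis
  obtain fB where fB: "\<And>v. \<forall>\<^sub>F k in F. fB v k \<in> B k" "\<And>v. (fB v \<longlongrightarrow> bb v) F"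
    using lscB[OF ab(2)] by metis
  define P where "P k v = (\<Sum>i\<in>Basis. (v \<bullet> i) *\<^sub>R fA i k)" for k and v :: 'e
  define Q where "Q k v = (\<Sum>i\<in>Basis. (v \<bullet> i) *\<^sub>R fB i k)" for k and v :: 'e
  define N where "N k = (\<Sum>i\<in>Basis. norm (fA i k + fB i k - i))" for k
  have "(N \<longlongrightarrow> (\<Sum>i\<in>Basis. norm (aa i + bb i - i))) F"
    unfolding N_def by (intro tendsto_intros fA fB)
  moreover have "aa i + bb i - i = 0" for i using ab(3)[of i] by simp
  ultimately have N0: "(N \<longlongrightarrow> 0) F" by simp
  have PQ: "norm (P k v + Q k v - v) \<le> N k * norm v" for k v
  proof -
    have "P k v + Q k v - v = (\<Sum>i\<in>Basis. (v \<bullet> i) *\<^sub>R (fA i k + fB i k - i))"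
      unfolding P_def Q_def by (subst (3) euclidean_representation[of v, symmetric])
         (simp add: sum.distrib sum_subtractf scaleR_add_right scaleR_diff_right)
    also have "norm \<dots> \<le> (\<Sum>i\<in>Basis. norm v * norm (fA i k + fB i k - i))"
      by (rule sum_norm_le) (auto intro!: mult_right_mono Basis_le_norm)
    finally show ?thesis unfolding N_def by (simp add: sum_distrib_left mult.commute)
  qed
  have linP: "linear (P k)" and linQ: "linear (Q k)" for k unfolding P_def Q_def
    by (auto intro!: linear_compose_sum linearI simp: algebra_simps sum.distrib scaleR_sum_right)
  have surj: "\<exists>u. P k u + Q k u = x" if "N k < 1/2" for k x
  proof -
    have lin: "linear (\<lambda>v. P k v + Q k v)" using linP linQ by (rule linear_compose_add)
    have "v = 0" if "P k v + Q k v = 0" for v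
    proof -
      have "norm v \<le> N k * norm v" using PQ[of k v] that by simp
      also have "\<dots> \<le> 1/2 * norm v" using \<open>N k < 1/2\<close> by (intro mult_right_mono) auto
      finally show ?thesis by simp
    qed
    then have "inj (\<lambda>v. P k v + Q k v)" using lin linear_injective_0 by blast
    then have "surj (\<lambda>v. P k v + Q k v)" using lin linear_injective_imp_surjective by blast
    then show ?thesis unfolding surj_def by (elim allE[of _ x]) (auto simp: eq_commute)
  qed
  \<comment> \<open>\<open>u k\<close> solves the perturbed equation exactly. By uniqueness of
    components \<open>P k (u k)\<close> then equals \<open>a k\<close>, and its limit is computable
    because \<open>u k\<close> tends to \<open>a0 + b0\<close>.\<close>
  define u where "u k = (SOME u. P k u + Q k u = a k + b k)" for k
  have evN: "\<forall>\<^sub>F k in F. N k < 1/2" using N0 by (rule order_tendstoD) simp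
  have u: "P k (u k) + Q k (u k) = a k + b k" if "N k < 1/2" for k
    unfolding u_def by (rule someI_ex) (rule surj[OF that])
  have bound: "norm (u k - (a k + b k)) \<le> 2 * N k * norm (a k + b k)" if N: "N k < 1/2" for k
  proof -
    have 1: "norm (u k - (a k + b k)) \<le> N k * norm (u k)" using PQ[of k "u k"] u[OF N]
      by (simp add: norm_minus_commute)
    have N_ge: "N k \<ge> 0" unfolding N_def by (intro sum_nonneg) auto
    have "norm (u k) \<le> norm (u k - (a k + b k)) + norm (a k + b k)"
      by (metis diff_add_cancel norm_triangle_ineq)
    also have "\<dots> \<le> 1/2 * norm (u k) + norm (a k + b k)"
      using 1 mult_right_mono[of "N k" "1/2" "norm (u k)"] N by auto
    finally have "norm (u k) \<le> 2 * norm (a k + b k)" by simp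
    then have "N k * norm (u k) \<le> N k * (2 * norm (a k + b k))" using N_ge by (rule mult_left_mono)
    then show ?thesis using 1 by simp
  qed
  have "((\<lambda>k. u k - (a k + b k)) \<longlongrightarrow> 0) F"
  proof (rule Lim_null_comparison)
    show "\<forall>\<^sub>F k in F. norm (u k - (a k + b k)) \<le> 2 * N k * norm (a k + b k)"
      using evN by eventually_elim (rule bound)
    show "((\<lambda>k. 2 * N k * norm (a k + b k)) \<longlongrightarrow> 0) F"
      using tendsto_mult[OF tendsto_mult[OF tendsto_const[of 2] N0] tendsto_norm[OF lim]] by simp
  qed
  from tendsto_add[OF this lim] have ulim: "(u \<longlongrightarrow> a0 + b0) F" by simp
  have Plim: "((\<lambda>k. P k (u k)) \<longlongrightarrow> (\<Sum>i\<in>Basis. ((a0 + b0) \<bullet> i) *\<^sub>R aa i)) F"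
    unfolding P_def by (intro tendsto_intros fA ulim)
  have "(\<Sum>i\<in>Basis. ((a0 + b0) \<bullet> i) *\<^sub>R aa i) = a0"
  proof (rule direct_sum_unique(1)[OF sub0])
    show "(\<Sum>i\<in>Basis. ((a0 + b0) \<bullet> i) *\<^sub>R aa i) + (\<Sum>i\<in>Basis. ((a0 + b0) \<bullet> i) *\<^sub>R bb i) = a0 + b0"
      using euclidean_representation[of "a0 + b0"] unfolding sum.distrib[symmetric] scaleR_add_right[symmetric]
      by (simp only: ab(3)[symmetric])
  qed (use ab mem0 sub0 in \<open>auto intro!: subspace_sum subspace_scale\<close>)
  with Plim have "((\<lambda>k. P k (u k)) \<longlongrightarrow> a0) F" by simp
  moreover have "\<forall>\<^sub>F k in F. (\<forall>i\<in>Basis. fA i k \<in> A k) \<and> (\<forall>i\<in>Basis. fB i k \<in> B k)"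
    by (intro eventually_conj eventually_ball_finite) (auto simp: fA fB)
  then have "\<forall>\<^sub>F k in F. P k (u k) = a k"
    using sub mem evN
  proof eventually_elim
    case (elim k)
    have "P k (u k) \<in> A k" "Q k (u k) \<in> B k" unfolding P_def Q_def
      using elim by (auto intro!: subspace_sum subspace_scale)
    then show ?case using direct_sum_unique(1)[of "A k" "B k"] u[of k] elim by blast
  qed
  ultimately show ?thesis by (rule Lim_transform_eventually)
qed

text \<open>A linear map on a finite-dimensional space is determined by its values on
  \<open>Basis\<close>, so convergence there is locally uniform and allows the argument to vary as
  well.\<close>

lemma linear_pointwise_tendsto:
  fixes S :: "'k \<Rightarrow> 'e::euclidean_space \<Rightarrow> 'f::real_normed_vector"
  assumes "\<And>i. i \<in> Basis \<Longrightarrow> ((\<lambda>k. S k i) \<longlongrightarrow> S0 i) F" "\<forall>\<^sub>F k in F. linear (S k)" "linear S0" "(u \<longlongrightarrow> u0) F"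
  shows "((\<lambda>k. S k (u k)) \<longlongrightarrow> S0 u0) F"
proof -
  have eq: "T v = (\<Sum>i\<in>Basis. (v \<bullet> i) *\<^sub>R T i)" if "linear T" for T :: "'e \<Rightarrow> 'f" and v
    by (subst (1) euclidean_representation[of v, symmetric]) (simp only: linear_sum[OF that] linear_scale[OF that])
  have "((\<lambda>k. \<Sum>i\<in>Basis. (u k \<bullet> i) *\<^sub>R S k i) \<longlongrightarrow> S0 u0) F"
    unfolding eq[OF assms(3), of u0] by (intro tendsto_intros assms)
  then show ?thesis
    by (rule Lim_transform_eventually) (use assms(2) eq in \<open>auto elim!: eventually_mono\<close>)
qed

text \<open>A tube lemma. It turns inequalities near each point of the unit sphere of
  \<open>L r\<close> into one that holds on the whole sphere for all t close to the limit.\<close>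

lemma eventually_compact_uniform:
  fixes K :: "'a::topological_space set"
  assumes "compact K" and P: "\<And>x. x \<in> K \<Longrightarrow> \<forall>\<^sub>F (t, y) in F \<times>\<^sub>F nhds x. P t y"
  shows "\<forall>\<^sub>F t in F. \<forall>y\<in>K. P t y"
proof -
  have "\<exists>U. open U \<and> x \<in> U \<and> (\<forall>\<^sub>F t in F. \<forall>y\<in>U. P t y)" if x: "x \<in> K" for x
  proof -
    from P[OF x] obtain Pf Pg where ev: "eventually Pf F" "eventually Pg (nhds x)"
      and imp: "\<And>t y. Pf t \<Longrightarrow> Pg y \<Longrightarrow> P t y"
      unfolding eventually_prod_filter by auto
    from ev(2) obtain U where U: "open U" "x \<in> U" "\<And>y. y \<in> U \<Longrightarrow> Pg y"
      unfolding eventually_nhds by auto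
    have "\<forall>\<^sub>F t in F. \<forall>y\<in>U. P t y" using ev(1) by (rule eventually_mono) (use U imp in auto)
    with U show ?thesis by blast
  qed
  then obtain U where U: "\<And>x. x \<in> K \<Longrightarrow> open (U x) \<and> x \<in> U x \<and> (\<forall>\<^sub>F t in F. \<forall>y\<in>U x. P t y)"
    by metis
  obtain D where D: "D \<subseteq> K" "finite D" "K \<subseteq> (\<Union>x\<in>D. U x)"
    proof (rule compactE_image[OF \<open>compact K\<close>, of K U])
    show "K \<subseteq> (\<Union>x\<in>K. U x)" using U by blast
  qed (use U in auto)
  have "\<forall>\<^sub>F t in F. \<forall>x\<in>D. \<forall>y\<in>U x. P t y"
    using D U by (intro eventually_ball_finite) auto
  then show ?thesis by (rule eventually_mono) (use D in blast)
qed

lemma open_if_eventually_nhds: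
  assumes "\<And>x. x \<in> S \<Longrightarrow> \<forall>\<^sub>F y in nhds x. y \<in> S"
  shows "open S"
proof (subst open_subopen, intro ballI)
  fix x assume "x \<in> S"
  from assms[OF this] obtain T where "open T" "x \<in> T" "\<forall>y\<in>T. y \<in> S" unfolding eventually_nhds by blast
  then show "\<exists>T. open T \<and> x \<in> T \<and> T \<subseteq> S" by (intro exI[of _ T]) auto
qed

lemma has_vector_derivative_quotient:
  assumes "(f has_vector_derivative D) (at r)"
  shows "((\<lambda>t. (1 / (t - r)) *\<^sub>R (f t - f r)) \<longlongrightarrow> D) (at r)"
proof -
  have lim: "((\<lambda>t. norm (f t - f r - (t - r) *\<^sub>R D) / norm (t - r)) \<longlongrightarrow> 0) (at r)"
    using assms unfolding has_vector_derivative_def has_derivative_iff_norm by blast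
  have eq: "norm (f t - f r - (t - r) *\<^sub>R D) / norm (t - r) = norm ((1 / (t - r)) *\<^sub>R (f t - f r) - D)"
    if "t \<noteq> r" for t
  proof -
    have "(1 / (t - r)) *\<^sub>R (f t - f r) - D = (1 / (t - r)) *\<^sub>R (f t - f r - (t - r) *\<^sub>R D)"
      using that by (simp add: scaleR_diff_right)
    then show ?thesis by (simp add: divide_inverse_commute)
  qed
  from lim have "((\<lambda>t. norm ((1 / (t - r)) *\<^sub>R (f t - f r) - D)) \<longlongrightarrow> 0) (at r)"
    by (rule Lim_transform_eventually) (use eq in \<open>force simp: eventually_at_filter\<close>)
  then show ?thesis using Lim_null tendsto_norm_zero_iff by blast
qed

text \<open>The abstract form of the pulled back curve, read in coordinates. In
  \<open>monotone\<close>, \<open>G t\<close> is a local trivialisation that carries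
  \<open>L r\<close> into \<open>L t\<close> and is the identity on \<open>L r\<close> at time r;
  \<open>w (G' x) x\<close> is then the velocity of the curve at r, a quadratic form on
  \<open>L r\<close> that does not depend on the choice of G.\<close>

locale monotone_lagrangian_curve =
  fixes w :: "'e::euclidean_space \<Rightarrow> 'e \<Rightarrow> real" and L :: "real \<Rightarrow> 'e set" and n :: nat
  assumes bilinear: "bilinear w"
    and skew: "w u v = - w v u"
    and dim_total: "DIM('e) = 2 * n"
    and subspace_L: "subspace (L t)"
    and lagrangian_L: "L t = {v. \<forall>u\<in>L t. w v u = 0}"
    and dim_L: "dim (L t) = n"
    and transversal: "s \<noteq> t \<Longrightarrow> L s \<inter> L t = {0}"
    and monotone: "\<exists>G G'. (\<forall>t. linear (G t)) \<and> linear G' \<and> (\<forall>\<^sub>F t in at r. \<forall>x\<in>L r. G t x \<in> L t) \<and>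
       (\<forall>x. ((\<lambda>t. G t x) has_vector_derivative G' x) (at r)) \<and>
       (\<forall>x\<in>L r. G r x = x \<and> (x \<noteq> 0 \<longrightarrow> w (G' x) x > 0))"
begin

lemmas w_simps = bilinear_ladd[OF bilinear] bilinear_radd[OF bilinear] bilinear_lmul[OF bilinear]
  bilinear_rmul[OF bilinear] bilinear_lneg[OF bilinear] bilinear_rneg[OF bilinear]
  bilinear_lsub[OF bilinear] bilinear_rsub[OF bilinear] bilinear_lzero[OF bilinear] bilinear_rzero[OF bilinear]

lemmas tendsto_w [tendsto_intros] =
  bounded_bilinear.tendsto[OF bilinear[unfolded bilinear_conv_bounded_bilinear]]

section \<open>Decomposition along two members of the curve\<close>

lemma isotropic: "u \<in> L t \<Longrightarrow> v \<in> L t \<Longrightarrow> w u v = 0"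
  using lagrangian_L[of t] by blast

lemma coisotropic: "(\<And>u. u \<in> L t \<Longrightarrow> w v u = 0) \<Longrightarrow> v \<in> L t"
  using lagrangian_L[of t] by blast

lemma sum_L: "s \<noteq> t \<Longrightarrow> \<exists>a\<in>L s. \<exists>b\<in>L t. v = a + b"
proof -
  assume st: "s \<noteq> t"
  let ?S = "{x + y |x y. x \<in> L s \<and> y \<in> L t}"
  have "dim ?S = DIM('e)"
    using dim_sums_Int[OF subspace_L[of s] subspace_L[of t]] transversal[OF st] dim_L dim_total by simp
  moreover have "subspace ?S" using subspace_sums[OF subspace_L subspace_L] .
  ultimately have "?S = UNIV" using dim_eq_full[of ?S] span_eq_iff[of ?S] by simp
  then show ?thesis by blast
qed

text \<open>For fixed s the subspace \<open>L t\<close> is the kernel of \<open>pr s t\<close>, so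
  convergence of the subspaces is studied through these maps. The value carries no information when
  s = t.\<close>

definition pr :: "real \<Rightarrow> real \<Rightarrow> 'e \<Rightarrow> 'e"
  where "pr s t x = (SOME a. a \<in> L s \<and> x - a \<in> L t)"

lemma pr_mem: assumes "s \<noteq> t" shows "pr s t x \<in> L s" "x - pr s t x \<in> L t"
proof -
  have "\<exists>a. a \<in> L s \<and> x - a \<in> L t"
    using sum_L[OF assms, of x] by (metis add_diff_cancel_left')
  then have "pr s t x \<in> L s \<and> x - pr s t x \<in> L t" unfolding pr_def by (rule someI_ex)
  then show "pr s t x \<in> L s" "x - pr s t x \<in> L t" by auto
qed

lemma pr_unique: "s \<noteq> t \<Longrightarrow> a \<in> L s \<Longrightarrow> x - a \<in> L t \<Longrightarrow> pr s t x = a"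
  using direct_sum_unique(1)[OF subspace_L subspace_L transversal pr_mem(1) _ pr_mem(2)]
  by (metis add.commute diff_add_cancel)

lemma linear_pr: assumes "s \<noteq> t" shows "linear (pr s t)"
proof (rule linearI)
  fix x y c
  have "x + y - (pr s t x + pr s t y) = (x - pr s t x) + (y - pr s t y)" by simp
  then show "pr s t (x + y) = pr s t x + pr s t y"
    by (intro pr_unique[OF assms]) (metis pr_mem[OF assms] subspace_L subspace_add)+
  have "c *\<^sub>R x - c *\<^sub>R pr s t x = c *\<^sub>R (x - pr s t x)" by (simp add: algebra_simps)
  then show "pr s t (c *\<^sub>R x) = c *\<^sub>R pr s t x"
    by (intro pr_unique[OF assms]) (metis pr_mem[OF assms] subspace_L subspace_scale)+
qed

text \<open>The trivialisation from \<open>monotone\<close> moves v to the neighbouring subspaces.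
  This is the kind of continuity that \<open>decomposition_tendsto\<close> asks for.\<close>

lemma lsc_L:
  assumes "v \<in> L r" "(\<tau> \<longlongrightarrow> r) F"
  shows "\<exists>f. (\<forall>\<^sub>F k in F. f k \<in> L (\<tau> k)) \<and> (f \<longlongrightarrow> v) F"
proof -
  obtain G G' where G: "\<forall>\<^sub>F t in at r. \<forall>x\<in>L r. G t x \<in> L t"
    "((\<lambda>t. G t v) has_vector_derivative G' v) (at r)" "\<forall>x\<in>L r. G r x = x"
    using monotone[of r] by blast
  have "isCont (\<lambda>t. G t v) r" using G(2) has_vector_derivative_continuous by blast
  then have "((\<lambda>t. G t v) \<longlongrightarrow> G r v) (nhds r)" by (simp add: isCont_def tendsto_nhds_iff)
  from filterlim_compose[OF this assms(2)] have "((\<lambda>k. G (\<tau> k) v) \<longlongrightarrow> v) F" using G(3) assms by simp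
  moreover have "\<forall>\<^sub>F t in nhds r. G t v \<in> L t"
    using G(1) assms G(3) unfolding eventually_at_filter by (auto elim!: eventually_mono)
  then have "\<forall>\<^sub>F k in F. G (\<tau> k) v \<in> L (\<tau> k)" using assms(2) by (rule eventually_compose_filterlim)
  ultimately show ?thesis by (intro exI[of _ "\<lambda>k. G (\<tau> k) v"] conjI)
qed

lemma pr_tendsto:
  assumes "(\<tau> \<longlongrightarrow> r) F" "(x \<longlongrightarrow> x0) F" "s \<noteq> r"
  shows "((\<lambda>k. pr s (\<tau> k) (x k)) \<longlongrightarrow> pr s r x0) F"
proof (rule decomposition_tendsto)
  have ev: "\<forall>\<^sub>F k in F. \<tau> k \<noteq> s"
    using tendsto_imp_eventually_ne[OF assms(1), of s] assms(3) by simp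
  show "\<exists>a\<in>L s. \<exists>b\<in>L r. v = a + b" for v by (rule sum_L[OF assms(3)])
  show "\<forall>\<^sub>F k in F. subspace (L s) \<and> subspace (L (\<tau> k)) \<and> L s \<inter> L (\<tau> k) = {0}"
    using ev by eventually_elim (use subspace_L transversal in auto)
  show "\<forall>\<^sub>F k in F. pr s (\<tau> k) (x k) \<in> L s \<and> x k - pr s (\<tau> k) (x k) \<in> L (\<tau> k)"
    using ev by eventually_elim (use pr_mem in auto)
  show "((\<lambda>k. pr s (\<tau> k) (x k) + (x k - pr s (\<tau> k) (x k))) \<longlongrightarrow> pr s r x0 + (x0 - pr s r x0)) F"
    using assms(2) by simp
  show "\<exists>f. (\<forall>\<^sub>F k in F. f k \<in> L s) \<and> (f \<longlongrightarrow> v) F" if "v \<in> L s" for v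
    using that by (intro exI[of _ "\<lambda>_. v"]) auto
qed (use assms subspace_L transversal pr_mem lsc_L in auto)

text \<open>Expand \<open>w\<close> on the \<open>L t\<close> components of x and y: each of
  \<open>L s\<close>, \<open>L t\<close> and \<open>L r\<close> is isotropic, and only the two mixed
  terms survive. Symmetry later allows polarisation.\<close>

lemma pr_form_symmetric:
  assumes "s \<noteq> t" "x \<in> L r" "y \<in> L r"
  shows "w (pr s t x) y = w (pr s t y) x"
proof -
  have "w (x - pr s t x) (y - pr s t y) = 0" "w (pr s t x) (pr s t y) = 0" "w x y = 0"
    using isotropic pr_mem assms by blast+
  then show ?thesis using skew[of x "pr s t y"] by (simp add: w_simps)
qed

text \<open>If the form were nonpositive on \<open>L r\<close>, the vector x would be a null vector
  and hence lie in the radical. The radical is trivial: if \<open>pr s t x\<close> is orthogonal to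
  \<open>L r\<close>, it lies in \<open>L s \<inter> L r\<close> and vanishes, so x lies in
  \<open>L t \<inter> L r\<close>. Failure of negative definiteness thus always yields a strictly
  positive value.\<close>

lemma pr_form_degenerate:
  assumes "s \<noteq> t" "s \<noteq> r" "t \<noteq> r" "x \<in> L r" "x \<noteq> 0" "w (pr s t x) x \<ge> 0"
  shows "\<exists>y\<in>L r. w (pr s t y) y > 0"
proof (rule ccontr)
  assume neg: "\<not> ?thesis"
  have q0: "w (pr s t x) x = 0" using neg assms by force
  have "w (pr s t x) y = 0" if y: "y \<in> L r" for y
  proof (rule ccontr)
    define B where "B = w (pr s t x) y"
    define q where "q = w (pr s t y) y"
    assume "w (pr s t x) y \<noteq> 0"
    then have B: "B \<noteq> 0" by (simp add: B_def)
    have eq: "w (pr s t (x + e *\<^sub>R y)) (x + e *\<^sub>R y) = e * (2 * B + e * q)" for e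
      using q0 pr_form_symmetric[OF assms(1) y assms(4)]
      by (simp add: linear_add[OF linear_pr[OF assms(1)]] linear_scale[OF linear_pr[OF assms(1)]]
          w_simps B_def q_def algebra_simps)
    have le: "e * (2 * B + e * q) \<le> 0" for e
    proof -
      have "x + e *\<^sub>R y \<in> L r" using y assms(4) subspace_L by (intro subspace_add subspace_scale)
      then show ?thesis unfolding eq[symmetric] using neg not_le by blast
    qed
    show False
    proof (cases "q = 0")
      case True
      then show False using le[of B] B by (auto simp: mult_le_0_iff)
    next
      case False
      moreover have "q \<le> 0" using neg y unfolding q_def by force
      ultimately have "q < 0" by simp
      \<comment> \<open>The parameter \<open>- B / q\<close> maximises the concave quadratic
        \<open>e * (2 * B + e * q)\<close>; its value there is positive.\<close>
      have "(- B / q) * (2 * B + (- B / q) * q) = - (B * B) / q" using False by (simp add: field_simps)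
      with le[of "- B / q"] have "- (B * B) / q \<le> 0" by linarith
      moreover have "B * B > 0" using B by (simp add: zero_less_mult_iff) linarith
      ultimately show False using \<open>q < 0\<close> by (simp add: divide_le_0_iff zero_le_divide_iff)
    qed
  qed
  then have "pr s t x \<in> L r" by (rule coisotropic)
  then have "pr s t x = 0" using transversal[OF assms(2)] pr_mem(1)[OF assms(1)] by blast
  then have "x \<in> L t" using pr_mem(2)[OF assms(1), of x] by simp
  then show False using transversal[OF assms(3)] assms(4,5) by blast
qed

section \<open>Negative definiteness of the projection forms\<close>

lemma compact_unit_L: "compact (L r \<inter> sphere 0 1)"
  by (intro closed_Int_compact closed_subspace subspace_L) auto

lemma pr_form_scale: "s \<noteq> t \<Longrightarrow> w (pr s t (c *\<^sub>R x)) (c *\<^sub>R x) = c\<^sup>2 * w (pr s t x) x"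
  by (simp add: linear_scale[OF linear_pr] w_simps power2_eq_square)

lemma pr_form_normalize:
  assumes "s \<noteq> t" "\<forall>x\<in>L r \<inter> sphere 0 1. w (pr s t x) x < 0" "x \<in> L r" "x \<noteq> 0"
  shows "w (pr s t x) x < 0"
proof -
  have "(1 / norm x) *\<^sub>R x \<in> L r \<inter> sphere 0 1" using assms subspace_L by (auto intro: subspace_scale)
  then have "(1 / norm x)\<^sup>2 * w (pr s t x) x < 0" using assms(2) pr_form_scale[OF assms(1)] by metis
  then show ?thesis using assms(4) by (simp add: mult_less_0_iff)
qed

text \<open>For x in \<open>L r\<close> the vector \<open>G t x\<close> lies in \<open>L t\<close>
  and is killed by \<open>pr s t\<close>, so to first order \<open>pr s t x\<close> is
  \<open>- (t - r)\<close> times the \<open>L s\<close> component of the velocity. Paired with x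
  this is negative for t > r by \<open>monotone\<close>.\<close>

lemma pr_form_neg_near:
  assumes "s < r"
  shows "\<forall>\<^sub>F t in at_right r. \<forall>x\<in>L r \<inter> sphere 0 1. w (pr s t x) x < 0"
proof -
  obtain G G' where "\<forall>t. linear (G t)" and linG': "linear G'"
    and mem: "\<forall>\<^sub>F t in at r. \<forall>x\<in>L r. G t x \<in> L t"
    and "\<forall>x. ((\<lambda>t. G t x) has_vector_derivative G' x) (at r)"
    and "\<forall>x\<in>L r. G r x = x \<and> (x \<noteq> 0 \<longrightarrow> w (G' x) x > 0)"
    using monotone[of r] by (elim exE conjE)
  then have linG: "\<And>t. linear (G t)"
    and der: "\<And>x. ((\<lambda>t. G t x) has_vector_derivative G' x) (at r)"
    and Gr: "\<And>x. x \<in> L r \<Longrightarrow> G r x = x" and pos: "\<And>x. x \<in> L r \<Longrightarrow> x \<noteq> 0 \<Longrightarrow> w (G' x) x > 0"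
    by auto
  have sr: "s \<noteq> r" "r \<noteq> s" using assms by auto
  define D where "D t x = (1 / (t - r)) *\<^sub>R (G t x - G r x)" for t x
  have linD: "linear (D t)" for t unfolding D_def
    using linG by (intro linear_compose_scale_right linear_compose_sub)
  have Dlim: "((\<lambda>t. D t x) \<longlongrightarrow> G' x) (at_right r)" for x
    using has_vector_derivative_quotient[OF der[of x]] unfolding D_def by (rule tendsto_within_subset) simp
  \<comment> \<open>The tube lemma lets the point vary in a full neighbourhood of x, so
    \<open>pr r s\<close> first returns it to \<open>L r\<close>; on \<open>L r\<close> itself this
    is the identity.\<close>
  have "\<forall>\<^sub>F t in at_right r. \<forall>x\<in>L r \<inter> sphere 0 1. w (pr s t (pr r s x)) (pr r s x) < 0"
  proof (rule eventually_compact_uniform[OF compact_unit_L])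
    fix x assume x: "x \<in> L r \<inter> sphere 0 1"
    let ?F = "at_right r \<times>\<^sub>F nhds x"
    have f1: "filterlim fst (at_right r) ?F" and f2: "filterlim snd (nhds x) ?F"
      by (rule filterlim_fst filterlim_snd)+
    have \<tau>: "(fst \<longlongrightarrow> r) ?F" using f1 by (rule filterlim_mono) (auto simp: at_within_le_nhds)
    have prx: "pr r s x = x" using x sr by (intro pr_unique) (auto simp: subspace_0 subspace_L)
    have y: "((\<lambda>k. pr r s (snd k)) \<longlongrightarrow> x) ?F"
      using linear_pointwise_tendsto[OF tendsto_const always_eventually[OF allI[OF linear_pr[OF sr(2)]]] linear_pr[OF sr(2)] f2] prx by simp
    have "((\<lambda>k. D (fst k) (pr r s (snd k))) \<longlongrightarrow> G' x) ?F"
      by (rule linear_pointwise_tendsto[where S = "\<lambda>k. D (fst k)", OF filterlim_compose[OF Dlim f1] always_eventually[OF allI[OF linD]] linG' y])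
    then have "((\<lambda>k. w (pr s (fst k) (D (fst k) (pr r s (snd k)))) (pr r s (snd k))) \<longlongrightarrow> w (pr s r (G' x)) x) ?F"
      by (intro tendsto_w pr_tendsto \<tau> y sr)
    \<comment> \<open>Replacing the velocity by its \<open>L s\<close> component changes it by an
      element of \<open>L r\<close>, which is orthogonal to x.\<close>
    moreover have "w (G' x - pr s r (G' x)) x = 0" using isotropic pr_mem(2)[OF sr(1)] x by blast
    then have "w (pr s r (G' x)) x > 0" using pos[of x] x by (cases "x = 0") (auto simp: w_simps)
    ultimately have "\<forall>\<^sub>F k in ?F. w (pr s (fst k) (D (fst k) (pr r s (snd k)))) (pr r s (snd k)) > 0"
      by (rule order_tendstoD)
    moreover have "\<forall>\<^sub>F k in ?F. fst k > r"
      using f1 by (rule eventually_compose_filterlim[rotated]) (rule eventually_at_right_less)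
    moreover have "\<forall>\<^sub>F t in at_right r. \<forall>x\<in>L r. G t x \<in> L t"
      using mem by (rule filter_leD[rotated]) (auto simp: at_le)
    then have "\<forall>\<^sub>F k in ?F. \<forall>x\<in>L r. G (fst k) x \<in> L (fst k)"
      using f1 by (rule eventually_compose_filterlim)
    ultimately have "\<forall>\<^sub>F k in ?F. w (pr s (fst k) (pr r s (snd k))) (pr r s (snd k)) < 0"
    proof eventually_elim
      case (elim k)
      define t y where "t = fst k" and "y = pr r s (snd k)"
      have t: "t > r" "s \<noteq> t" and y: "y \<in> L r" using elim assms pr_mem sr by (auto simp: t_def y_def)
      have "G t y \<in> L t" using elim y unfolding t_def by blast
      then have "pr s t (G t y) = 0" using t subspace_L by (intro pr_unique) (auto simp: subspace_0)
      moreover have "y = G t y - (t - r) *\<^sub>R D t y" using Gr[OF y] t by (simp add: D_def)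
      then have "pr s t y = pr s t (G t y) - (t - r) *\<^sub>R pr s t (D t y)"
        by (metis linear_pr[OF t(2)] linear_diff linear_scale)
      ultimately have "w (pr s t y) y = - ((t - r) * w (pr s t (D t y)) y)" by (simp add: w_simps)
      then show ?case using elim(1) t unfolding t_def[symmetric] y_def[symmetric] by (simp add: mult_pos_pos)
    qed
    then show "\<forall>\<^sub>F (t, y) in ?F. w (pr s t (pr r s y)) (pr r s y) < 0" by (simp add: case_prod_unfold)
  qed
  moreover have "pr r s x = x" if "x \<in> L r" for x
    using that sr by (intro pr_unique) (auto simp: subspace_0 subspace_L)
  ultimately show ?thesis by (elim eventually_mono) simp
qed

text \<open>A connectedness argument on the half line of times after r. The good times form an open
  set by compactness of the unit sphere, nonempty by \<open>pr_form_neg_near\<close>.\<close>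

lemma pr_form_neg_aux:
  assumes "s < r" "r < t"
  shows "\<forall>x\<in>L r \<inter> sphere 0 1. w (pr s t x) x < 0"
proof -
  let ?good = "\<lambda>t. \<forall>x\<in>L r \<inter> sphere 0 1. w (pr s t x) x < 0"
  have "open {t. r < t \<and> ?good t}"
  proof (rule open_if_eventually_nhds)
    fix t assume "t \<in> {t. r < t \<and> ?good t}"
    then have t: "r < t" and good: "?good t" by auto
    have st: "s \<noteq> t" using t assms by auto
    have "\<forall>\<^sub>F t' in nhds t. ?good t'"
    proof (rule eventually_compact_uniform[OF compact_unit_L])
      fix x assume x: "x \<in> L r \<inter> sphere 0 1"
      have "((\<lambda>k. w (pr s (fst k) (snd k)) (snd k)) \<longlongrightarrow> w (pr s t x) x) (nhds t \<times>\<^sub>F nhds x)"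
        by (intro tendsto_w pr_tendsto filterlim_fst filterlim_snd st)
      then have "\<forall>\<^sub>F k in nhds t \<times>\<^sub>F nhds x. w (pr s (fst k) (snd k)) (snd k) < 0"
        using good x by (intro order_tendstoD) auto
      then show "\<forall>\<^sub>F (t', y) in nhds t \<times>\<^sub>F nhds x. w (pr s t' y) y < 0" by (simp add: case_prod_unfold)
    qed
    moreover have "\<forall>\<^sub>F t' in nhds t. r < t'" using t by (intro order_tendstoD(1)[OF filterlim_ident])
    ultimately show "\<forall>\<^sub>F t' in nhds t. t' \<in> {t. r < t \<and> ?good t}" by eventually_elim auto
  qed
  \<comment> \<open>By \<open>pr_form_degenerate\<close> a bad time has a vector with strictly
    positive value, and this sign persists for nearby times.\<close>
  moreover have "open {t. r < t \<and> \<not> ?good t}"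
  proof (rule open_if_eventually_nhds)
    fix t assume "t \<in> {t. r < t \<and> \<not> ?good t}"
    then obtain x where t: "r < t" and x: "x \<in> L r" "x \<in> sphere 0 1" "\<not> w (pr s t x) x < 0" by auto
    have st: "s \<noteq> t" using t assms by auto
    obtain y where y: "y \<in> L r" "w (pr s t y) y > 0"
      using pr_form_degenerate[OF st _ _ x(1)] x t assms by force
    have "((\<lambda>t'. w (pr s t' y) y) \<longlongrightarrow> w (pr s t y) y) (nhds t)"
      by (intro tendsto_w pr_tendsto filterlim_ident st tendsto_const)
    then have "\<forall>\<^sub>F t' in nhds t. w (pr s t' y) y > 0" using y(2) by (rule order_tendstoD)
    moreover have "\<forall>\<^sub>F t' in nhds t. r < t'" using t by (intro order_tendstoD(1)[OF filterlim_ident])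
    ultimately show "\<forall>\<^sub>F t' in nhds t. t' \<in> {t. r < t \<and> \<not> ?good t}"
    proof eventually_elim
      case (elim t')
      have st': "s \<noteq> t'" using elim assms by auto
      have "y \<noteq> 0" using elim by (auto simp: w_simps)
      then have "\<not> ?good t'" using pr_form_normalize[OF st' _ y(1)] elim by force
      with elim show ?case by simp
    qed
  qed
  moreover obtain b where "b > r" "\<And>t. r < t \<Longrightarrow> t < b \<Longrightarrow> ?good t"
    using pr_form_neg_near[OF assms(1)] unfolding eventually_at_right_field by metis
  then obtain t0 where "r < t0" "?good t0" using dense by metis
  ultimately show ?thesis
    using connectedD[OF connected_Ioi[of r], of "{t. r < t \<and> ?good t}" "{t. r < t \<and> \<not> ?good t}"] assms(2) by blast
qed

lemma pr_form_neg:
  assumes "s < r" "r < t" "x \<in> L r" "x \<noteq> 0"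
  shows "w (pr s t x) x < 0"
  using pr_form_normalize[OF _ pr_form_neg_aux] assms by auto

text \<open>A vector orthogonal to everything lies in every Lagrangian subspace, in particular in
  \<open>L 0\<close> and \<open>L 1\<close>, which meet only in 0.\<close>

lemma nondegenerate: "(\<And>u. w v u = 0) \<Longrightarrow> v = 0"
  using coisotropic[of 0 v] coisotropic[of 1 v] transversal[of 0 1] by auto

text \<open>Lets each Euclidean coordinate be tested by pairing with a vector under
  \<open>w\<close>, which is how convergence of pairings becomes convergence of vectors.\<close>

lemma riesz: "\<exists>v. \<forall>u. w u v = u \<bullet> e"
proof -
  define T where "T v = (\<Sum>i\<in>Basis. w i v *\<^sub>R i)" for v
  have bilinear_lsum: "w (sum f S) v = (\<Sum>a\<in>S. w (f a) v)" for f S v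
    using linear_sum[of "\<lambda>u. w u v"] bilinear unfolding bilinear_def by blast
  have T: "T v \<bullet> u = w u v" for u v
  proof -
    have "w u v = w (\<Sum>i\<in>Basis. (u \<bullet> i) *\<^sub>R i) v" by (simp add: euclidean_representation)
    also have "\<dots> = (\<Sum>i\<in>Basis. (u \<bullet> i) * w i v)"
      by (simp add: bilinear_lsum w_simps)
    also have "\<dots> = T v \<bullet> u" unfolding T_def by (simp add: inner_sum_left inner_commute[of u] mult.commute)
    finally show ?thesis by simp
  qed
  have lin: "linear T" unfolding T_def
    by (intro linearI) (simp_all add: w_simps scaleR_add_left sum.distrib scaleR_sum_right)
  have "v = 0" if "T v = 0" for v
  proof (rule nondegenerate)
    show "w v u = 0" for u using T[of v u] that skew[of v u] by simp
  qed
  then have "surj T" using lin linear_injective_0 linear_injective_imp_surjective by blast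
  then obtain v where "e = T v" by (rule surjE)
  then show ?thesis using T[of v] by (auto simp: inner_commute)
qed

section \<open>Monotonicity, lower bound and convergence\<close>

lemma pr_left: "s \<noteq> t \<Longrightarrow> x \<in> L s \<Longrightarrow> pr s t x = x"
  by (rule pr_unique) (auto simp: subspace_0 subspace_L)

lemma pr_right: "s \<noteq> t \<Longrightarrow> x \<in> L t \<Longrightarrow> pr s t x = 0"
  by (rule pr_unique) (auto simp: subspace_0 subspace_L)

text \<open>The difference of the two values at x is the form of the triple s < t < t' at the
  \<open>L t\<close> component of x, hence negative.\<close>

lemma pr_form_decreasing:
  assumes "s < r" "r < t" "t < t'" "x \<in> L r" "x \<noteq> 0"
  shows "w (pr s t' x) x < w (pr s t x) x"
proof -
  have ne: "s \<noteq> t" "s \<noteq> t'" "s \<noteq> r" using assms by auto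
  define y where "y = x - pr s t x"
  have y: "y \<in> L t" unfolding y_def using pr_mem[OF ne(1)] by blast
  have "y \<noteq> 0"
  proof
    assume "y = 0"
    then have "x \<in> L s" using pr_mem(1)[OF ne(1), of x] by (simp add: y_def)
    then show False using assms transversal[OF ne(3)] by blast
  qed
  then have "w (pr s t' y) y < 0" using pr_form_neg[of s t t' y] assms y by simp
  moreover have eq: "pr s t' y = pr s t' x - pr s t x"
    unfolding y_def linear_diff[OF linear_pr[OF ne(2)]] pr_left[OF ne(2) pr_mem(1)[OF ne(1)]] ..
  have "w (pr s t' x - pr s t x) (pr s t x) = 0"
    using pr_mem(1) ne subspace_L by (intro isotropic[of _ s]) (auto intro: subspace_diff)
  then have "w (pr s t' y) y = w (pr s t' x - pr s t x) x"
    unfolding eq unfolding y_def by (simp add: w_simps)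
  ultimately show ?thesis by (simp add: w_simps)
qed

text \<open>The vector z in \<open>L s\<close> is chosen so that its components in
  \<open>L s'\<close> and \<open>L t\<close> are \<open>x - p\<close> and
  \<open>z - (x - p)\<close>. Negativity for s' < s < t at z then expands to the claimed inequality.
  The bound does not depend on t.\<close>

lemma pr_form_bounded:
  assumes "s' < s" "s < r" "r < t" "x \<in> L r" "x \<noteq> 0"
  shows "w (pr s s' x) x < w (pr s t x) x"
proof -
  have ne: "s \<noteq> t" "s \<noteq> s'" "s' \<noteq> t" "s \<noteq> r" using assms by auto
  define p z where "p = pr s s' x" and "z = pr s t x - p"
  have z: "z \<in> L s" unfolding p_def z_def using pr_mem(1) ne subspace_L by (auto intro: subspace_diff)
  have xp: "x - p \<in> L s'" unfolding p_def using pr_mem(2)[OF ne(2)] .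
  have "z - (x - p) = - (x - pr s t x)" by (simp add: z_def)
  then have zt: "z - (x - p) \<in> L t" using pr_mem(2)[OF ne(1), of x] subspace_neg[OF subspace_L] by metis
  then have prz: "pr s' t z = x - p" using xp by (intro pr_unique ne)
  have "z \<noteq> 0"
  proof
    assume "z = 0"
    then have "x - p \<in> L t" using zt subspace_neg[OF subspace_L, of "- (x - p)" t] by simp
    then have "x - p \<in> L s' \<inter> L t" using xp by blast
    then have "x = p" using transversal[OF ne(3)] by simp
    then have "x \<in> L s" unfolding p_def using pr_mem(1)[OF ne(2), of x] by simp
    then show False using assms transversal[OF ne(4)] by blast
  qed
  then have "w (pr s' t z) z < 0" using pr_form_neg assms z by force
  moreover have "w p (pr s t x) = 0" "w p p = 0"
    unfolding p_def using isotropic pr_mem(1) ne by blast+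
  moreover have "w x x = 0" using skew[of x x] by simp
  ultimately have "w x (pr s t x) - w x p < 0" unfolding prz unfolding z_def by (simp add: w_simps)
  then show ?thesis using skew[of x "pr s t x"] skew[of x p] unfolding p_def by simp
qed

lemma pr_form_convergent:
  assumes "s < r" "x \<in> L r"
  shows "\<exists>l. ((\<lambda>t. w (pr s t x) x) \<longlongrightarrow> l) at_top"
proof (cases "x = 0")
  case True
  then show ?thesis by (auto simp: w_simps)
next
  case False
  define q where "q t = w (pr s t x) x" for t
  have anti: "q t' \<le> q t" if "r < t" "t \<le> t'" for t t'
    using pr_form_decreasing[OF assms(1) that(1) _ assms(2) False] that unfolding q_def
    by (cases "t = t'") (auto intro: less_imp_le)
  \<comment> \<open>Any time before s would serve as the barrier; \<open>s - 1\<close> is a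
    convenient one.\<close>
  have bdd: "bdd_below (q ` {r<..})" unfolding q_def
    using pr_form_bounded[of "s - 1", OF _ assms(1) _ assms(2) False]
    by (intro bdd_belowI2) (auto intro: less_imp_le)
  have "(q \<longlongrightarrow> Inf (q ` {r<..})) at_top"
  proof (rule order_tendstoI)
    fix a assume a: "a < Inf (q ` {r<..})"
    have "a < q t" if "r < t" for t
      using a cInf_lower[OF _ bdd, of "q t"] that by force
    then show "\<forall>\<^sub>F t in at_top. a < q t"
      by (rule eventually_mono[OF eventually_gt_at_top[of r]])
  next
    fix a assume "Inf (q ` {r<..}) < a"
    then obtain t where t: "r < t" "q t < a" by (subst (asm) cInf_less_iff[OF _ bdd]) auto
    then have "q t' < a" if "t \<le> t'" for t' using anti[OF t(1) that] by linarith
    then show "\<forall>\<^sub>F t in at_top. q t < a"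
      by (rule eventually_mono[OF eventually_ge_at_top[of t]])
  qed
  then show ?thesis unfolding q_def by blast
qed

text \<open>Polarisation turns convergence of the quadratic forms on \<open>L r\<close> into
  convergence of \<open>w (pr s t x) b\<close> for x and b in \<open>L r\<close>. Vectors of
  \<open>L s\<close> pair to 0 with \<open>pr s t x\<close>, so all pairings converge, and
  \<open>riesz\<close> recovers the vector. A general x differs from a vector of \<open>L r\<close>
  by an element of \<open>L s\<close>, which \<open>pr s t\<close> fixes.\<close>

lemma pr_convergent:
  assumes "s < r"
  shows "\<exists>l. ((\<lambda>t. pr s t x) \<longlongrightarrow> l) at_top"
proof -
  have ev: "\<forall>\<^sub>F t in at_top. s \<noteq> t" by (rule eventually_mono[OF eventually_gt_at_top[of s]]) simp
  have sr: "s \<noteq> r" using assms by simp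
  have conv_L: "\<exists>l. ((\<lambda>t. pr s t x) \<longlongrightarrow> l) at_top" if x: "x \<in> L r" for x
  proof -
    have form: "\<exists>l. ((\<lambda>t. w (pr s t x) y) \<longlongrightarrow> l) at_top" for y
    proof -
      obtain a b where ab: "a \<in> L s" "b \<in> L r" "y = a + b" using sum_L[OF sr] by blast
      have xb: "x + b \<in> L r" using x ab subspace_L by (intro subspace_add)
      obtain l1 l2 l3 where l:
        "((\<lambda>t. w (pr s t x) x) \<longlongrightarrow> l1) at_top" "((\<lambda>t. w (pr s t b) b) \<longlongrightarrow> l2) at_top"
        "((\<lambda>t. w (pr s t (x + b)) (x + b)) \<longlongrightarrow> l3) at_top"
        using pr_form_convergent[OF assms] x ab xb by metis
      have "((\<lambda>t. (w (pr s t (x + b)) (x + b) - w (pr s t x) x - w (pr s t b) b) / 2)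
          \<longlongrightarrow> (l3 - l1 - l2) / 2) at_top"
        by (intro tendsto_intros l) auto
      moreover have "\<forall>\<^sub>F t in at_top. (w (pr s t (x + b)) (x + b) - w (pr s t x) x - w (pr s t b) b) / 2
          = w (pr s t x) y"
        using ev
      proof eventually_elim
        case (elim t)
        have "w (pr s t x) a = 0" using isotropic pr_mem(1)[OF elim] ab by blast
        then show ?case using pr_form_symmetric[OF elim x ab(2)]
          by (simp add: linear_add[OF linear_pr[OF elim]] w_simps ab(3))
      qed
      ultimately have "((\<lambda>t. w (pr s t x) y) \<longlongrightarrow> (l3 - l1 - l2) / 2) at_top"
        by (rule Lim_transform_eventually)
      then show ?thesis ..
    qed
    obtain v where v: "\<And>e u. w u (v e) = u \<bullet> e" using riesz by metis
    define l where "l e = (SOME l. ((\<lambda>t. w (pr s t x) (v e)) \<longlongrightarrow> l) at_top)" for e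
    have l: "((\<lambda>t. w (pr s t x) (v e)) \<longlongrightarrow> l e) at_top" for e
      unfolding l_def by (rule someI_ex[OF form])
    have "((\<lambda>t. \<Sum>i\<in>Basis. w (pr s t x) (v i) *\<^sub>R i) \<longlongrightarrow> (\<Sum>i\<in>Basis. l i *\<^sub>R i)) at_top"
      by (intro tendsto_intros l)
    then show ?thesis unfolding v euclidean_representation by blast
  qed
  obtain a b where ab: "a \<in> L s" "b \<in> L r" "x = a + b" using sum_L[OF sr] by blast
  obtain l where l: "((\<lambda>t. pr s t b) \<longlongrightarrow> l) at_top" using conv_L[OF ab(2)] ..
  have "\<forall>\<^sub>F t in at_top. a + pr s t b = pr s t x"
    using ev
  proof eventually_elim
    case (elim t)
    show ?case unfolding ab(3) linear_add[OF linear_pr[OF elim]] pr_left[OF elim ab(1)] ..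
  qed
  with tendsto_add[OF tendsto_const[of a] l] have "((\<lambda>t. pr s t x) \<longlongrightarrow> a + l) at_top"
    by (rule Lim_transform_eventually)
  then show ?thesis ..
qed

text \<open>Stated through convergent selections, without s and r, so that it is independent of the
  subspaces used to prove convergence.\<close>

definition lim_L :: "'e set"
  where "lim_L = {v. \<exists>f. (\<forall>t. f t \<in> L t) \<and> (f \<longlongrightarrow> v) at_top}"

text \<open>The limit R of the maps \<open>pr s t\<close> is the projection onto \<open>L s\<close>
  with kernel \<open>lim_L\<close>. Hence \<open>lim_L\<close> is the graph of the vectors
  \<open>x - R x\<close> over \<open>L r\<close>, which is the form needed for measurable
  frames.\<close>

lemma lim_L_structure:
  assumes "s < r"
  obtains R where "linear R" "\<And>x. ((\<lambda>t. pr s t x) \<longlongrightarrow> R x) at_top"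
    "lim_L = (\<lambda>x. x - R x) ` L r" "\<And>x. x \<in> L r \<Longrightarrow> x - R x = 0 \<Longrightarrow> x = 0"
    "subspace lim_L" "lim_L = {v. \<forall>u\<in>lim_L. w v u = 0}"
proof -
  obtain R where R: "\<And>x. ((\<lambda>t. pr s t x) \<longlongrightarrow> R x) at_top" using pr_convergent[OF assms] by metis
  have ev: "\<forall>\<^sub>F t in at_top. s \<noteq> t" by (rule eventually_mono[OF eventually_gt_at_top[of s]]) simp
  have sr: "s \<noteq> r" using assms by simp
  note uniq = tendsto_unique[OF trivial_limit_at_top_linorder]
  have R_eqI: "R x = l" if "(f \<longlongrightarrow> l) at_top" "\<And>t. s \<noteq> t \<Longrightarrow> f t = pr s t x" for f l x
    by (rule uniq[OF R Lim_transform_eventually[OF that(1)]], rule eventually_mono[OF ev], rule that(2))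
  have lin: "linear R"
  proof (rule linearI)
    show "R (x + y) = R x + R y" for x y
      by (rule R_eqI[OF tendsto_add[OF R[of x] R[of y]]]) (simp add: linear_add[OF linear_pr])
    show "R (c *\<^sub>R x) = c *\<^sub>R R x" for c x
      by (rule R_eqI[OF tendsto_scaleR[OF tendsto_const[of c] R[of x]]]) (simp add: linear_scale[OF linear_pr])
  qed
  have R_mem: "R x \<in> L s" for x
    using closed_subspace[OF subspace_L] _ trivial_limit_at_top_linorder R
    by (rule Lim_in_closed_set) (use ev in eventually_elim, rule pr_mem)
  have R_left: "R x = x" if "x \<in> L s" for x
    by (rule R_eqI[OF tendsto_const]) (simp add: pr_left that)
  have ker: "lim_L = {v. R v = 0}"
  proof safe
    fix v assume "v \<in> lim_L"
    then obtain f where f: "\<And>t. f t \<in> L t" "(f \<longlongrightarrow> v) at_top" unfolding lim_L_def by blast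
    have "((\<lambda>t. pr s t (f t)) \<longlongrightarrow> R v) at_top"
      by (rule linear_pointwise_tendsto[OF R _ lin f(2)]) (use ev linear_pr in \<open>auto elim!: eventually_mono\<close>)
    moreover have "((\<lambda>t. pr s t (f t)) \<longlongrightarrow> 0) at_top"
      by (rule Lim_transform_eventually[OF tendsto_const])
         (use ev f pr_right in \<open>auto elim!: eventually_mono\<close>)
    ultimately show "R v = 0" by (rule uniq)
  next
    fix v assume v: "R v = 0"
    \<comment> \<open>At the single time t = s the projection carries no information, so 0 is
      selected.\<close>
    define f where "f t = (if t = s then 0 else v - pr s t v)" for t
    have "f t \<in> L t" for t unfolding f_def using pr_mem(2)[of s t] subspace_0[OF subspace_L] by auto
    moreover have "((\<lambda>t. v - pr s t v) \<longlongrightarrow> v) at_top"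
      using tendsto_diff[OF tendsto_const R[of v], of v] v by simp
    then have "(f \<longlongrightarrow> v) at_top"
      by (rule Lim_transform_eventually) (rule eventually_mono[OF ev], simp add: f_def)
    ultimately show "v \<in> lim_L" unfolding lim_L_def by blast
  qed
  have iso: "w v u = 0" if "v \<in> lim_L" "u \<in> lim_L" for u v
  proof -
    have "((\<lambda>t. w (v - pr s t v) (u - pr s t u)) \<longlongrightarrow> w (v - R v) (u - R u)) at_top"
      by (intro tendsto_w tendsto_diff tendsto_const R)
    moreover have "((\<lambda>t. w (v - pr s t v) (u - pr s t u)) \<longlongrightarrow> 0) at_top"
      by (rule Lim_transform_eventually[OF tendsto_const])
         (use ev in eventually_elim, use isotropic pr_mem(2) in metis)
    ultimately show ?thesis using uniq that by (force simp: ker)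
  qed
  have "v \<in> lim_L" if v: "\<And>u. u \<in> lim_L \<Longrightarrow> w v u = 0" for v
  proof -
    have R2: "x - R x \<in> lim_L" for x using R_left[OF R_mem] by (simp add: ker linear_diff[OF lin])
    \<comment> \<open>The space splits into the range of R and \<open>lim_L\<close>. The range lies
      in the isotropic \<open>L s\<close>, and \<open>lim_L\<close> is orthogonal both to v and to
      \<open>v - R v\<close>. So \<open>R v\<close> is orthogonal to everything.\<close>
    have "w (R v) u = 0" for u
    proof -
      have "w (R v) (R u) = 0" using isotropic R_mem by blast
      moreover have "w v (u - R u) = 0" "w (v - R v) (u - R u) = 0" using v iso R2 by auto
      ultimately show ?thesis by (simp add: w_simps)
    qed
    then show ?thesis using nondegenerate ker by blast
  qed
  then have lag: "lim_L = {v. \<forall>u\<in>lim_L. w v u = 0}" using iso by blast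
  have img: "lim_L = (\<lambda>x. x - R x) ` L r"
  proof safe
    fix v assume v: "v \<in> lim_L"
    obtain a b where ab: "a \<in> L s" "b \<in> L r" "v = a + b" using sum_L[OF sr] by blast
    have "R v = a + R b" by (simp add: ab linear_add[OF lin] R_left)
    then have "v = b - R b" using v ab(3) by (simp add: ker add_eq_0_iff)
    then show "v \<in> (\<lambda>x. x - R x) ` L r" using ab by blast
  next
    show "x - R x \<in> lim_L" for x using R_left[OF R_mem] by (simp add: ker linear_diff[OF lin])
  qed
  have inj: "x = 0" if "x \<in> L r" "x - R x = 0" for x
    using R_mem[of x] that transversal[OF sr] by auto
  have "subspace lim_L" unfolding ker by (rule linear_subspace_kernel[OF lin])
  then show thesis using that lin R img inj lag by blast
qed

end

section \<open>Calculus in a chart\<close>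

lemma smooth_on_differentiable: "smooth_on S f \<Longrightarrow> x \<in> S \<Longrightarrow> f differentiable (at x)"
  unfolding smooth_on_def by (metis Ck_on.simps(2))

lemma smooth_on_frechet_derivative: "smooth_on S f \<Longrightarrow> smooth_on S (\<lambda>x. frechet_derivative f (at x) v)"
  unfolding smooth_on_def by (metis Ck_on.simps(2))

lemma smooth_on_continuous: "smooth_on S f \<Longrightarrow> continuous_on S f"
  unfolding smooth_on_def by (metis Ck_on.simps(1))

lemma smooth_on_has_derivative:
  "smooth_on S f \<Longrightarrow> x \<in> S \<Longrightarrow> (f has_derivative frechet_derivative f (at x)) (at x)"
  using smooth_on_differentiable frechet_derivative_works by blast

lemma linear_frechet_derivative: "f differentiable (at x) \<Longrightarrow> linear (frechet_derivative f (at x))"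
  using frechet_derivative_works has_derivative_linear by blast

lemma frechet_derivative_eqI: "(f has_derivative f') (at x) \<Longrightarrow> frechet_derivative f (at x) = f'"
  using frechet_derivative_at by metis

lemma frechet_derivative_cong_open:
  assumes "open S" "x \<in> S" "\<And>y. y \<in> S \<Longrightarrow> f y = g y"
  shows "frechet_derivative f (at x) = frechet_derivative g (at x)"
proof -
  have "(f has_derivative D) (at x) \<longleftrightarrow> (g has_derivative D) (at x)" for D
    using assms has_derivative_transform_within_open by metis
  then show ?thesis unfolding frechet_derivative_def by simp
qed

text \<open>Functions that agree on an open set have the same derivatives there, so the agreement
  passes down the induction. It is needed because rules such as the derivative of a sum are
  available only at points of S.\<close>

lemma Ck_on_cong_open:
  assumes "open S" "\<And>y. y \<in> S \<Longrightarrow> f y = g y" "Ck_on k S f"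
  shows "Ck_on k S g"
  using assms(2,3)
proof (induction k arbitrary: f g)
  case 0
  then show ?case using continuous_on_cong[of S S f g] by simp
next
  case (Suc k)
  have "g differentiable (at x)" if "x \<in> S" for x
    using Suc.prems that \<open>open S\<close> unfolding differentiable_def
    by (metis Ck_on.simps(2) differentiable_def has_derivative_transform_within_open)
  moreover have "Ck_on k S (\<lambda>x. frechet_derivative g (at x) v)" for v
  proof (rule Suc.IH)
    show "Ck_on k S (\<lambda>x. frechet_derivative f (at x) v)" using Suc.prems by simp
    show "frechet_derivative f (at x) v = frechet_derivative g (at x) v" if "x \<in> S" for x
      using frechet_derivative_cong_open[OF \<open>open S\<close> that Suc.prems(1)] by simp
  qed
  ultimately show ?case by simp
qed

lemma Ck_on_add:
  assumes "open S" "Ck_on k S f" "Ck_on k S g"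
  shows "Ck_on k S (\<lambda>x. f x + g x)"
  using assms(2,3)
proof (induction k arbitrary: f g)
  case 0
  then show ?case by (simp add: continuous_on_add)
next
  case (Suc k)
  have "Ck_on k S (\<lambda>x. frechet_derivative (\<lambda>x. f x + g x) (at x) v)" for v
  proof (rule Ck_on_cong_open[OF \<open>open S\<close>])
    show "Ck_on k S (\<lambda>x. frechet_derivative f (at x) v + frechet_derivative g (at x) v)"
      using Suc by simp
    show "frechet_derivative f (at x) v + frechet_derivative g (at x) v
        = frechet_derivative (\<lambda>x. f x + g x) (at x) v" if "x \<in> S" for x
    proof -
      have "(f has_derivative frechet_derivative f (at x)) (at x)" "(g has_derivative frechet_derivative g (at x)) (at x)"
        using Suc.prems that by (auto intro: frechet_derivative_works[THEN iffD1])
      from frechet_derivative_eqI[OF has_derivative_add[OF this]] show ?thesis by simp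
    qed
  qed
  then show ?case using Suc.prems by (simp add: differentiable_add)
qed

lemma Ck_on_scaleR:
  assumes "open S" "Ck_on k S f"
  shows "Ck_on k S (\<lambda>x. c *\<^sub>R f x)"
  using assms(2)
proof (induction k arbitrary: f)
  case 0
  then show ?case by (simp add: continuous_on_scaleR)
next
  case (Suc k)
  have "Ck_on k S (\<lambda>x. frechet_derivative (\<lambda>x. c *\<^sub>R f x) (at x) v)" for v
  proof (rule Ck_on_cong_open[OF \<open>open S\<close>])
    show "Ck_on k S (\<lambda>x. c *\<^sub>R frechet_derivative f (at x) v)" using Suc by simp
    show "c *\<^sub>R frechet_derivative f (at x) v = frechet_derivative (\<lambda>x. c *\<^sub>R f x) (at x) v"
      if "x \<in> S" for x
    proof -
      have "(f has_derivative frechet_derivative f (at x)) (at x)"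
        using Suc.prems that frechet_derivative_works by auto
      from frechet_derivative_eqI[OF has_derivative_scaleR_right[OF this]] show ?thesis by simp
    qed
  qed
  then show ?case using Suc.prems by simp
qed

lemma smooth_on_zero: "smooth_on S (\<lambda>x. 0)"
proof -
  have "Ck_on k S (\<lambda>x. 0 :: 'b)" for k
    by (induction k) (auto simp: frechet_derivative_const)
  then show ?thesis by (simp add: smooth_on_def)
qed

lemma smooth_on_linear_combination:
  assumes "open S" "finite I" "\<And>i. i \<in> I \<Longrightarrow> smooth_on S (f i)"
  shows "smooth_on S (\<lambda>x. \<Sum>i\<in>I. c i *\<^sub>R f i x)"
  using assms(2,3)
proof (induction I)
  case empty
  then show ?case by (simp add: smooth_on_zero)
next
  case (insert i I)
  then show ?case using \<open>open S\<close> by (auto simp: smooth_on_def intro!: Ck_on_add Ck_on_scaleR)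
qed

section \<open>Symmetry of second derivatives\<close>

lemma mvt_second_difference:
  fixes f :: "'a::real_normed_vector \<Rightarrow> 'b::real_inner"
  assumes f: "\<And>y. y \<in> ball x d \<Longrightarrow> f differentiable (at y)"
    and fu: "\<And>y. y \<in> ball x d \<Longrightarrow> (\<lambda>y. frechet_derivative f (at y) u) differentiable (at y)"
    and h: "h > 0" "h * (norm u + norm v) < d"
  shows "\<exists>p. dist x p \<le> h * (norm u + norm v) \<and>
    (f (x + h *\<^sub>R u + h *\<^sub>R v) - f (x + h *\<^sub>R u) - f (x + h *\<^sub>R v) + f x) \<bullet> z =
      h * h * (frechet_derivative (\<lambda>y. frechet_derivative f (at y) u) (at p) v \<bullet> z)"
proof -
  \<comment> \<open>The mean value theorem fails for vector-valued functions, hence the pairing with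
    z; the intermediate point depends on z.\<close>
  have line: "((\<lambda>s. g (a + s *\<^sub>R e) \<bullet> z) has_real_derivative frechet_derivative g (at (a + s *\<^sub>R e)) e \<bullet> z) (at s)"
    if "g differentiable (at (a + s *\<^sub>R e))" for g :: "'a \<Rightarrow> 'b" and a e s
  proof -
    have "(g has_derivative frechet_derivative g (at (a + s *\<^sub>R e))) (at (a + s *\<^sub>R e))"
      using that frechet_derivative_works by blast
    moreover have "((\<lambda>s. a + s *\<^sub>R e) has_derivative (\<lambda>s. s *\<^sub>R e)) (at s)"
      by (auto intro!: derivative_eq_intros)
    ultimately have "((\<lambda>s. g (a + s *\<^sub>R e)) has_derivative (\<lambda>r. frechet_derivative g (at (a + s *\<^sub>R e)) (r *\<^sub>R e))) (at s)"
      using has_derivative_compose[of "\<lambda>s. a + s *\<^sub>R e" "\<lambda>s. s *\<^sub>R e" s UNIV g] by simp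
    then have "((\<lambda>s. g (a + s *\<^sub>R e) \<bullet> z) has_derivative
        (\<lambda>r. frechet_derivative g (at (a + s *\<^sub>R e)) (r *\<^sub>R e) \<bullet> z)) (at s)"
      by (rule has_derivative_inner_left)
    then show ?thesis unfolding has_field_derivative_def
      using linear_scale[OF linear_frechet_derivative[OF that]] by (simp add: mult_commute_abs)
  qed
  let ?Du = "\<lambda>y. frechet_derivative f (at y) u"
  have near: "dist x (x + s *\<^sub>R u + r *\<^sub>R v) \<le> h * (norm u + norm v)" if "0 \<le> s" "s \<le> h" "0 \<le> r" "r \<le> h" for s r
  proof -
    have "dist x (x + s *\<^sub>R u + r *\<^sub>R v) = norm (s *\<^sub>R u + r *\<^sub>R v)"
      unfolding dist_commute[of x] by (simp add: dist_norm add.assoc)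
    also have "\<dots> \<le> s * norm u + r * norm v" using norm_triangle_ineq[of "s *\<^sub>R u" "r *\<^sub>R v"] that by simp
    also have "\<dots> \<le> h * norm u + h * norm v" using that by (intro add_mono mult_right_mono) auto
    finally show ?thesis by (simp add: algebra_simps)
  qed
  then have ball: "x + s *\<^sub>R u + r *\<^sub>R v \<in> ball x d" if "0 \<le> s" "s \<le> h" "0 \<le> r" "r \<le> h" for s r
    using that h(2) by force
  \<comment> \<open>The second difference is the increment of \<phi> over [0, h]. The mean value
    theorem is applied to it in direction u, and then to the derivative in direction v.\<close>
  define \<phi> where "\<phi> s = f (x + h *\<^sub>R v + s *\<^sub>R u) \<bullet> z - f (x + s *\<^sub>R u) \<bullet> z" for s
  have "\<exists>s>0. s < h \<and> \<phi> h - \<phi> 0 = (h - 0) * (?Du (x + h *\<^sub>R v + s *\<^sub>R u) \<bullet> z - ?Du (x + s *\<^sub>R u) \<bullet> z)"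
  proof (rule MVT2[OF h(1)])
    fix s assume s: "0 \<le> s" "s \<le> h"
    then show "DERIV \<phi> s :> ?Du (x + h *\<^sub>R v + s *\<^sub>R u) \<bullet> z - ?Du (x + s *\<^sub>R u) \<bullet> z"
      unfolding \<phi>_def using ball[of s h] ball[of s 0] h(1)
      by (intro DERIV_diff line f) (simp_all add: add_ac)
  qed
  then obtain s where s: "0 < s" "s < h"
    and 1: "\<phi> h - \<phi> 0 = h * (?Du (x + s *\<^sub>R u + h *\<^sub>R v) \<bullet> z - ?Du (x + s *\<^sub>R u) \<bullet> z)"
    by (auto simp: add_ac)
  have "\<exists>r>0. r < h \<and> ?Du (x + s *\<^sub>R u + h *\<^sub>R v) \<bullet> z - ?Du (x + s *\<^sub>R u + 0 *\<^sub>R v) \<bullet> z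
      = (h - 0) * (frechet_derivative ?Du (at (x + s *\<^sub>R u + r *\<^sub>R v)) v \<bullet> z)"
    by (rule MVT2[OF h(1)]) (use ball s in \<open>auto intro!: line fu\<close>)
  then obtain r where r: "0 < r" "r < h" and 2: "?Du (x + s *\<^sub>R u + h *\<^sub>R v) \<bullet> z - ?Du (x + s *\<^sub>R u) \<bullet> z
      = h * (frechet_derivative ?Du (at (x + s *\<^sub>R u + r *\<^sub>R v)) v \<bullet> z)" by auto
  have "(f (x + h *\<^sub>R u + h *\<^sub>R v) - f (x + h *\<^sub>R u) - f (x + h *\<^sub>R v) + f x) \<bullet> z = \<phi> h - \<phi> 0"
    unfolding \<phi>_def by (simp add: inner_diff_left inner_add_left add_ac)
  then show ?thesis using 1 2 near[of s r] s r by (intro exI[of _ "x + s *\<^sub>R u + r *\<^sub>R v"]) (simp add: mult.assoc)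
qed

text \<open>The second difference is symmetric in u and v, so after pairing with z both mixed
  derivatives take a common value at points within \<open>h * N\<close> of x. Continuity lets h tend
  to 0.\<close>

lemma second_derivative_symmetric:
  fixes f :: "'a::real_normed_vector \<Rightarrow> 'b::real_inner"
  assumes S: "open S" "x \<in> S" and f: "smooth_on S f"
  shows "frechet_derivative (\<lambda>y. frechet_derivative f (at y) u) (at x) v
       = frechet_derivative (\<lambda>y. frechet_derivative f (at y) v) (at x) u"
proof -
  define D where "D u v p = frechet_derivative (\<lambda>y. frechet_derivative f (at y) u) (at p) v" for u v p
  obtain d where d: "d > 0" "ball x d \<subseteq> S" using S openE by blast
  define N where "N = norm u + norm v + 1"
  have cont: "isCont (D u v) x" for u v
    using smooth_on_continuous[OF smooth_on_frechet_derivative[OF smooth_on_frechet_derivative[OF f]], of u v]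
      continuous_on_eq_continuous_at[OF S(1)] S(2) unfolding D_def by blast
  have eq: "D u v x \<bullet> z = D v u x \<bullet> z" for z
  proof -
    have "\<exists>p q. dist x p \<le> h * N \<and> dist x q \<le> h * N \<and> D u v p \<bullet> z = D v u q \<bullet> z" if h: "0 < h" "h * N < d" for h
    proof -
      have le: "h * (norm u + norm v) \<le> h * N" using h by (intro mult_left_mono) (auto simp: N_def)
      have diff: "y \<in> ball x d \<Longrightarrow> f differentiable (at y)"
        "y \<in> ball x d \<Longrightarrow> (\<lambda>y. frechet_derivative f (at y) e) differentiable (at y)" for y e
        using d(2) smooth_on_differentiable smooth_on_frechet_derivative f by (blast, blast)
      obtain p where p: "dist x p \<le> h * (norm u + norm v)"
        "(f (x + h *\<^sub>R u + h *\<^sub>R v) - f (x + h *\<^sub>R u) - f (x + h *\<^sub>R v) + f x) \<bullet> z = h * h * (D u v p \<bullet> z)"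
        using mvt_second_difference[of x d f u h v z] diff h le unfolding D_def by auto
      obtain q where q: "dist x q \<le> h * (norm v + norm u)"
        "(f (x + h *\<^sub>R v + h *\<^sub>R u) - f (x + h *\<^sub>R v) - f (x + h *\<^sub>R u) + f x) \<bullet> z = h * h * (D v u q \<bullet> z)"
        using mvt_second_difference[of x d f v h u z] diff h le unfolding D_def by (auto simp: add.commute)
      have "h * h * (D u v p \<bullet> z) = h * h * (D v u q \<bullet> z)"
        unfolding p(2)[symmetric] q(2)[symmetric] by (simp add: algebra_simps)
      then have "D u v p \<bullet> z = D v u q \<bullet> z" using h(1) by simp
      moreover have "dist x q \<le> h * N" using q(1) le by (simp add: add.commute)
      ultimately show ?thesis using p(1) le by (meson order_trans)
    qed
    then obtain p q where pq: "\<And>h. 0 < h \<Longrightarrow> h * N < d \<Longrightarrow>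
        dist x (p h) \<le> h * N \<and> dist x (q h) \<le> h * N \<and> D u v (p h) \<bullet> z = D v u (q h) \<bullet> z" by metis
    have "((\<lambda>h. h * N) \<longlongrightarrow> 0) (at_right 0)" by (auto intro!: tendsto_eq_intros)
    then have "\<forall>\<^sub>F h in at_right 0. h * N < d" using d(1) by (rule order_tendstoD)
    then have ev: "\<forall>\<^sub>F h in at_right 0. 0 < h \<and> h * N < d"
      using eventually_at_right_less[of 0] by eventually_elim simp
    have lim: "((\<lambda>h. h * N) \<longlongrightarrow> 0) (at_right 0)" by (auto intro!: tendsto_eq_intros)
    have to_x: "(g \<longlongrightarrow> x) (at_right 0)" if "\<And>h. 0 < h \<Longrightarrow> h * N < d \<Longrightarrow> dist x (g h) \<le> h * N" for g
      unfolding tendsto_dist_iff[of g]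
      by (rule tendsto_sandwich[OF _ _ tendsto_const lim])
         (auto intro: eventually_mono[OF ev] simp: dist_commute that)
    have "((\<lambda>h. D u v (p h) \<bullet> z) \<longlongrightarrow> D u v x \<bullet> z) (at_right 0)"
      using isCont_tendsto_compose[OF cont[of u v] to_x[of p]] pq by (intro tendsto_intros) auto
    moreover have "((\<lambda>h. D v u (q h) \<bullet> z) \<longlongrightarrow> D v u x \<bullet> z) (at_right 0)"
      using isCont_tendsto_compose[OF cont[of v u] to_x[of q]] pq by (intro tendsto_intros) auto
    then have "((\<lambda>h. D u v (p h) \<bullet> z) \<longlongrightarrow> D v u x \<bullet> z) (at_right 0)"
      by (rule Lim_transform_eventually) (rule eventually_mono[OF ev], simp add: pq)
    ultimately show ?thesis using tendsto_unique trivial_limit_at_right_real by blast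
  qed
  then show ?thesis unfolding D_def by (metis vector_eq_rdot)
qed

section \<open>Local flows in Euclidean space\<close>

lemma has_derivative_slice:
  assumes "(g has_derivative D) (at (t, x))"
  shows "((\<lambda>y. g (t, y)) has_derivative (\<lambda>e. D (0, e))) (at x)"
    and "((\<lambda>s. g (s, x)) has_derivative (\<lambda>s. D (s, 0))) (at t)"
proof -
  have "((\<lambda>y. (t, y)) has_derivative (\<lambda>e. (0, e))) (at x)" "((\<lambda>s. (s, x)) has_derivative (\<lambda>s. (s, 0))) (at t)"
    by (auto intro!: derivative_eq_intros)
  from this[THEN has_derivative_compose[of _ _ _ UNIV g D]] assms
  show "((\<lambda>y. g (t, y)) has_derivative (\<lambda>e. D (0, e))) (at x)"
    and "((\<lambda>s. g (s, x)) has_derivative (\<lambda>s. D (s, 0))) (at t)" by auto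
qed

text \<open>The derivative at time \<open>0\<close> of the spatial differential of a local flow \<open>\<phi>\<close>:
  by the symmetry of second derivatives it is the spatial differential of the generator.\<close>

locale local_flow =
  fixes \<phi> :: "real \<times> 'e::euclidean_space \<Rightarrow> 'e" and W :: "(real \<times> 'e) set" and x0 :: 'e
  assumes open_W: "open W" and x0: "(0, x0) \<in> W" and smooth: "smooth_on W \<phi>"
    and initial: "\<And>x. (0, x) \<in> W \<Longrightarrow> \<phi> (0, x) = x"
begin

definition generator :: "'e \<Rightarrow> 'e"
  where "generator x = frechet_derivative \<phi> (at (0, x)) (1, 0)"

definition space_deriv :: "'e \<Rightarrow> real \<times> 'e \<Rightarrow> 'e"
  where "space_deriv b z = frechet_derivative \<phi> (at z) (0, b)"

lemma open_slice: "open {x. (0, x) \<in> W}"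
  using open_vimage[OF open_W, of "\<lambda>x. (0, x)"] by (simp add: vimage_def continuous_on_Pair)

lemma space_deriv_0: "(0, x) \<in> W \<Longrightarrow> space_deriv b (0, x) = b"
proof -
  assume x: "(0, x) \<in> W"
  have "((\<lambda>x. \<phi> (0, x)) has_derivative (\<lambda>e. frechet_derivative \<phi> (at (0, x)) (0, e))) (at x)"
    by (rule has_derivative_slice[OF smooth_on_has_derivative[OF smooth x]])
  moreover have "((\<lambda>x. \<phi> (0, x)) has_derivative (\<lambda>e. e)) (at x)"
    by (rule has_derivative_transform_within_open[OF has_derivative_ident open_slice]) (use x initial in auto)
  ultimately show ?thesis unfolding space_deriv_def using has_derivative_unique by metis
qed

lemma generator_differentiable: "generator differentiable (at x0)"
  and generator_has_derivative:
    "(generator has_derivative (\<lambda>b. frechet_derivative (\<lambda>z. frechet_derivative \<phi> (at z) (1, 0)) (at (0, x0)) (0, b))) (at x0)"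
proof -
  show *: "(generator has_derivative (\<lambda>b. frechet_derivative (\<lambda>z. frechet_derivative \<phi> (at z) (1, 0)) (at (0, x0)) (0, b))) (at x0)"
    unfolding generator_def
    by (rule has_derivative_slice[OF smooth_on_has_derivative[OF smooth_on_frechet_derivative[OF smooth] x0]])
  then show "generator differentiable (at x0)" unfolding differentiable_def by blast
qed

lemma space_deriv_has_derivative:
  "(space_deriv b has_derivative (\<lambda>(\<tau>, \<xi>). \<tau> *\<^sub>R frechet_derivative generator (at x0) b)) (at (0, x0))"
proof -
  let ?g = "\<lambda>z. frechet_derivative \<phi> (at z) (0, b)"
  let ?D = "frechet_derivative ?g (at (0, x0))"
  have der: "(?g has_derivative ?D) (at (0, x0))"
    by (rule smooth_on_has_derivative[OF smooth_on_frechet_derivative[OF smooth] x0])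
  \<comment> \<open>At time 0 the spatial differential is the identity at every point, so
    \<open>space_deriv b\<close> is constant there and only the time component of its derivative
    survives.\<close>
  have "((\<lambda>x. ?g (0, x)) has_derivative (\<lambda>e. ?D (0, e))) (at x0)"
    by (rule has_derivative_slice[OF der])
  moreover have "((\<lambda>x. ?g (0, x)) has_derivative (\<lambda>e. 0)) (at x0)"
    by (rule has_derivative_transform_within_open[OF has_derivative_const open_slice])
       (use x0 space_deriv_0 in \<open>auto simp: space_deriv_def\<close>)
  ultimately have D0: "?D (0, e) = 0" for e using has_derivative_unique by metis
  have "?D (1, 0) = frechet_derivative generator (at x0) b"
    unfolding frechet_derivative_eqI[OF generator_has_derivative]
    by (rule second_derivative_symmetric[OF open_W x0 smooth])
  moreover have "?D (\<tau>, \<xi>) = \<tau> *\<^sub>R ?D (1, 0) + ?D (0, \<xi>)" for \<tau> \<xi>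
    using has_derivative_linear[OF der] linear_add[of ?D "\<tau> *\<^sub>R (1, 0)" "(0, \<xi>)"]
      linear_scale[of ?D \<tau> "(1, 0)"] by simp
  ultimately have "?D (\<tau>, \<xi>) = \<tau> *\<^sub>R frechet_derivative generator (at x0) b" for \<tau> \<xi>
    using D0 by (metis add.right_neutral)
  then have "?D = (\<lambda>(\<tau>, \<xi>). \<tau> *\<^sub>R frechet_derivative generator (at x0) b)"
    by (intro ext) (simp only: split_paired_all prod.case)
  with der show ?thesis unfolding space_deriv_def by simp
qed

text \<open>Writes the differential in a moving direction as a combination of the fixed functions
  \<open>space_deriv i\<close>, to which the product rule applies.\<close>

lemma space_deriv_sum: "z \<in> W \<Longrightarrow> frechet_derivative \<phi> (at z) (0, e) = (\<Sum>i\<in>Basis. (e \<bullet> i) *\<^sub>R space_deriv i z)"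
proof -
  assume "z \<in> W"
  then have lin: "linear (frechet_derivative \<phi> (at z))"
    by (intro linear_frechet_derivative smooth_on_differentiable[OF smooth])
  have lin0: "linear (\<lambda>e. frechet_derivative \<phi> (at z) (0, e))"
  proof (rule linearI)
    fix a b c
    show "frechet_derivative \<phi> (at z) (0, a + b) = frechet_derivative \<phi> (at z) (0, a) + frechet_derivative \<phi> (at z) (0, b)"
      using linear_add[OF lin, of "(0, a)" "(0, b)"] by simp
    show "frechet_derivative \<phi> (at z) (0, c *\<^sub>R a) = c *\<^sub>R frechet_derivative \<phi> (at z) (0, a)"
      using linear_scale[OF lin, of c "(0, a)"] by simp
  qed
  have "e = (\<Sum>i\<in>Basis. (e \<bullet> i) *\<^sub>R i)" by (simp add: euclidean_representation)
  then have "frechet_derivative \<phi> (at z) (0, e) = frechet_derivative \<phi> (at z) (0, \<Sum>i\<in>Basis. (e \<bullet> i) *\<^sub>R i)"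
    by (rule arg_cong)
  also have "\<dots> = (\<Sum>i\<in>Basis. (e \<bullet> i) *\<^sub>R frechet_derivative \<phi> (at z) (0, i))"
    unfolding linear_sum[OF lin0] linear_scale[OF lin0] ..
  finally show ?thesis unfolding space_deriv_def .
qed

text \<open>The Lie bracket as derivative of the pulled back field: V changes along the orbit at
  rate \<open>V' (generator x0)\<close>, and running the flow backwards subtracts the derivative of
  the generator in direction \<open>V x0\<close>. The motion of the base point inside the
  differential has no first-order effect, since the differential is the identity at time 0.\<close>

lemma pullback_has_vector_derivative:
  assumes \<gamma>: "(\<gamma> has_vector_derivative generator x0) (at 0)" "\<gamma> 0 = x0"
    and V: "(V has_derivative V') (at x0)"
  shows "((\<lambda>h. frechet_derivative \<phi> (at (- h, \<gamma> h)) (0, V (\<gamma> h))) has_vector_derivative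
           (V' (generator x0) - frechet_derivative generator (at x0) (V x0))) (at 0)"
proof -
  let ?X = "generator x0" and ?DX = "frechet_derivative generator (at x0)"
  have \<gamma>': "(\<gamma> has_derivative (\<lambda>h. h *\<^sub>R ?X)) (at 0)" using \<gamma>(1) by (simp add: has_vector_derivative_def)
  have "V' (h *\<^sub>R ?X) = h *\<^sub>R V' ?X" for h by (rule linear_scale[OF has_derivative_linear[OF V]])
  then have dV: "((\<lambda>h. V (\<gamma> h)) has_derivative (\<lambda>h. h *\<^sub>R V' ?X)) (at 0)"
    using has_derivative_compose[OF \<gamma>', of V V'] V \<gamma>(2) by simp
  have dg: "((\<lambda>h. space_deriv i (- h, \<gamma> h)) has_derivative (\<lambda>h. (- h) *\<^sub>R ?DX i)) (at 0)" for i
  proof -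
    have "((\<lambda>h. (- h, \<gamma> h)) has_derivative (\<lambda>h. (- h, h *\<^sub>R ?X))) (at 0)"
      by (intro has_derivative_Pair \<gamma>' derivative_intros)
    from has_derivative_compose[OF this, of "space_deriv i"
        "\<lambda>(\<tau>, \<xi>). \<tau> *\<^sub>R ?DX i"] space_deriv_has_derivative[of i] \<gamma>(2)
    show ?thesis by simp
  qed
  have "((\<lambda>h. \<Sum>i\<in>Basis. (V (\<gamma> h) \<bullet> i) *\<^sub>R space_deriv i (- h, \<gamma> h)) has_derivative
      (\<lambda>h. \<Sum>i\<in>Basis. (V (\<gamma> 0) \<bullet> i) *\<^sub>R ((- h) *\<^sub>R ?DX i) + (h *\<^sub>R V' ?X \<bullet> i) *\<^sub>R space_deriv i (- 0, \<gamma> 0))) (at 0)"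
    by (intro has_derivative_sum has_derivative_scaleR has_derivative_inner_left dV dg)
  moreover have "(\<lambda>h. \<Sum>i\<in>Basis. (V (\<gamma> 0) \<bullet> i) *\<^sub>R ((- h) *\<^sub>R ?DX i) + (h *\<^sub>R V' ?X \<bullet> i) *\<^sub>R space_deriv i (- 0, \<gamma> 0))
     = (\<lambda>h. h *\<^sub>R (V' ?X - ?DX (V x0)))"
  proof
    fix h
    have lin: "linear ?DX" using linear_frechet_derivative generator_differentiable by blast
    have "?DX (V x0) = (\<Sum>i\<in>Basis. (V x0 \<bullet> i) *\<^sub>R ?DX i)"
      by (subst euclidean_representation[of "V x0", symmetric]) (simp only: linear_sum[OF lin] linear_scale[OF lin])
    moreover have "(\<Sum>i\<in>Basis. (h * (V' ?X \<bullet> i)) *\<^sub>R i) = h *\<^sub>R V' ?X"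
      unfolding scaleR_scaleR[symmetric] scaleR_sum_right[symmetric] euclidean_representation ..
    ultimately show "(\<Sum>i\<in>Basis. (V (\<gamma> 0) \<bullet> i) *\<^sub>R ((- h) *\<^sub>R ?DX i) + (h *\<^sub>R V' ?X \<bullet> i) *\<^sub>R space_deriv i (- 0, \<gamma> 0))
     = h *\<^sub>R (V' ?X - ?DX (V x0))"
      using \<gamma>(2) space_deriv_0[OF x0]
      by (simp add: sum.distrib scaleR_diff_right scaleR_sum_right sum_negf mult.commute sum_subtractf)
  qed
  ultimately have "((\<lambda>h. \<Sum>i\<in>Basis. (V (\<gamma> h) \<bullet> i) *\<^sub>R space_deriv i (- h, \<gamma> h)) has_vector_derivative
      (V' ?X - ?DX (V x0))) (at 0)" by (simp add: has_vector_derivative_def)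
  note main = this
  have "isCont \<gamma> 0" using \<gamma>(1) has_vector_derivative_continuous by blast
  then have "isCont (\<lambda>h. (- h, \<gamma> h)) 0" by (intro continuous_intros)
  then have "\<forall>\<^sub>F h in nhds 0. (- h, \<gamma> h) \<in> W"
    using topological_tendstoD[OF _ open_W, of "\<lambda>h. (- h, \<gamma> h)" "(0, x0)" "nhds 0"] x0 \<gamma>(2)
    by (simp add: isCont_def tendsto_nhds_iff)
  then obtain T where T0: "open T" "0 \<in> T" and T: "\<And>h. h \<in> T \<Longrightarrow> (- h, \<gamma> h) \<in> W"
    unfolding eventually_nhds by blast
  show ?thesis
    by (rule has_vector_derivative_transform_within_open[OF main T0]) (rule space_deriv_sum[OF T, symmetric])
qed

text \<open>The Lie derivative of F along the generator in coordinates: one term for the moving base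
  point, two for the moving arguments. Differentiability is given for fixed arguments, so F is
  expanded over \<open>Basis\<close> before the product rule is applied.\<close>

lemma bilinear_pushforward_has_real_derivative:
  fixes F :: "'e \<Rightarrow> 'e \<Rightarrow> 'e \<Rightarrow> real"
  assumes \<gamma>: "\<And>h. \<gamma> h = \<phi> (h, x0)" "(\<gamma> has_vector_derivative generator x0) (at 0)"
    and N: "open N" "x0 \<in> N"
    and F: "\<And>x. x \<in> N \<Longrightarrow> bilinear (F x)" "\<And>u v. (\<lambda>x. F x u v) differentiable (at x0)"
  shows "((\<lambda>h. F (\<gamma> h) (space_deriv u (h, x0)) (space_deriv v (h, x0))) has_real_derivative
     frechet_derivative (\<lambda>x. F x u v) (at x0) (generator x0)
     + F x0 (frechet_derivative generator (at x0) u) v + F x0 u (frechet_derivative generator (at x0) v)) (at 0)"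
proof -
  let ?X = "generator x0" and ?DX = "frechet_derivative generator (at x0)"
  have \<gamma>0: "\<gamma> 0 = x0" using \<gamma>(1) initial[OF x0] by simp
  have \<gamma>': "(\<gamma> has_derivative (\<lambda>h. h *\<^sub>R ?X)) (at 0)" using \<gamma>(2) by (simp add: has_vector_derivative_def)
  have dg: "((\<lambda>h. space_deriv u (h, x0)) has_vector_derivative ?DX u) (at 0)" for u
  proof -
    show ?thesis using has_derivative_slice(2)[OF space_deriv_has_derivative[of u]]
      by (simp add: has_vector_derivative_def)
  qed
  have dF: "((\<lambda>h. F (\<gamma> h) a b) has_real_derivative frechet_derivative (\<lambda>x. F x a b) (at x0) ?X) (at 0)" for a b
  proof -
    have d: "((\<lambda>x. F x a b) has_derivative frechet_derivative (\<lambda>x. F x a b) (at x0)) (at x0)"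
      using F(2) frechet_derivative_works by blast
    from has_derivative_compose[OF \<gamma>', of "\<lambda>x. F x a b"] d \<gamma>0
    have "((\<lambda>h. F (\<gamma> h) a b) has_derivative (\<lambda>h. frechet_derivative (\<lambda>x. F x a b) (at x0) (h *\<^sub>R ?X))) (at 0)" by simp
    then show ?thesis unfolding has_field_derivative_def
      using linear_scale[OF has_derivative_linear[OF d]] by (simp add: mult_commute_abs)
  qed
  have expand: "F x a b = (\<Sum>i\<in>Basis. \<Sum>j\<in>Basis. (a \<bullet> i) * (b \<bullet> j) * F x i j)" if "x \<in> N" for x a b
  proof -
    have l: "linear (F x a)" "linear (\<lambda>a. F x a b)" for a b using F(1)[OF that] unfolding bilinear_def by auto
    have "F x a b = (\<Sum>i\<in>Basis. (a \<bullet> i) * F x i b)"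
      by (subst euclidean_representation[of a, symmetric]) (simp add: linear_sum[OF l(2)] linear_scale[OF l(2)])
    moreover have "F x i b = (\<Sum>j\<in>Basis. (b \<bullet> j) * F x i j)" for i
      by (subst euclidean_representation[of b, symmetric]) (simp add: linear_sum[OF l(1)] linear_scale[OF l(1)])
    ultimately show ?thesis by (simp add: sum_distrib_left mult.assoc)
  qed
  let ?gu = "\<lambda>h. space_deriv u (h, x0)" and ?gv = "\<lambda>h. space_deriv v (h, x0)"
  have di: "((\<lambda>h. space_deriv u (h, x0) \<bullet> i) has_real_derivative ?DX u \<bullet> i) (at 0)" for u i
    using has_derivative_inner_left[OF dg[unfolded has_vector_derivative_def], of u i]
    by (simp add: has_field_derivative_def mult.commute[of _ "_ \<bullet> _"] cong: if_cong)
  have "((\<lambda>h. \<Sum>i\<in>Basis. \<Sum>j\<in>Basis. (?gu h \<bullet> i) * (?gv h \<bullet> j) * F (\<gamma> h) i j) has_real_derivative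
     (\<Sum>i\<in>Basis. \<Sum>j\<in>Basis. ((?DX u \<bullet> i) * (?gv 0 \<bullet> j) + (?DX v \<bullet> j) * (?gu 0 \<bullet> i)) * F (\<gamma> 0) i j
        + frechet_derivative (\<lambda>x. F x i j) (at x0) ?X * ((?gu 0 \<bullet> i) * (?gv 0 \<bullet> j)))) (at 0)"
    by (intro DERIV_sum DERIV_mult di dF)
  moreover have "(\<Sum>i\<in>Basis. \<Sum>j\<in>Basis. ((?DX u \<bullet> i) * (?gv 0 \<bullet> j) + (?DX v \<bullet> j) * (?gu 0 \<bullet> i)) * F (\<gamma> 0) i j
        + frechet_derivative (\<lambda>x. F x i j) (at x0) ?X * ((?gu 0 \<bullet> i) * (?gv 0 \<bullet> j)))
     = frechet_derivative (\<lambda>x. F x u v) (at x0) ?X + F x0 (?DX u) v + F x0 u (?DX v)"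
  proof -
    have "((\<lambda>x. \<Sum>i\<in>Basis. \<Sum>j\<in>Basis. (u \<bullet> i) * (v \<bullet> j) * F x i j) has_derivative
       (\<lambda>e. \<Sum>i\<in>Basis. \<Sum>j\<in>Basis. (u \<bullet> i) * (v \<bullet> j) * frechet_derivative (\<lambda>x. F x i j) (at x0) e)) (at x0)"
      using F(2) by (intro has_derivative_sum has_derivative_mult_right) (simp add: frechet_derivative_works)
    then have d: "((\<lambda>x. F x u v) has_derivative
       (\<lambda>e. \<Sum>i\<in>Basis. \<Sum>j\<in>Basis. (u \<bullet> i) * (v \<bullet> j) * frechet_derivative (\<lambda>x. F x i j) (at x0) e)) (at x0)"
      by (rule has_derivative_transform_within_open[OF _ N]) (simp add: expand[of _ u v])
    have fu: "frechet_derivative (\<lambda>x. F x u v) (at x0) ?X =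
       (\<Sum>i\<in>Basis. \<Sum>j\<in>Basis. (u \<bullet> i) * (v \<bullet> j) * frechet_derivative (\<lambda>x. F x i j) (at x0) ?X)"
      by (rule fun_cong[OF frechet_derivative_eqI[OF d]])
    show ?thesis unfolding fu expand[OF N(2), of "?DX u" v] expand[OF N(2), of u "?DX v"] \<gamma>0 space_deriv_0[OF x0]
      by (simp add: sum.distrib algebra_simps)
  qed
  ultimately have "((\<lambda>h. \<Sum>i\<in>Basis. \<Sum>j\<in>Basis. (?gu h \<bullet> i) * (?gv h \<bullet> j) * F (\<gamma> h) i j) has_real_derivative
     frechet_derivative (\<lambda>x. F x u v) (at x0) ?X + F x0 (?DX u) v + F x0 u (?DX v)) (at 0)" by simp
  note main = this
  have "isCont \<gamma> 0" using \<gamma>(2) has_vector_derivative_continuous by blast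
  then have "\<forall>\<^sub>F h in nhds 0. \<gamma> h \<in> N"
    using topological_tendstoD[OF _ N(1), of \<gamma> x0 "nhds 0"] N(2) \<gamma>0 by (simp add: isCont_def tendsto_nhds_iff)
  then obtain T where T0: "open T" "0 \<in> T" and T: "\<And>h. h \<in> T \<Longrightarrow> \<gamma> h \<in> N" unfolding eventually_nhds by blast
  show ?thesis
    by (rule has_field_derivative_transform_within_open[OF main T0]) (rule expand[OF T, symmetric])
qed

end

text \<open>Closedness rewrites the first summand through \<open>F (Y, b)\<close> and \<open>F (Y, a)\<close>; differentiating the
  Hamiltonian equation turns these into the other two summands, up to Hessian terms that cancel.\<close>

lemma hamiltonian_lie_derivative_zero:
  fixes F :: "'e::euclidean_space \<Rightarrow> 'e \<Rightarrow> 'e \<Rightarrow> real" and Y :: "'e \<Rightarrow> 'e" and h :: "'e \<Rightarrow> real"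
  assumes N: "open N" "x0 \<in> N"
    and F: "\<And>x. x \<in> N \<Longrightarrow> bilinear (F x)" "\<And>u v. F x0 u v = - F x0 v u"
      "\<And>u v. (\<lambda>x. F x u v) differentiable (at x0)"
    and Y: "Y differentiable (at x0)"
    and h: "smooth_on N h"
    and ham: "\<And>x v. x \<in> N \<Longrightarrow> F x (Y x) v = - frechet_derivative h (at x) v"
    and closed: "\<And>u v w. frechet_derivative (\<lambda>y. F y v w) (at x0) u - frechet_derivative (\<lambda>y. F y u w) (at x0) v
        + frechet_derivative (\<lambda>y. F y u v) (at x0) w = 0"
  shows "frechet_derivative (\<lambda>x. F x a b) (at x0) (Y x0)
     + F x0 (frechet_derivative Y (at x0) a) b + F x0 a (frechet_derivative Y (at x0) b) = 0"
proof -
  let ?DY = "frechet_derivative Y (at x0)"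
  have dF: "((\<lambda>x. F x u v) has_derivative frechet_derivative (\<lambda>x. F x u v) (at x0)) (at x0)" for u v
    using F(3) frechet_derivative_works by blast
  have dY: "(Y has_derivative ?DY) (at x0)" using Y frechet_derivative_works by blast
  have expand: "F x e v = (\<Sum>i\<in>Basis. (e \<bullet> i) * F x i v)" if "x \<in> N" for x e v
  proof -
    have l: "linear (\<lambda>a. F x a v)" using F(1)[OF that] unfolding bilinear_def by auto
    show ?thesis
      by (subst euclidean_representation[of e, symmetric]) (simp add: linear_sum[OF l] linear_scale[OF l])
  qed
  have key: "frechet_derivative (\<lambda>x. F x (Y x0) v) (at x0) e + F x0 (?DY e) v
      = - frechet_derivative (\<lambda>y. frechet_derivative h (at y) v) (at x0) e" for v e
  proof -
    have "((\<lambda>x. \<Sum>i\<in>Basis. (Y x \<bullet> i) * F x i v) has_derivative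
        (\<lambda>e. \<Sum>i\<in>Basis. (Y x0 \<bullet> i) * frechet_derivative (\<lambda>x. F x i v) (at x0) e + (?DY e \<bullet> i) * F x0 i v)) (at x0)"
      by (intro has_derivative_sum has_derivative_mult has_derivative_inner_left dF dY)
    then have "((\<lambda>x. - frechet_derivative h (at x) v) has_derivative
        (\<lambda>e. \<Sum>i\<in>Basis. (Y x0 \<bullet> i) * frechet_derivative (\<lambda>x. F x i v) (at x0) e + (?DY e \<bullet> i) * F x0 i v)) (at x0)"
      by (rule has_derivative_transform_within_open[OF _ N]) (simp add: expand[symmetric] ham)
    moreover have "((\<lambda>x. - frechet_derivative h (at x) v) has_derivative
        (\<lambda>e. - frechet_derivative (\<lambda>y. frechet_derivative h (at y) v) (at x0) e)) (at x0)"
      by (intro has_derivative_minus smooth_on_has_derivative[OF smooth_on_frechet_derivative[OF h] N(2)])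
    ultimately have 1: "(\<Sum>i\<in>Basis. (Y x0 \<bullet> i) * frechet_derivative (\<lambda>x. F x i v) (at x0) e + (?DY e \<bullet> i) * F x0 i v)
        = - frechet_derivative (\<lambda>y. frechet_derivative h (at y) v) (at x0) e"
      by (intro fun_cong[OF has_derivative_unique])
    have "((\<lambda>x. \<Sum>i\<in>Basis. (Y x0 \<bullet> i) * F x i v) has_derivative
        (\<lambda>e. \<Sum>i\<in>Basis. (Y x0 \<bullet> i) * frechet_derivative (\<lambda>x. F x i v) (at x0) e)) (at x0)"
      by (intro has_derivative_sum has_derivative_mult_right dF)
    then have d: "((\<lambda>x. F x (Y x0) v) has_derivative
        (\<lambda>e. \<Sum>i\<in>Basis. (Y x0 \<bullet> i) * frechet_derivative (\<lambda>x. F x i v) (at x0) e)) (at x0)"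
      by (rule has_derivative_transform_within_open[OF _ N]) (simp add: expand[of _ "Y x0"])
    have "frechet_derivative (\<lambda>x. F x (Y x0) v) (at x0) e
        = (\<Sum>i\<in>Basis. (Y x0 \<bullet> i) * frechet_derivative (\<lambda>x. F x i v) (at x0) e)"
      by (rule fun_cong[OF frechet_derivative_eqI[OF d]])
    then show ?thesis using 1 expand[OF N(2), of "?DY e" v] by (simp add: sum.distrib)
  qed
  have sym: "frechet_derivative (\<lambda>y. frechet_derivative h (at y) a) (at x0) b
      = frechet_derivative (\<lambda>y. frechet_derivative h (at y) b) (at x0) a"
    by (rule second_derivative_symmetric[OF N h])
  show ?thesis using closed[of a b "Y x0"] closed[of "Y x0" a b] key[of b a] key[of a b] sym F(2)[of a "?DY b"]
    by linarith
qed

section \<open>The tangent flow\<close>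

locale manifold_flow =
  fixes A :: "('m::{t2_space, second_countable_topology}, 'e::euclidean_space) chart set"
    and X :: "'m \<Rightarrow> ('m, 'e) tvec" and \<Phi> :: "real \<Rightarrow> 'm \<Rightarrow> 'm"
  assumes manifold: "smooth_atlas A" and flow: "complete_flow A X \<Phi>"
begin

lemma chartD:
  assumes "c \<in> A"
  shows "open (chart_dom c)" "open (chart_image c)" "continuous_on (chart_dom c) (chart_map c)"
    "continuous_on (chart_image c) (chart_inv c)"
    "p \<in> chart_dom c \<Longrightarrow> chart_inv c (chart_map c p) = p"
    "p \<in> chart_dom c \<Longrightarrow> chart_map c p \<in> chart_image c"
    "x \<in> chart_image c \<Longrightarrow> chart_map c (chart_inv c x) = x"
    "x \<in> chart_image c \<Longrightarrow> chart_inv c x \<in> chart_dom c"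
proof -
  have "is_chart c" using manifold assms unfolding smooth_atlas_def by blast
  then have "open (chart_dom c)" "open (chart_image c)"
    "homeomorphism (chart_dom c) (chart_image c) (chart_map c) (chart_inv c)"
    unfolding is_chart_def by auto
  then show "open (chart_dom c)" "open (chart_image c)" "continuous_on (chart_dom c) (chart_map c)"
    "continuous_on (chart_image c) (chart_inv c)"
    "p \<in> chart_dom c \<Longrightarrow> chart_inv c (chart_map c p) = p"
    "p \<in> chart_dom c \<Longrightarrow> chart_map c p \<in> chart_image c"
    "x \<in> chart_image c \<Longrightarrow> chart_map c (chart_inv c x) = x"
    "x \<in> chart_image c \<Longrightarrow> chart_inv c x \<in> chart_dom c"
    unfolding homeomorphism_def by auto
qed

lemma charts_atD: "c \<in> charts_at A p \<Longrightarrow> c \<in> A" "c \<in> charts_at A p \<Longrightarrow> p \<in> chart_dom c"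
  unfolding charts_at_def by auto

lemma charts_atI: "c \<in> A \<Longrightarrow> p \<in> chart_dom c \<Longrightarrow> c \<in> charts_at A p"
  unfolding charts_at_def by auto

lemma some_chart: "some_chart A p \<in> charts_at A p"
proof -
  have "p \<in> (\<Union>c\<in>A. chart_dom c)" using manifold unfolding smooth_atlas_def by simp
  then have "\<exists>c. c \<in> charts_at A p" by (auto simp: charts_at_def)
  then show ?thesis unfolding some_chart_def by (rule someI_ex)
qed

lemma flow_continuous: "continuous_on UNIV (\<lambda>(t, p). \<Phi> t p)"
  and flow_0: "\<Phi> 0 p = p"
  and flow_add: "\<Phi> (s + t) p = \<Phi> s (\<Phi> t p)"
  and flow_generator: "c \<in> charts_at A (\<Phi> t p) \<Longrightarrow>
     ((\<lambda>s. chart_map c (\<Phi> s p)) has_vector_derivative X (\<Phi> t p) c) (at t)"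
  using flow unfolding complete_flow_def by blast+

lemma flow_minus: "\<Phi> (- t) (\<Phi> t p) = p" "\<Phi> t (\<Phi> (- t) p) = p"
  using flow_add[of "- t" t p] flow_add[of t "- t" p] flow_0 by auto

lemma flow_tendsto: "(f \<longlongrightarrow> t) F \<Longrightarrow> (g \<longlongrightarrow> p) F \<Longrightarrow> ((\<lambda>k. \<Phi> (f k) (g k)) \<longlongrightarrow> \<Phi> t p) F"
  using continuous_on_tendsto_compose[OF flow_continuous, of "\<lambda>k. (f k, g k)" "(t, p)" F]
  by (simp add: tendsto_Pair)

section \<open>The differential of the flow in charts\<close>

definition flow_coord :: "('m, 'e) chart \<Rightarrow> ('m, 'e) chart \<Rightarrow> real \<times> 'e \<Rightarrow> 'e"
  where "flow_coord c d = (\<lambda>(t, x). chart_map d (\<Phi> t (chart_inv c x)))"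

definition flow_dom :: "('m, 'e) chart \<Rightarrow> ('m, 'e) chart \<Rightarrow> (real \<times> 'e) set"
  where "flow_dom c d = {(t, x). x \<in> chart_image c \<and> \<Phi> t (chart_inv c x) \<in> chart_dom d}"

text \<open>For t = 0 this is the derivative of a transition map. Coordinate changes, tangent maps
  and their compositions are thereby governed by the single identity
  \<open>Dflow_cocycle\<close>.\<close>

definition Dflow :: "('m, 'e) chart \<Rightarrow> ('m, 'e) chart \<Rightarrow> real \<Rightarrow> 'm \<Rightarrow> 'e \<Rightarrow> 'e"
  where "Dflow c d t p = frechet_derivative (chart_map d \<circ> \<Phi> t \<circ> chart_inv c) (at (chart_map c p))"

lemma flow_dom_open:
  assumes "c \<in> A" "d \<in> A"
  shows "open (flow_dom c d)"
proof -
  have "continuous_on (UNIV \<times> chart_image c) (\<lambda>z. (fst z, chart_inv c (snd z)))"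
    by (intro continuous_intros continuous_on_compose2[OF chartD(4)[OF assms(1)]]) auto
  then have "continuous_on (UNIV \<times> chart_image c) (\<lambda>z. \<Phi> (fst z) (chart_inv c (snd z)))"
    by (rule continuous_on_compose2[OF flow_continuous, of _ "\<lambda>z. (fst z, chart_inv c (snd z))", simplified])
  moreover have "open (UNIV \<times> chart_image c :: (real \<times> 'e) set)"
    by (intro open_Times chartD(2)[OF assms(1)]) auto
  ultimately have "open (UNIV \<times> chart_image c \<inter> (\<lambda>z. \<Phi> (fst z) (chart_inv c (snd z))) -` chart_dom d)"
    using chartD(1)[OF assms(2)] by (rule continuous_open_preimage)
  also have "UNIV \<times> chart_image c \<inter> (\<lambda>z. \<Phi> (fst z) (chart_inv c (snd z))) -` chart_dom d = flow_dom c d"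
    unfolding flow_dom_def by auto
  finally show ?thesis .
qed

lemma flow_coord_smooth: "c \<in> A \<Longrightarrow> d \<in> A \<Longrightarrow> smooth_on (flow_dom c d) (flow_coord c d)"
  using flow unfolding complete_flow_def flow_dom_def flow_coord_def by blast

lemma flow_dom_mem: "c \<in> charts_at A p \<Longrightarrow> d \<in> charts_at A (\<Phi> t p) \<Longrightarrow> (t, chart_map c p) \<in> flow_dom c d"
  unfolding flow_dom_def charts_at_def using chartD by auto

lemma Dflow_has_derivative:
  assumes "c \<in> charts_at A p" "d \<in> charts_at A (\<Phi> t p)"
  shows "((chart_map d \<circ> \<Phi> t \<circ> chart_inv c) has_derivative Dflow c d t p) (at (chart_map c p))"
    and "Dflow c d t p e = frechet_derivative (flow_coord c d) (at (t, chart_map c p)) (0, e)"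
proof -
  have "(flow_coord c d has_derivative frechet_derivative (flow_coord c d) (at (t, chart_map c p))) (at (t, chart_map c p))"
    by (rule smooth_on_has_derivative[OF flow_coord_smooth flow_dom_mem]) (use assms charts_atD in auto)
  from has_derivative_slice(1)[OF this]
  have *: "((chart_map d \<circ> \<Phi> t \<circ> chart_inv c) has_derivative
     (\<lambda>e. frechet_derivative (flow_coord c d) (at (t, chart_map c p)) (0, e))) (at (chart_map c p))"
    by (simp add: flow_coord_def o_def)
  have eq: "Dflow c d t p = (\<lambda>e. frechet_derivative (flow_coord c d) (at (t, chart_map c p)) (0, e))"
    unfolding Dflow_def by (rule frechet_derivative_eqI[OF *])
  show "((chart_map d \<circ> \<Phi> t \<circ> chart_inv c) has_derivative Dflow c d t p) (at (chart_map c p))"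
    using * unfolding eq .
  show "Dflow c d t p e = frechet_derivative (flow_coord c d) (at (t, chart_map c p)) (0, e)"
    by (simp only: eq)
qed

lemma linear_Dflow: "c \<in> charts_at A p \<Longrightarrow> d \<in> charts_at A (\<Phi> t p) \<Longrightarrow> linear (Dflow c d t p)"
  using Dflow_has_derivative(1) has_derivative_linear by blast

lemma Dflow_cocycle:
  assumes c: "c \<in> charts_at A p" and d: "d \<in> charts_at A (\<Phi> t p)" and e: "e \<in> charts_at A (\<Phi> (s + t) p)"
  shows "Dflow d e s (\<Phi> t p) (Dflow c d t p v) = Dflow c e (s + t) p v"
proof -
  have e': "e \<in> charts_at A (\<Phi> s (\<Phi> t p))" using e by (simp add: flow_add)
  have "(chart_map d \<circ> \<Phi> t \<circ> chart_inv c) (chart_map c p) = chart_map d (\<Phi> t p)"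
    using chartD(5) charts_atD[OF c] by simp
  then have comp: "((\<lambda>x. (chart_map e \<circ> \<Phi> s \<circ> chart_inv d) ((chart_map d \<circ> \<Phi> t \<circ> chart_inv c) x)) has_derivative
     (\<lambda>v. Dflow d e s (\<Phi> t p) (Dflow c d t p v))) (at (chart_map c p))"
    using has_derivative_compose[OF Dflow_has_derivative(1)[OF c d],
        of "chart_map e \<circ> \<Phi> s \<circ> chart_inv d" "Dflow d e s (\<Phi> t p)"]
      Dflow_has_derivative(1)[OF d e'] by metis
  \<comment> \<open>The chart d can be inserted between the two flow maps only where the time t map
    lands in its domain, which holds near the base point.\<close>
  let ?U = "Pair t -` flow_dom c d"
  have "open ?U"
    by (rule open_vimage[OF flow_dom_open]) (use c d charts_atD in \<open>auto intro: continuous_on_Pair\<close>)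
  moreover have "chart_map c p \<in> ?U" using flow_dom_mem[OF c d] by simp
  ultimately have "((chart_map e \<circ> \<Phi> (s + t) \<circ> chart_inv c) has_derivative
     (\<lambda>v. Dflow d e s (\<Phi> t p) (Dflow c d t p v))) (at (chart_map c p))"
    by (rule has_derivative_transform_within_open[OF comp])
       (use d charts_atD chartD(5) in \<open>auto simp: flow_dom_def flow_add\<close>)
  from has_derivative_unique[OF this Dflow_has_derivative(1)[OF c e]] show ?thesis by metis
qed

lemma Dflow_id: "c \<in> charts_at A p \<Longrightarrow> Dflow c c 0 p v = v"
proof -
  assume c: "c \<in> charts_at A p"
  have "((chart_map c \<circ> \<Phi> 0 \<circ> chart_inv c) has_derivative (\<lambda>v. v)) (at (chart_map c p))"
    by (rule has_derivative_transform_within_open[OF has_derivative_ident chartD(2)[OF charts_atD(1)[OF c]]])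
       (simp_all add: flow_0 chartD charts_atD[OF c])
  moreover have "((chart_map c \<circ> \<Phi> 0 \<circ> chart_inv c) has_derivative Dflow c c 0 p) (at (chart_map c p))"
    using Dflow_has_derivative(1)[OF c, of c 0] c by (simp add: flow_0)
  ultimately show ?thesis by (intro fun_cong[OF has_derivative_unique])
qed

section \<open>Tangent vectors and tangent maps\<close>

lemma transition: "chart_map d \<circ> chart_inv c = chart_map d \<circ> \<Phi> 0 \<circ> chart_inv c"
  by (simp add: fun_eq_iff flow_0)

lemma tangent_space_eq: "tangent_space A p = {v. (\<forall>c. c \<notin> charts_at A p \<longrightarrow> v c = 0) \<and>
    (\<forall>c\<in>charts_at A p. \<forall>d\<in>charts_at A p. v d = Dflow c d 0 p (v c))}"
  unfolding tangent_space_def Dflow_def transition ..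

lemma tangent_coord:
  "v \<in> tangent_space A p \<Longrightarrow> c \<in> charts_at A p \<Longrightarrow> d \<in> charts_at A p \<Longrightarrow> v d = Dflow c d 0 p (v c)"
  unfolding tangent_space_eq by blast

lemma tangent_outside: "v \<in> tangent_space A p \<Longrightarrow> c \<notin> charts_at A p \<Longrightarrow> v c = 0"
  unfolding tangent_space_eq by blast

lemma coord_vec_eq: "coord_vec A c p e = (\<lambda>d. if d \<in> charts_at A p then Dflow c d 0 p e else 0)"
  unfolding coord_vec_def Dflow_def transition ..

lemma coord_vec_coord: "c \<in> charts_at A p \<Longrightarrow> coord_vec A c p e c = e"
  unfolding coord_vec_eq by (simp add: Dflow_id)

lemma coord_vec_tangent: "c \<in> charts_at A p \<Longrightarrow> coord_vec A c p e \<in> tangent_space A p"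
  using Dflow_cocycle[of c p _ 0 _ 0] unfolding tangent_space_eq coord_vec_eq by (auto simp: flow_0)

lemma coord_vec_of_coord: "v \<in> tangent_space A p \<Longrightarrow> c \<in> charts_at A p \<Longrightarrow> coord_vec A c p (v c) = v"
proof (rule ext)
  fix d assume v: "v \<in> tangent_space A p" and c: "c \<in> charts_at A p"
  show "coord_vec A c p (v c) d = v d"
  proof (cases "d \<in> charts_at A p")
    case True
    then show ?thesis using tangent_coord[OF v c True] by (simp add: coord_vec_eq)
  next
    case False
    then show ?thesis using tangent_outside[OF v] by (simp add: coord_vec_eq)
  qed
qed

lemma tangent_eqI:
  "u \<in> tangent_space A p \<Longrightarrow> v \<in> tangent_space A p \<Longrightarrow> c \<in> charts_at A p \<Longrightarrow> u c = v c \<Longrightarrow> u = v"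
  using coord_vec_of_coord by metis

lemma linear_coord_vec: "c \<in> charts_at A p \<Longrightarrow> linear (coord_vec A c p)"
  using linear_Dflow[of c p _ 0] unfolding coord_vec_eq
  by (intro linearI) (auto simp: fun_eq_iff flow_0 scaleR_fun_def linear_add linear_scale)

lemma linear_coord: "linear (\<lambda>v::('m, 'e) tvec. v c)"
  by (intro linearI) (simp_all add: scaleR_fun_def)

lemma tangent_space_coords: "c \<in> charts_at A p \<Longrightarrow> tangent_space A p = range (coord_vec A c p)"
  using coord_vec_of_coord[symmetric] coord_vec_tangent by blast

lemma subspace_tangent: "subspace (tangent_space A p)"
  using tangent_space_coords[OF some_chart] linear_subspace_image[OF linear_coord_vec[OF some_chart]]
  by (metis subspace_UNIV)

lemma linear_tangent_map: "linear (tangent_map A (\<Phi> t) p)"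
proof (rule linearI)
  let ?c = "some_chart A p"
  note l = linear_Dflow[OF some_chart, unfolded Dflow_def]
  note tm = tangent_map_def[of A "\<Phi> t" p, unfolded Let_def]
  show "tangent_map A (\<Phi> t) p (u + v) = tangent_map A (\<Phi> t) p u + tangent_map A (\<Phi> t) p v" for u v
    by (rule ext) (simp add: tm linear_add[OF l])
  show "tangent_map A (\<Phi> t) p (k *\<^sub>R u) = k *\<^sub>R tangent_map A (\<Phi> t) p u" for u k
    by (rule ext) (simp add: tm linear_scale[OF l] scaleR_fun_def)
qed

lemma tangent_map_coord:
  assumes "v \<in> tangent_space A p" "c \<in> charts_at A p" "d \<in> charts_at A (\<Phi> t p)"
  shows "tangent_map A (\<Phi> t) p v d = Dflow c d t p (v c)"
proof -
  let ?c = "some_chart A p"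
  have "tangent_map A (\<Phi> t) p v d = Dflow ?c d t p (v ?c)"
    unfolding tangent_map_def Let_def Dflow_def using assms(3) by simp
  also have "v ?c = Dflow c ?c 0 p (v c)" by (rule tangent_coord[OF assms(1,2) some_chart])
  also have "Dflow ?c d t p (Dflow c ?c 0 p (v c)) = Dflow c d t p (v c)"
    using Dflow_cocycle[of c p ?c 0 d t "v c"] some_chart assms by (simp add: flow_0)
  finally show ?thesis .
qed

lemma tangent_map_tangent:
  assumes "v \<in> tangent_space A p"
  shows "tangent_map A (\<Phi> t) p v \<in> tangent_space A (\<Phi> t p)"
  unfolding tangent_space_eq
proof (intro CollectI conjI allI impI ballI)
  show "tangent_map A (\<Phi> t) p v c = 0" if "c \<notin> charts_at A (\<Phi> t p)" for c
    using that unfolding tangent_map_def Let_def by simp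
  fix c d assume c: "c \<in> charts_at A (\<Phi> t p)" and d: "d \<in> charts_at A (\<Phi> t p)"
  show "tangent_map A (\<Phi> t) p v d = Dflow c d 0 (\<Phi> t p) (tangent_map A (\<Phi> t) p v c)"
    unfolding tangent_map_coord[OF assms some_chart c] tangent_map_coord[OF assms some_chart d]
    using Dflow_cocycle[OF some_chart c, of d 0] d by simp
qed

lemma tangent_map_add:
  assumes v: "v \<in> tangent_space A p"
  shows "tangent_map A (\<Phi> s) (\<Phi> t p) (tangent_map A (\<Phi> t) p v) = tangent_map A (\<Phi> (s + t)) p v"
proof -
  let ?c = "some_chart A p" and ?d = "some_chart A (\<Phi> t p)" and ?e = "some_chart A (\<Phi> (s + t) p)"
  note tm = tangent_map_tangent[OF v, of t]
  have e: "?e \<in> charts_at A (\<Phi> s (\<Phi> t p))" using some_chart[of "\<Phi> (s + t) p"] by (simp add: flow_add)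
  show ?thesis
  proof (rule tangent_eqI[OF _ _ some_chart[of "\<Phi> (s + t) p"]])
    show "tangent_map A (\<Phi> s) (\<Phi> t p) (tangent_map A (\<Phi> t) p v) \<in> tangent_space A (\<Phi> (s + t) p)"
      using tangent_map_tangent[OF tm, of s] by (simp add: flow_add)
    show "tangent_map A (\<Phi> s) (\<Phi> t p) (tangent_map A (\<Phi> t) p v) ?e = tangent_map A (\<Phi> (s + t)) p v ?e"
      unfolding tangent_map_coord[OF tm some_chart e] tangent_map_coord[OF v some_chart some_chart]
      by (rule Dflow_cocycle[OF some_chart some_chart some_chart])
  qed (rule tangent_map_tangent[OF v])
qed

lemma tangent_map_0: "v \<in> tangent_space A p \<Longrightarrow> tangent_map A (\<Phi> 0) p v = v"
proof -
  assume v: "v \<in> tangent_space A p"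
  have c: "some_chart A p \<in> charts_at A (\<Phi> 0 p)" using some_chart by (simp add: flow_0)
  have "tangent_map A (\<Phi> 0) p v (some_chart A p) = v (some_chart A p)"
    unfolding tangent_map_coord[OF v some_chart c] by (rule Dflow_id[OF some_chart])
  then show ?thesis using tangent_eqI[OF _ v some_chart] tangent_map_tangent[OF v, of 0] by (simp add: flow_0)
qed

lemma tangent_map_minus:
  "v \<in> tangent_space A p \<Longrightarrow> tangent_map A (\<Phi> (- t)) (\<Phi> t p) (tangent_map A (\<Phi> t) p v) = v"
  using tangent_map_add[of v p "- t" t] tangent_map_0 by simp

section \<open>The Lie bracket as a derivative along the flow\<close>

lemma local_flow_chart:
  assumes c: "c \<in> charts_at A p"
  shows "local_flow (flow_coord c c) (flow_dom c c) (chart_map c p)"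
proof
  show "open (flow_dom c c)" "smooth_on (flow_dom c c) (flow_coord c c)"
    using flow_dom_open flow_coord_smooth charts_atD[OF c] by auto
  show "(0, chart_map c p) \<in> flow_dom c c" using flow_dom_mem[OF c, of c 0] c by (simp add: flow_0)
  show "flow_coord c c (0, x) = x" if "(0, x) \<in> flow_dom c c" for x
    using that chartD(7) charts_atD[OF c] unfolding flow_dom_def flow_coord_def by (simp add: flow_0)
qed

text \<open>Identifies the time derivative of the flow in a chart with the coordinates of X, so that
  differentiability of X is inherited from smoothness of the flow.\<close>

lemma generator_eq:
  assumes c: "c \<in> charts_at A p" and x: "x \<in> chart_image c"
  shows "local_flow.generator (flow_coord c c) x = X (chart_inv c x) c"
proof -
  interpret local_flow "flow_coord c c" "flow_dom c c" "chart_map c p" by (rule local_flow_chart[OF c])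
  let ?q = "chart_inv c x"
  have q: "c \<in> charts_at A (\<Phi> 0 ?q)" using chartD(8)[OF charts_atD(1)[OF c] x] charts_atD[OF c] by (simp add: flow_0 charts_atI)
  have "(0, x) \<in> flow_dom c c" using x q charts_atD unfolding flow_dom_def by auto
  from has_derivative_slice(2)[OF smooth_on_has_derivative[OF smooth this]]
  have "((\<lambda>s. chart_map c (\<Phi> s ?q)) has_derivative (\<lambda>s. frechet_derivative (flow_coord c c) (at (0, x)) (s, 0))) (at 0)"
    by (simp add: flow_coord_def)
  from has_derivative_unique[OF this flow_generator[OF q, unfolded has_vector_derivative_def]]
  have "frechet_derivative (flow_coord c c) (at (0, x)) (1, 0) = 1 *\<^sub>R X (\<Phi> 0 ?q) c" by (rule fun_cong)
  then show ?thesis unfolding generator_def by (simp add: flow_0)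
qed

lemma lie_bracket_eq:
  assumes c: "c \<in> charts_at A p"
  shows "lie_bracket A X V p c = frechet_derivative (\<lambda>x. V (chart_inv c x) c) (at (chart_map c p)) (X p c)
    - frechet_derivative (local_flow.generator (flow_coord c c)) (at (chart_map c p)) (V p c)"
proof -
  have "frechet_derivative (\<lambda>x. X (chart_inv c x) c) (at (chart_map c p))
      = frechet_derivative (local_flow.generator (flow_coord c c)) (at (chart_map c p))"
    by (rule frechet_derivative_cong_open[OF chartD(2)[OF charts_atD(1)[OF c]]])
       (simp_all add: chartD charts_atD[OF c] generator_eq[OF c])
  then show ?thesis unfolding lie_bracket_def using c by simp
qed

lemma open_chart_image_Int:
  assumes "c \<in> A" "open U"
  shows "open (chart_map c ` (chart_dom c \<inter> U))"
proof -
  have "open (chart_image c \<inter> chart_inv c -` U)"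
    using continuous_open_preimage chartD assms by metis
  also have "chart_image c \<inter> chart_inv c -` U = chart_map c ` (chart_dom c \<inter> U)"
  proof (intro equalityI subsetI)
    fix x assume "x \<in> chart_image c \<inter> chart_inv c -` U"
    then have x: "x \<in> chart_image c" "chart_inv c x \<in> U" by auto
    then show "x \<in> chart_map c ` (chart_dom c \<inter> U)"
      using chartD(7,8)[OF assms(1) x(1)] by (metis IntI imageI)
  next
    fix x assume "x \<in> chart_map c ` (chart_dom c \<inter> U)"
    then show "x \<in> chart_image c \<inter> chart_inv c -` U" using chartD(5,6)[OF assms(1)] by auto
  qed
  finally show ?thesis .
qed

lemma flow_eventually_mem: "open U \<Longrightarrow> \<Phi> t p \<in> U \<Longrightarrow> \<forall>\<^sub>F s in nhds t. \<Phi> s p \<in> U"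
  using topological_tendstoD[OF flow_tendsto[OF filterlim_ident tendsto_const]] by blast

lemma pullback_has_vector_derivative_lie_bracket:
  assumes V: "smooth_vector_field_on A U V" and U: "open U" "q \<in> U" and d: "d \<in> charts_at A q"
  shows "((\<lambda>h. tangent_map A (\<Phi> (- h)) (\<Phi> h q) (V (\<Phi> h q)) d) has_vector_derivative lie_bracket A X V q d) (at 0)"
proof -
  interpret local_flow "flow_coord d d" "flow_dom d d" "chart_map d q" by (rule local_flow_chart[OF d])
  have dA: "d \<in> A" "q \<in> chart_dom d" using charts_atD[OF d] by auto
  let ?\<gamma> = "\<lambda>h. chart_map d (\<Phi> h q)" and ?V = "\<lambda>x. V (chart_inv d x) d"
  have gen: "generator (chart_map d q) = X q d"
    using generator_eq[OF d chartD(6)[OF dA]] chartD(5)[OF dA] by simp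
  have \<gamma>: "(?\<gamma> has_vector_derivative generator (chart_map d q)) (at 0)"
    using flow_generator[of d 0 q] d by (simp add: flow_0 gen)
  have "smooth_on (chart_map d ` (chart_dom d \<inter> U)) ?V"
    using V dA(1) unfolding smooth_vector_field_on_def by blast
  then have dV: "(?V has_derivative frechet_derivative ?V (at (chart_map d q))) (at (chart_map d q))"
    by (rule smooth_on_has_derivative) (use U dA in blast)
  have "((\<lambda>h. frechet_derivative (flow_coord d d) (at (- h, ?\<gamma> h)) (0, ?V (?\<gamma> h))) has_vector_derivative
           lie_bracket A X V q d) (at 0)"
    using pullback_has_vector_derivative[OF \<gamma> _ dV] chartD(5)[OF dA]
    by (simp add: flow_0 lie_bracket_eq[OF d] gen)
  note main = this
  have "\<forall>\<^sub>F h in nhds 0. \<Phi> h q \<in> U \<inter> chart_dom d"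
    using U dA chartD(1)[OF dA(1)] by (intro flow_eventually_mem) (auto simp: flow_0)
  then obtain T where T0: "open T" "0 \<in> T" and T: "\<And>h. h \<in> T \<Longrightarrow> \<Phi> h q \<in> U \<inter> chart_dom d"
    unfolding eventually_nhds by blast
  have eq: "frechet_derivative (flow_coord d d) (at (- h, ?\<gamma> h)) (0, ?V (?\<gamma> h))
      = tangent_map A (\<Phi> (- h)) (\<Phi> h q) (V (\<Phi> h q)) d" if "h \<in> T" for h
  proof -
    have mem: "\<Phi> h q \<in> U" "d \<in> charts_at A (\<Phi> h q)" using T[OF that] dA by (auto intro: charts_atI)
    then have tan: "V (\<Phi> h q) \<in> tangent_space A (\<Phi> h q)"
      using V unfolding smooth_vector_field_on_def by blast
    have d': "d \<in> charts_at A (\<Phi> (- h) (\<Phi> h q))" using d by (simp add: flow_minus)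
    show ?thesis unfolding tangent_map_coord[OF tan mem(2) d'] Dflow_has_derivative(2)[OF mem(2) d']
      using chartD(5)[OF charts_atD(1,2)[OF mem(2)]] by simp
  qed
  show ?thesis by (rule has_vector_derivative_transform_within_open[OF main T0 eq])
qed

text \<open>For small h the pulled back fields are tangent at q, and the change of chart at q is one
  fixed linear map. Differentiating their transformation rule at h = 0 gives that of the bracket,
  with no second derivatives of transition maps to compute.\<close>

lemma lie_bracket_tangent:
  assumes V: "smooth_vector_field_on A U V" and U: "open U" "q \<in> U"
  shows "lie_bracket A X V q \<in> tangent_space A q"
  unfolding tangent_space_eq
proof (intro CollectI conjI allI impI ballI)
  show "lie_bracket A X V q c = 0" if "c \<notin> charts_at A q" for c
    using that unfolding lie_bracket_def by simp
  fix c d assume c: "c \<in> charts_at A q" and d: "d \<in> charts_at A q"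
  let ?Z = "\<lambda>h. tangent_map A (\<Phi> (- h)) (\<Phi> h q) (V (\<Phi> h q))"
  note Z = pullback_has_vector_derivative_lie_bracket[OF assms]
  have lin: "linear (Dflow c d 0 q)" using linear_Dflow[OF c, of d 0] d by (simp add: flow_0)
  from has_derivative_compose[OF Z[OF c, unfolded has_vector_derivative_def]
      bounded_linear_imp_has_derivative[OF linear_conv_bounded_linear[THEN iffD1, OF lin]]]
  have "((\<lambda>h. Dflow c d 0 q (?Z h c)) has_vector_derivative Dflow c d 0 q (lie_bracket A X V q c)) (at 0)"
    by (simp add: has_vector_derivative_def linear_scale[OF lin])
  note main = this
  have "\<forall>\<^sub>F h in nhds 0. \<Phi> h q \<in> U" using U by (intro flow_eventually_mem) (auto simp: flow_0)
  then obtain T where T0: "open T" "0 \<in> T" and T: "\<And>h. h \<in> T \<Longrightarrow> \<Phi> h q \<in> U"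
    unfolding eventually_nhds by blast
  have eq: "Dflow c d 0 q (?Z h c) = ?Z h d" if "h \<in> T" for h
  proof -
    have "V (\<Phi> h q) \<in> tangent_space A (\<Phi> h q)"
      using V T[OF that] unfolding smooth_vector_field_on_def by blast
    from tangent_map_tangent[OF this, of "- h"] show ?thesis
      using tangent_coord[OF _ c d] by (simp add: flow_minus)
  qed
  have "((\<lambda>h. ?Z h d) has_vector_derivative Dflow c d 0 q (lie_bracket A X V q c)) (at 0)"
    by (rule has_vector_derivative_transform_within_open[OF main T0 eq])
  with Z[OF d] show "lie_bracket A X V q d = Dflow c d 0 q (lie_bracket A X V q c)"
    by (rule vector_derivative_unique_at)
qed

end

section \<open>Invariance of the symplectic form\<close>

locale symplectic_flow = manifold_flow A X \<Phi>
  for A :: "('m::{t2_space, second_countable_topology}, 'e::euclidean_space) chart set"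
    and X :: "'m \<Rightarrow> ('m, 'e) tvec" and \<Phi> :: "real \<Rightarrow> 'm \<Rightarrow> 'm" +
  fixes \<omega> :: "'m \<Rightarrow> ('m, 'e) tvec \<Rightarrow> ('m, 'e) tvec \<Rightarrow> real" and H :: "'m \<Rightarrow> real"
  assumes symplectic: "symplectic_form A \<omega>" and smooth_H: "smooth_function A H"
    and hamiltonian: "hamiltonian_vector_field A \<omega> H X"
begin

section \<open>The symplectic form in coordinates\<close>

lemma omega_linear: "u \<in> tangent_space A p \<Longrightarrow> v \<in> tangent_space A p \<Longrightarrow> w \<in> tangent_space A p \<Longrightarrow>
    \<omega> p (a *\<^sub>R u + b *\<^sub>R v) w = a * \<omega> p u w + b * \<omega> p v w"
  and omega_skew: "u \<in> tangent_space A p \<Longrightarrow> v \<in> tangent_space A p \<Longrightarrow> \<omega> p u v = - \<omega> p v u"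
  and form_coord_smooth: "c \<in> A \<Longrightarrow> smooth_on (chart_image c) (\<lambda>x. form_coord A \<omega> c x e f)"
  and omega_closed: "c \<in> A \<Longrightarrow> x \<in> chart_image c \<Longrightarrow> ext_deriv_coord A \<omega> c x e1 e2 e3 = 0"
proof -
  note S = symplectic[unfolded symplectic_form_def smooth_two_form_def]
  show "u \<in> tangent_space A p \<Longrightarrow> v \<in> tangent_space A p \<Longrightarrow> w \<in> tangent_space A p \<Longrightarrow>
    \<omega> p (a *\<^sub>R u + b *\<^sub>R v) w = a * \<omega> p u w + b * \<omega> p v w"
    using S[THEN conjunct1, THEN conjunct1] by simp
  show "u \<in> tangent_space A p \<Longrightarrow> v \<in> tangent_space A p \<Longrightarrow> \<omega> p u v = - \<omega> p v u"
    using S[THEN conjunct1, THEN conjunct2, THEN conjunct1] by blast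
  show "c \<in> A \<Longrightarrow> smooth_on (chart_image c) (\<lambda>x. form_coord A \<omega> c x e f)"
    using S[THEN conjunct1, THEN conjunct2, THEN conjunct2] by blast
  show "c \<in> A \<Longrightarrow> x \<in> chart_image c \<Longrightarrow> ext_deriv_coord A \<omega> c x e1 e2 e3 = 0"
    using S[THEN conjunct2, THEN conjunct2] by blast
qed

lemma X_tangent: "X p \<in> tangent_space A p"
  and omega_X: "v \<in> tangent_space A p \<Longrightarrow> \<omega> p (X p) v = - differential A H p v"
  using hamiltonian unfolding hamiltonian_vector_field_def by blast+

definition form_at :: "('m, 'e) chart \<Rightarrow> 'm \<Rightarrow> 'e \<Rightarrow> 'e \<Rightarrow> real"
  where "form_at c p e f = \<omega> p (coord_vec A c p e) (coord_vec A c p f)"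

lemma form_coord_eq: "form_coord A \<omega> c x = form_at c (chart_inv c x)"
  by (intro ext) (simp add: form_coord_def form_at_def Let_def)

lemma omega_coord: "u \<in> tangent_space A p \<Longrightarrow> v \<in> tangent_space A p \<Longrightarrow> c \<in> charts_at A p \<Longrightarrow>
    \<omega> p u v = form_at c p (u c) (v c)"
  unfolding form_at_def by (simp add: coord_vec_of_coord)

lemma form_at_skew: "c \<in> charts_at A p \<Longrightarrow> form_at c p e f = - form_at c p f e"
  unfolding form_at_def by (intro omega_skew coord_vec_tangent)

lemma form_at_bilinear:
  assumes c: "c \<in> charts_at A p"
  shows "bilinear (form_at c p)"
proof -
  note lin = linear_coord_vec[OF c] and tan = coord_vec_tangent[OF c]
  have 1: "linear (\<lambda>e. form_at c p e f)" for f
    unfolding form_at_def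
    using omega_linear[OF tan tan tan, where a = 1 and b = 1] omega_linear[OF tan tan tan, where b = 0]
    by (intro linearI) (simp_all add: linear_add[OF lin] linear_scale[OF lin])
  have "linear (\<lambda>f. - form_at c p f e)" for e using linear_compose_neg[OF 1] .
  then have "linear (form_at c p e)" for e using form_at_skew[OF c] by (metis (no_types, lifting) ext)
  with 1 show ?thesis unfolding bilinear_def by blast
qed

lemma differential_coord:
  assumes v: "v \<in> tangent_space A p" and c: "c \<in> charts_at A p"
  shows "differential A H p v = frechet_derivative (H \<circ> chart_inv c) (at (chart_map c p)) (v c)"
proof -
  let ?d = "some_chart A p"
  have d: "?d \<in> charts_at A p" by (rule some_chart)
  note cA = charts_atD[OF c] and dA = charts_atD[OF d]
  have Hd: "((H \<circ> chart_inv ?d) has_derivative frechet_derivative (H \<circ> chart_inv ?d) (at (chart_map ?d p))) (at (chart_map ?d p))"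
    by (rule smooth_on_has_derivative[OF _ chartD(6)[OF dA]]) (use smooth_H dA in \<open>auto simp: smooth_function_def\<close>)
  have tr: "((chart_map ?d \<circ> chart_inv c) has_derivative Dflow c ?d 0 p) (at (chart_map c p))"
    unfolding transition by (rule Dflow_has_derivative(1)[OF c]) (use d in \<open>simp add: flow_0\<close>)
  have "(chart_map ?d \<circ> chart_inv c) (chart_map c p) = chart_map ?d p" using chartD(5)[OF cA] by simp
  from has_derivative_compose[OF tr, unfolded this, OF Hd]
  have "((\<lambda>x. H (chart_inv ?d (chart_map ?d (chart_inv c x)))) has_derivative
      (\<lambda>e. frechet_derivative (H \<circ> chart_inv ?d) (at (chart_map ?d p)) (Dflow c ?d 0 p e))) (at (chart_map c p))"
    by (simp add: o_def)
  moreover have "open (chart_map c ` (chart_dom c \<inter> chart_dom ?d))"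
    by (rule open_chart_image_Int[OF cA(1) chartD(1)[OF dA(1)]])
  moreover have "chart_map c p \<in> chart_map c ` (chart_dom c \<inter> chart_dom ?d)" using cA dA by blast
  moreover have "H (chart_inv ?d (chart_map ?d (chart_inv c x))) = (H \<circ> chart_inv c) x"
    if "x \<in> chart_map c ` (chart_dom c \<inter> chart_dom ?d)" for x
    using that chartD(5)[OF cA(1)] chartD(5)[OF dA(1)] by force
  ultimately have "((H \<circ> chart_inv c) has_derivative
      (\<lambda>e. frechet_derivative (H \<circ> chart_inv ?d) (at (chart_map ?d p)) (Dflow c ?d 0 p e))) (at (chart_map c p))"
    by (rule has_derivative_transform_within_open)
  from frechet_derivative_eqI[OF this] show ?thesis
    unfolding differential_def Let_def using tangent_coord[OF v c d] by simp
qed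

text \<open>In one chart the derivative is the Lie derivative expression of
  \<open>bilinear_pushforward_has_real_derivative\<close>, which vanishes for a Hamiltonian field
  and a closed form by \<open>hamiltonian_lie_derivative_zero\<close>.\<close>

lemma omega_pushforward_derivative_0:
  assumes u: "u \<in> tangent_space A q" and v: "v \<in> tangent_space A q"
  shows "((\<lambda>h. \<omega> (\<Phi> h q) (tangent_map A (\<Phi> h) q u) (tangent_map A (\<Phi> h) q v)) has_real_derivative 0) (at 0)"
proof -
  obtain c where c: "c \<in> charts_at A q" using some_chart by blast
  note cA = charts_atD[OF c]
  let ?x0 = "chart_map c q"
  interpret local_flow "flow_coord c c" "flow_dom c c" ?x0 by (rule local_flow_chart[OF c])
  let ?\<gamma> = "\<lambda>h. flow_coord c c (h, ?x0)"
  have \<gamma>_eq: "?\<gamma> h = chart_map c (\<Phi> h q)" for h using chartD(5)[OF cA] by (simp add: flow_coord_def)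
  have gen: "generator x = X (chart_inv c x) c" if "x \<in> chart_image c" for x by (rule generator_eq[OF c that])
  have x0_im: "?x0 \<in> chart_image c" by (rule chartD(6)[OF cA])
  have \<gamma>: "(?\<gamma> has_vector_derivative generator ?x0) (at 0)"
    using flow_generator[of c 0 q] c chartD(5)[OF cA] unfolding \<gamma>_eq gen[OF x0_im] by (simp add: flow_0)
  have chart_at: "c \<in> charts_at A (chart_inv c x)" if "x \<in> chart_image c" for x
    using chartD(8)[OF cA(1) that] cA(1) by (rule charts_atI[rotated])
  let ?F = "form_coord A \<omega> c"
  have F: "bilinear (?F x)" if "x \<in> chart_image c" for x
    unfolding form_coord_eq by (rule form_at_bilinear[OF chart_at[OF that]])
  have dF: "(\<lambda>x. ?F x e f) differentiable (at ?x0)" for e f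
    by (rule smooth_on_differentiable[OF form_coord_smooth[OF cA(1)] x0_im])
  have "frechet_derivative (\<lambda>x. ?F x (u c) (v c)) (at ?x0) (generator ?x0)
     + ?F ?x0 (frechet_derivative generator (at ?x0) (u c)) (v c)
     + ?F ?x0 (u c) (frechet_derivative generator (at ?x0) (v c)) = 0"
  proof (rule hamiltonian_lie_derivative_zero[OF chartD(2)[OF cA(1)] x0_im F _ dF generator_differentiable])
    show "?F ?x0 e f = - ?F ?x0 f e" for e f
      unfolding form_coord_eq by (rule form_at_skew[OF chart_at[OF x0_im]])
    show "smooth_on (chart_image c) (H \<circ> chart_inv c)" using smooth_H cA(1) by (simp add: smooth_function_def)
    show "?F x (generator x) e = - frechet_derivative (H \<circ> chart_inv c) (at x) e" if x: "x \<in> chart_image c" for x e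
    proof -
      let ?p = "chart_inv c x"
      note cp = chart_at[OF x]
      have "?F x (generator x) e = \<omega> ?p (X ?p) (coord_vec A c ?p e)"
        unfolding form_coord_eq form_at_def gen[OF x] coord_vec_of_coord[OF X_tangent cp] ..
      also have "\<dots> = - frechet_derivative (H \<circ> chart_inv c) (at x) e"
        unfolding omega_X[OF coord_vec_tangent[OF cp]] differential_coord[OF coord_vec_tangent[OF cp] cp]
        using chartD(7)[OF cA(1) x] coord_vec_coord[OF cp] by simp
      finally show ?thesis .
    qed
    show "frechet_derivative (\<lambda>y. ?F y e2 e3) (at ?x0) e1 - frechet_derivative (\<lambda>y. ?F y e1 e3) (at ?x0) e2
        + frechet_derivative (\<lambda>y. ?F y e1 e2) (at ?x0) e3 = 0" for e1 e2 e3
      using omega_closed[OF cA(1) x0_im] unfolding ext_deriv_coord_def .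
  qed auto
  with bilinear_pushforward_has_real_derivative[OF refl \<gamma> chartD(2)[OF cA(1)] x0_im F dF, of "u c" "v c"]
  have main: "((\<lambda>h. ?F (?\<gamma> h) (space_deriv (u c) (h, ?x0)) (space_deriv (v c) (h, ?x0))) has_real_derivative 0) (at 0)"
    by simp
  have "\<forall>\<^sub>F h in nhds 0. \<Phi> h q \<in> chart_dom c"
    using cA(2) chartD(1)[OF cA(1)] by (intro flow_eventually_mem) (auto simp: flow_0)
  then obtain T where T0: "open T" "0 \<in> T" and T: "\<And>h. h \<in> T \<Longrightarrow> \<Phi> h q \<in> chart_dom c"
    unfolding eventually_nhds by blast
  have eq: "?F (?\<gamma> h) (space_deriv (u c) (h, ?x0)) (space_deriv (v c) (h, ?x0))
     = \<omega> (\<Phi> h q) (tangent_map A (\<Phi> h) q u) (tangent_map A (\<Phi> h) q v)" if "h \<in> T" for h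
  proof -
    have ch: "c \<in> charts_at A (\<Phi> h q)" using T[OF that] cA by (auto intro: charts_atI)
    show ?thesis
      unfolding omega_coord[OF tangent_map_tangent[OF u] tangent_map_tangent[OF v] ch] form_coord_eq \<gamma>_eq
        tangent_map_coord[OF u c ch] tangent_map_coord[OF v c ch] Dflow_has_derivative(2)[OF c ch] space_deriv_def
        chartD(5)[OF charts_atD[OF ch]] ..
  qed
  show ?thesis by (rule has_field_derivative_transform_within_open[OF main T0 eq])
qed

text \<open>By the group law the derivative at time t is the derivative at time 0 for the vectors
  already transported to \<open>\<Phi> t p\<close>, hence 0.\<close>

lemma omega_flow_invariant:
  assumes u: "u \<in> tangent_space A p" and v: "v \<in> tangent_space A p"
  shows "\<omega> (\<Phi> t p) (tangent_map A (\<Phi> t) p u) (tangent_map A (\<Phi> t) p v) = \<omega> p u v"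
proof -
  define f where "f t = \<omega> (\<Phi> t p) (tangent_map A (\<Phi> t) p u) (tangent_map A (\<Phi> t) p v)" for t
  have "(f has_real_derivative 0) (at t)" for t
  proof -
    have "((\<lambda>h. f (h + t)) has_real_derivative 0) (at 0)"
      using omega_pushforward_derivative_0[OF tangent_map_tangent[OF u] tangent_map_tangent[OF v], of t]
      unfolding f_def tangent_map_add[OF u] tangent_map_add[OF v] flow_add[symmetric] .
    then show ?thesis using DERIV_shift[of f 0 0 t] by simp
  qed
  then have "f t = f 0" using DERIV_isconst_all by blast
  then show ?thesis unfolding f_def by (simp add: flow_0 tangent_map_0 u v)
qed

section \<open>Lagrangian subspaces under the flow\<close>

lemma lagrangian_subset: "lagrangian_subspace A \<omega> p L \<Longrightarrow> L \<subseteq> tangent_space A p"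
  and lagrangian_isotropic: "lagrangian_subspace A \<omega> p L \<Longrightarrow> u \<in> L \<Longrightarrow> v \<in> L \<Longrightarrow> \<omega> p u v = 0"
  and lagrangian_maximal: "lagrangian_subspace A \<omega> p L \<Longrightarrow> v \<in> tangent_space A p \<Longrightarrow>
    (\<And>u. u \<in> L \<Longrightarrow> \<omega> p v u = 0) \<Longrightarrow> v \<in> L"
  and lagrangian_subspaceD: "lagrangian_subspace A \<omega> p L \<Longrightarrow> subspace L"
  unfolding lagrangian_subspace_def by blast+

lemma tangent_map_minus': "v \<in> tangent_space A (\<Phi> t p) \<Longrightarrow> tangent_map A (\<Phi> t) p (tangent_map A (\<Phi> (- t)) (\<Phi> t p) v) = v"
  using tangent_map_minus[of v "\<Phi> t p" "- t"] by (simp add: flow_minus)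

lemma lagrangian_image:
  assumes L: "lagrangian_subspace A \<omega> p L"
  shows "lagrangian_subspace A \<omega> (\<Phi> t p) (tangent_map A (\<Phi> t) p ` L)"
  unfolding lagrangian_subspace_def
proof (intro conjI equalityI subsetI CollectI ballI)
  show "subspace (tangent_map A (\<Phi> t) p ` L)"
    using linear_subspace_image[OF linear_tangent_map] L unfolding lagrangian_subspace_def by blast
  note sub = lagrangian_subset[OF L, THEN subsetD]
  show "v \<in> tangent_space A (\<Phi> t p)" if "v \<in> tangent_map A (\<Phi> t) p ` L" for v
    using that tangent_map_tangent sub by blast
  show "\<omega> (\<Phi> t p) v w = 0" if "v \<in> tangent_map A (\<Phi> t) p ` L" "w \<in> tangent_map A (\<Phi> t) p ` L" for v w
    using that omega_flow_invariant sub lagrangian_isotropic[OF L] by auto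
  fix v assume "v \<in> {v \<in> tangent_space A (\<Phi> t p). \<forall>w\<in>tangent_map A (\<Phi> t) p ` L. \<omega> (\<Phi> t p) v w = 0}"
  then have v: "v \<in> tangent_space A (\<Phi> t p)" and orth: "\<And>w. w \<in> L \<Longrightarrow> \<omega> (\<Phi> t p) v (tangent_map A (\<Phi> t) p w) = 0"
    by auto
  let ?v = "tangent_map A (\<Phi> (- t)) (\<Phi> t p) v"
  have tan: "?v \<in> tangent_space A p" using tangent_map_tangent[OF v, of "- t"] by (simp add: flow_minus)
  have "?v \<in> L"
  proof (rule lagrangian_maximal[OF L tan])
    show "\<omega> p ?v w = 0" if "w \<in> L" for w
      using omega_flow_invariant[OF tan sub[OF that], of t] orth[OF that] by (simp add: tangent_map_minus'[OF v])
  qed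
  then show "v \<in> tangent_map A (\<Phi> t) p ` L" using tangent_map_minus'[OF v] by (metis imageI)
qed

end

section \<open>Pulling the distribution back along the flow\<close>

lemma linear_scaleR_const: "linear f \<Longrightarrow> linear (\<lambda>x. f x *\<^sub>R v)"
  by (intro linearI) (simp_all add: linear_add linear_scale scaleR_add_left)

text \<open>The functionals are extended linearly to the whole space, which makes the
  trivialisations built from them linear as \<open>monotone_lagrangian_curve\<close>
  demands.\<close>

lemma coordinate_functionals:
  fixes z :: "nat \<Rightarrow> 'e::real_vector"
  assumes inj: "inj_on z {..<n}" and ind: "independent (z ` {..<n})"
  shows "\<exists>\<kappa> :: nat \<Rightarrow> 'e \<Rightarrow> real. (\<forall>j. linear (\<kappa> j)) \<and> (\<forall>x\<in>span (z ` {..<n}). (\<Sum>j<n. \<kappa> j x *\<^sub>R z j) = x)"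
proof -
  have "\<exists>g :: 'e \<Rightarrow> real. linear g \<and> (\<forall>b\<in>z ` {..<n}. g b = (if b = z j then 1 else 0))" for j
    by (rule linear_independent_extend[OF ind])
  then obtain \<kappa> :: "nat \<Rightarrow> 'e \<Rightarrow> real" where lin: "\<And>j. linear (\<kappa> j)"
    and \<kappa>: "\<And>j b. b \<in> z ` {..<n} \<Longrightarrow> \<kappa> j b = (if b = z j then 1 else 0)" by metis
  have "linear (\<lambda>x. \<Sum>j<n. \<kappa> j x *\<^sub>R z j)"
    using lin by (intro linear_compose_sum ballI linear_scaleR_const)
  then have "(\<Sum>j<n. \<kappa> j x *\<^sub>R z j) = id x" if "x \<in> span (z ` {..<n})" for x
  proof (rule linear_eq_on_span[OF _ linear_id _ that])
    fix b assume "b \<in> z ` {..<n}"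
    then obtain i where i: "i < n" "b = z i" by auto
    have "\<kappa> j b *\<^sub>R z j = (if j = i then b else 0)" if "j < n" for j
      using \<kappa>[of b j] i that inj_onD[OF inj, of i j] by auto
    then have "(\<Sum>j<n. \<kappa> j b *\<^sub>R z j) = (\<Sum>j<n. if j = i then b else 0)" by (intro sum.cong) auto
    then show "(\<Sum>j<n. \<kappa> j b *\<^sub>R z j) = id b" using i by simp
  qed
  with lin show ?thesis by auto
qed

lemma frame_image:
  assumes fr: "frame_on n U V D" and p: "p \<in> U" and f: "linear f" "inj_on f (D p)"
  shows "inj_on (\<lambda>i. f (V i p)) {..<n}" "independent ((\<lambda>i. f (V i p)) ` {..<n})"
    "span ((\<lambda>i. f (V i p)) ` {..<n}) = f ` D p"
proof -
  have V: "inj_on (\<lambda>i. V i p) {..<n}" "independent ((\<lambda>i. V i p) ` {..<n})" "span ((\<lambda>i. V i p) ` {..<n}) = D p"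
    using fr p unfolding frame_on_def by auto
  have img: "(\<lambda>i. f (V i p)) ` {..<n} = f ` (\<lambda>i. V i p) ` {..<n}" by (simp add: image_image)
  have "(\<lambda>i. V i p) ` {..<n} \<subseteq> D p" unfolding V(3)[symmetric] by (rule span_superset)
  then show "inj_on (\<lambda>i. f (V i p)) {..<n}"
    using comp_inj_on[OF V(1) inj_on_subset[OF f(2)]] by (simp add: o_def)
  show "independent ((\<lambda>i. f (V i p)) ` {..<n})"
    unfolding img by (rule linear_independent_injective_image[OF f(1) V(2)]) (simp add: V(3) f(2))
  show "span ((\<lambda>i. f (V i p)) ` {..<n}) = f ` D p"
    unfolding img linear_span_image[OF f(1)] V(3) ..
qed

locale monotone_flow = symplectic_flow A X \<Phi> \<omega> H
  for A :: "('m::{t2_space, second_countable_topology}, 'e::euclidean_space) chart set"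
    and X :: "'m \<Rightarrow> ('m, 'e) tvec" and \<Phi> :: "real \<Rightarrow> 'm \<Rightarrow> 'm"
    and \<omega> :: "'m \<Rightarrow> ('m, 'e) tvec \<Rightarrow> ('m, 'e) tvec \<Rightarrow> real" and H :: "'m \<Rightarrow> real" +
  fixes n :: nat and \<Lambda> :: "'m \<Rightarrow> ('m, 'e) tvec set"
  assumes dim: "DIM('e) = 2 * n"
    and lagrangian: "smooth_lagrangian_distribution n A \<omega> \<Lambda>"
    and monotone: "monotone_field A \<omega> \<Lambda> X"
    and no_conj: "no_conjugate_points A \<Lambda> \<Phi>"
begin

section \<open>Sections of the distribution and their pullbacks\<close>

lemma Lambda_lagrangian: "lagrangian_subspace A \<omega> p (\<Lambda> p)"
  using lagrangian unfolding smooth_lagrangian_distribution_def by blast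

lemma Lambda_tangent: "v \<in> \<Lambda> p \<Longrightarrow> v \<in> tangent_space A p"
  using lagrangian_subset[OF Lambda_lagrangian] by blast

lemma Lambda_frame:
  obtains U V where "open U" "p \<in> U" "\<And>i. i < n \<Longrightarrow> smooth_vector_field_on A U (V i)" "frame_on n U V \<Lambda>"
proof -
  have "\<exists>U V. open U \<and> p \<in> U \<and> (\<forall>i<n. smooth_vector_field_on A U (V i)) \<and> frame_on n U V \<Lambda>"
    using lagrangian unfolding smooth_lagrangian_distribution_def by blast
  then show thesis by (elim exE conjE) (rule that; blast)
qed

text \<open>Constant coefficients in a local frame give, through every vector of \<Lambda> at a
  point, a section to which \<open>monotone\<close> applies.\<close>

definition combination :: "(nat \<Rightarrow> real) \<Rightarrow> (nat \<Rightarrow> 'm \<Rightarrow> ('m, 'e) tvec) \<Rightarrow> 'm \<Rightarrow> ('m, 'e) tvec"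
  where "combination k V p = (\<Sum>j<n. k j *\<^sub>R V j p)"

lemma combination_section:
  assumes U: "open U" and V: "\<And>i. i < n \<Longrightarrow> smooth_vector_field_on A U (V i)" and fr: "frame_on n U V \<Lambda>"
  shows "smooth_section_on A \<Lambda> U (combination k V)"
  unfolding smooth_section_on_def
proof (intro conjI ballI)
  show mem: "combination k V p \<in> \<Lambda> p" if "p \<in> U" for p
  proof -
    have "\<Lambda> p = span ((\<lambda>i. V i p) ` {..<n})" using fr that unfolding frame_on_def by blast
    then show ?thesis unfolding combination_def by (simp only:) (intro span_sum span_scale span_base imageI)
  qed
  show "smooth_vector_field_on A U (combination k V)"
    unfolding smooth_vector_field_on_def
  proof (intro conjI ballI)
    show "combination k V p \<in> tangent_space A p" if "p \<in> U" for p using mem[OF that] by (rule Lambda_tangent)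
    fix c assume c: "c \<in> A"
    have "combination k V p c = (\<Sum>j<n. k j *\<^sub>R V j p c)" for p
      unfolding combination_def linear_sum[OF linear_coord] by (simp add: scaleR_fun_def)
    then show "smooth_on (chart_map c ` (chart_dom c \<inter> U)) (\<lambda>x. combination k V (chart_inv c x) c)"
      using V c unfolding smooth_vector_field_on_def
      by (auto intro!: smooth_on_linear_combination open_chart_image_Int U)
  qed
qed

text \<open>Reading the transported vector in one chart at p places the whole orbit in the fixed
  Euclidean space required by \<open>monotone_lagrangian_curve\<close>.\<close>

definition pull :: "('m, 'e) chart \<Rightarrow> 'm \<Rightarrow> real \<Rightarrow> ('m, 'e) tvec \<Rightarrow> 'e"
  where "pull c p t v = tangent_map A (\<Phi> (- t)) (\<Phi> t p) v c"

definition curve :: "('m, 'e) chart \<Rightarrow> 'm \<Rightarrow> real \<Rightarrow> 'e set"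
  where "curve c p t = pull c p t ` \<Lambda> (\<Phi> t p)"

lemma linear_pull: "linear (pull c p t)"
  unfolding pull_def using linear_compose[OF linear_tangent_map linear_coord] by (simp add: o_def)

lemma back_tangent: "v \<in> tangent_space A (\<Phi> t p) \<Longrightarrow> tangent_map A (\<Phi> (- t)) (\<Phi> t p) v \<in> tangent_space A p"
  using tangent_map_tangent[of v "\<Phi> t p" "- t"] by (simp add: flow_minus)

lemma pull_inj:
  assumes "c \<in> charts_at A p"
  shows "inj_on (pull c p t) (tangent_space A (\<Phi> t p))"
proof (rule inj_onI)
  fix u v assume u: "u \<in> tangent_space A (\<Phi> t p)" and v: "v \<in> tangent_space A (\<Phi> t p)"
    and eq: "pull c p t u = pull c p t v"
  have "tangent_map A (\<Phi> (- t)) (\<Phi> t p) u = tangent_map A (\<Phi> (- t)) (\<Phi> t p) v"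
    using tangent_eqI[OF back_tangent[OF u] back_tangent[OF v] assms] eq unfolding pull_def by blast
  then show "u = v" using tangent_map_minus'[OF u] tangent_map_minus'[OF v] by metis
qed

lemma form_at_pull:
  assumes c: "c \<in> charts_at A p" and u: "u \<in> tangent_space A (\<Phi> t p)" and v: "v \<in> tangent_space A (\<Phi> t p)"
  shows "form_at c p (pull c p t u) (pull c p t v) = \<omega> (\<Phi> t p) u v"
  using omega_flow_invariant[OF u v, of "- t"] omega_coord[OF back_tangent[OF u] back_tangent[OF v] c]
  unfolding pull_def by (simp add: flow_minus)

text \<open>With q = \<open>\<Phi> r p\<close>, the pullback over time \<open>h + r\<close> is the
  pullback over h to q followed by the linear map \<open>Dflow d c (- r) q\<close>, which is
  independent of h. This reduces the claim to the derivative at time 0 at q.\<close>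

lemma pull_has_vector_derivative:
  assumes V: "smooth_vector_field_on A U V" and U: "open U" "\<Phi> r p \<in> U" and c: "c \<in> charts_at A p"
  shows "((\<lambda>t. pull c p t (V (\<Phi> t p))) has_vector_derivative pull c p r (lie_bracket A X V (\<Phi> r p))) (at r)"
proof -
  define q where "q = \<Phi> r p"
  obtain d where d: "d \<in> charts_at A q" using some_chart by blast
  have c': "c \<in> charts_at A (\<Phi> (- r) q)" using c by (simp add: q_def flow_minus)
  have lin: "linear (Dflow d c (- r) q)" by (rule linear_Dflow[OF d c'])
  have q: "q \<in> U" using U q_def by simp
  note Z = pullback_has_vector_derivative_lie_bracket[OF V U(1) q d]
  have lie: "pull c p r (lie_bracket A X V (\<Phi> r p)) = Dflow d c (- r) q (lie_bracket A X V q d)"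
    unfolding pull_def q_def[symmetric] by (rule tangent_map_coord[OF lie_bracket_tangent[OF V U(1) q] d c'])
  from has_derivative_compose[OF Z[unfolded has_vector_derivative_def]
      bounded_linear_imp_has_derivative[OF linear_conv_bounded_linear[THEN iffD1, OF lin]]]
  have main: "((\<lambda>h. Dflow d c (- r) q (tangent_map A (\<Phi> (- h)) (\<Phi> h q) (V (\<Phi> h q)) d))
      has_vector_derivative pull c p r (lie_bracket A X V (\<Phi> r p))) (at 0)"
    by (simp add: has_vector_derivative_def linear_scale[OF lin] lie)
  have "\<forall>\<^sub>F h in nhds 0. \<Phi> h q \<in> U" using U(1) q by (intro flow_eventually_mem) (auto simp: flow_0)
  then obtain T where T0: "open T" "0 \<in> T" and T: "\<And>h. h \<in> T \<Longrightarrow> \<Phi> h q \<in> U"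
    unfolding eventually_nhds by blast
  have eq: "Dflow d c (- r) q (tangent_map A (\<Phi> (- h)) (\<Phi> h q) (V (\<Phi> h q)) d) = pull c p (h + r) (V (\<Phi> (h + r) p))"
    if "h \<in> T" for h
  proof -
    have Vt: "V (\<Phi> h q) \<in> tangent_space A (\<Phi> h q)"
      using V T[OF that] unfolding smooth_vector_field_on_def by blast
    have "Dflow d c (- r) q (tangent_map A (\<Phi> (- h)) (\<Phi> h q) (V (\<Phi> h q)) d)
        = tangent_map A (\<Phi> (- r)) q (tangent_map A (\<Phi> (- h)) (\<Phi> h q) (V (\<Phi> h q))) c"
      using tangent_map_coord[OF back_tangent[OF Vt] d c'] ..
    also have "\<dots> = tangent_map A (\<Phi> (- r + - h)) (\<Phi> h q) (V (\<Phi> h q)) c"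
      using tangent_map_add[OF Vt, of "- r" "- h"] by (simp add: flow_minus)
    also have "\<Phi> h q = \<Phi> (h + r) p" by (simp add: q_def flow_add)
    also have "- r + - h = - (h + r)" by simp
    finally show ?thesis unfolding pull_def q_def flow_add .
  qed
  have "((\<lambda>h. pull c p (h + r) (V (\<Phi> (h + r) p))) has_vector_derivative
      pull c p r (lie_bracket A X V (\<Phi> r p))) (at 0)"
    by (rule has_vector_derivative_transform_within_open[OF main T0 eq])
  moreover have "((\<lambda>t. t - r) has_derivative (\<lambda>h. h)) (at r)" by (auto intro!: derivative_eq_intros)
  ultimately show ?thesis
    using has_derivative_compose[of "\<lambda>t. t - r" "\<lambda>h. h" r UNIV "\<lambda>h. pull c p (h + r) (V (\<Phi> (h + r) p))"]
    unfolding has_vector_derivative_def by simp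
qed

lemma curve_monotone:
  assumes c: "c \<in> charts_at A p"
  shows "\<exists>G G'. (\<forall>t. linear (G t)) \<and> linear G' \<and> (\<forall>\<^sub>F t in at r. \<forall>x\<in>curve c p r. G t x \<in> curve c p t) \<and>
       (\<forall>x. ((\<lambda>t. G t x) has_vector_derivative G' x) (at r)) \<and>
       (\<forall>x\<in>curve c p r. G r x = x \<and> (x \<noteq> 0 \<longrightarrow> form_at c p (G' x) x > 0))"
proof -
  let ?q = "\<Phi> r p"
  obtain U V where U: "open U" "?q \<in> U" and V: "\<And>i. i < n \<Longrightarrow> smooth_vector_field_on A U (V i)"
    and fr: "frame_on n U V \<Lambda>" by (rule Lambda_frame[of ?q]) (rule that)
  have inj: "inj_on (pull c p r) (\<Lambda> ?q)" using pull_inj[OF c] Lambda_tangent by (meson inj_on_subset subsetI)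
  note fi = frame_image[OF fr U(2) linear_pull inj]
  obtain \<kappa> where lin: "\<And>j. linear (\<kappa> j)"
    and \<kappa>: "\<And>x. x \<in> curve c p r \<Longrightarrow> (\<Sum>j<n. \<kappa> j x *\<^sub>R pull c p r (V j ?q)) = x"
    using coordinate_functionals[OF fi(1,2)] unfolding fi(3) curve_def by blast
  \<comment> \<open>Expand x in the pulled back frame at time r and keep the coefficients while the
    frame moves to time t.\<close>
  define G where "G t x = (\<Sum>j<n. \<kappa> j x *\<^sub>R pull c p t (V j (\<Phi> t p)))" for t x
  define G' where "G' x = (\<Sum>j<n. \<kappa> j x *\<^sub>R pull c p r (lie_bracket A X (V j) ?q))" for x
  have G_comb: "G t x = pull c p t (combination (\<lambda>j. \<kappa> j x) V (\<Phi> t p))" for t x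
    unfolding G_def combination_def linear_sum[OF linear_pull] linear_scale[OF linear_pull] ..
  have linG: "linear (G t)" "linear G'" for t unfolding G_def G'_def
    using lin by (auto intro!: linear_compose_sum linear_scaleR_const)
  have der: "((\<lambda>t. G t x) has_vector_derivative G' x) (at r)" for x
    unfolding G_def G'_def
    by (intro has_vector_derivative_sum bounded_linear.has_vector_derivative[OF bounded_linear_scaleR_right]
        pull_has_vector_derivative[OF V U c]) auto
  have sec: "smooth_section_on A \<Lambda> U (combination k V)" for k by (rule combination_section[OF U(1) V fr])
  have Gr: "G r x = x" if "x \<in> curve c p r" for x using \<kappa>[OF that] by (simp add: G_def)
  have pos: "form_at c p (G' x) x > 0" if x: "x \<in> curve c p r" "x \<noteq> 0" for x
  proof -
    \<comment> \<open>For fixed x the curve \<open>G t x\<close> is the pullback of one section, so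
      its velocity is a single bracket. The sum defining \<open>G'\<close> serves linearity in x,
      the bracket serves positivity.\<close>
    let ?W = "combination (\<lambda>j. \<kappa> j x) V"
    have W: "smooth_vector_field_on A U ?W" using sec unfolding smooth_section_on_def by blast
    have "((\<lambda>t. G t x) has_vector_derivative pull c p r (lie_bracket A X ?W ?q)) (at r)"
      unfolding G_comb by (rule pull_has_vector_derivative[OF W U c])
    with der have G': "G' x = pull c p r (lie_bracket A X ?W ?q)" by (rule vector_derivative_unique_at)
    have x': "x = pull c p r (?W ?q)" using Gr[OF x(1)] by (simp add: G_comb)
    then have "?W ?q \<noteq> 0" using x(2) linear_0[OF linear_pull] by metis
    then have "bracket_form A \<omega> X ?W ?W ?q > 0"
      using monotone U sec unfolding monotone_field_def by blast
    moreover have "?W ?q \<in> tangent_space A ?q" using W U unfolding smooth_vector_field_on_def by blast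
    then have "form_at c p (G' x) x = bracket_form A \<omega> X ?W ?W ?q"
      unfolding bracket_form_def G' using form_at_pull[OF c lie_bracket_tangent[OF W U], of "?W ?q"] x' by simp
    ultimately show ?thesis by simp
  qed
  have "\<forall>\<^sub>F t in nhds r. \<Phi> t p \<in> U" using U by (rule flow_eventually_mem)
  then have "\<forall>\<^sub>F t in at r. \<Phi> t p \<in> U" by (auto simp: eventually_at_filter elim: eventually_mono)
  then have "\<forall>\<^sub>F t in at r. \<forall>x\<in>curve c p r. G t x \<in> curve c p t"
  proof eventually_elim
    case (elim t)
    show ?case
    proof
      fix x show "G t x \<in> curve c p t"
        using sec elim unfolding G_comb curve_def smooth_section_on_def by blast
    qed
  qed
  with linG der Gr pos show ?thesis by blast
qed

section \<open>The pulled back curve is Lagrangian and transversal\<close>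

lemma coord_lagrangian:
  assumes L: "lagrangian_subspace A \<omega> p L" and c: "c \<in> charts_at A p"
  shows "(\<lambda>v. v c) ` L = {e. \<forall>u\<in>(\<lambda>v. v c) ` L. form_at c p e u = 0}"
proof (intro equalityI subsetI)
  note sub = lagrangian_subset[OF L, THEN subsetD]
  fix e assume "e \<in> (\<lambda>v. v c) ` L"
  then show "e \<in> {e. \<forall>u\<in>(\<lambda>v. v c) ` L. form_at c p e u = 0}"
    using lagrangian_isotropic[OF L] omega_coord[OF sub sub c] by auto
next
  note sub = lagrangian_subset[OF L, THEN subsetD]
  fix e assume e: "e \<in> {e. \<forall>u\<in>(\<lambda>v. v c) ` L. form_at c p e u = 0}"
  have "coord_vec A c p e \<in> L"
  proof (rule lagrangian_maximal[OF L coord_vec_tangent[OF c]])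
    show "\<omega> p (coord_vec A c p e) u = 0" if "u \<in> L" for u
      using e that omega_coord[OF coord_vec_tangent[OF c] sub c] by (simp add: coord_vec_coord[OF c])
  qed
  then show "e \<in> (\<lambda>v. v c) ` L" using coord_vec_coord[OF c] by (metis imageI)
qed

lemma curve_image: "curve c p t = (\<lambda>v. v c) ` tangent_map A (\<Phi> (- t)) (\<Phi> t p) ` \<Lambda> (\<Phi> t p)"
  unfolding curve_def pull_def by (simp add: image_image)

lemma back_lagrangian: "lagrangian_subspace A \<omega> p (tangent_map A (\<Phi> (- t)) (\<Phi> t p) ` \<Lambda> (\<Phi> t p))"
  using lagrangian_image[OF Lambda_lagrangian, of "- t" "\<Phi> t p"] by (simp add: flow_minus)

lemma curve_transversal:
  assumes c: "c \<in> charts_at A p" and "s \<noteq> t"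
  shows "curve c p s \<inter> curve c p t = {0}"
proof (intro equalityI subsetI)
  fix e assume "e \<in> curve c p s \<inter> curve c p t"
  then obtain u v where u: "u \<in> \<Lambda> (\<Phi> s p)" "e = pull c p s u" and v: "v \<in> \<Lambda> (\<Phi> t p)" "e = pull c p t v"
    unfolding curve_def by blast
  note ut = Lambda_tangent[OF u(1)] and vt = Lambda_tangent[OF v(1)]
  have "tangent_map A (\<Phi> (- s)) (\<Phi> s p) u = tangent_map A (\<Phi> (- t)) (\<Phi> t p) v"
    using tangent_eqI[OF back_tangent[OF ut] back_tangent[OF vt] c] u v unfolding pull_def by simp
  then have "tangent_map A (\<Phi> t) p (tangent_map A (\<Phi> (- s)) (\<Phi> s p) u) = v"
    using tangent_map_minus'[OF vt] by simp
  \<comment> \<open>Transporting to time t compares the two members at \<open>\<Phi> t p\<close>,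
    with flow time \<open>t - s\<close>, where the absence of conjugate points applies.\<close>
  then have "v = tangent_map A (\<Phi> (t - s)) (\<Phi> s p) u"
    using tangent_map_add[OF ut, of t "- s"] by (simp add: flow_minus)
  moreover have "\<Phi> (t - s) (\<Phi> s p) = \<Phi> t p" using flow_add[of "t - s" s p] by simp
  then have "tangent_map A (\<Phi> (t - s)) (\<Phi> s p) ` \<Lambda> (\<Phi> s p) \<inter> \<Lambda> (\<Phi> t p) = {0}"
    using no_conj assms(2) unfolding no_conjugate_points_def
    by (metis cancel_comm_monoid_add_class.diff_cancel right_minus_eq)
  ultimately have "v = 0" using u(1) v(1) by blast
  then show "e \<in> {0}" using v(2) linear_0[OF linear_pull] by simp
next
  fix e :: 'e assume "e \<in> {0}"
  moreover have "0 \<in> curve c p t" for t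
    unfolding curve_def using linear_0[OF linear_pull] subspace_0[OF lagrangian_subspaceD[OF Lambda_lagrangian]]
    by (metis imageI)
  ultimately show "e \<in> curve c p s \<inter> curve c p t" by auto
qed

lemma monotone_curve:
  assumes c: "c \<in> charts_at A p"
  shows "monotone_lagrangian_curve (form_at c p) (curve c p) n"
proof
  show "bilinear (form_at c p)" by (rule form_at_bilinear[OF c])
  show "form_at c p u v = - form_at c p v u" for u v by (rule form_at_skew[OF c])
  show "DIM('e) = 2 * n" by (rule dim)
  show "subspace (curve c p t)" for t
    unfolding curve_def by (rule linear_subspace_image[OF linear_pull lagrangian_subspaceD[OF Lambda_lagrangian]])
  show "curve c p t = {v. \<forall>u\<in>curve c p t. form_at c p v u = 0}" for t
    unfolding curve_image by (rule coord_lagrangian[OF back_lagrangian c])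
  show "dim (curve c p t) = n" for t
  proof -
    obtain U V where U: "\<Phi> t p \<in> U" and fr: "frame_on n U V \<Lambda>" by (rule Lambda_frame[of "\<Phi> t p"]) (rule that)
    have inj: "inj_on (pull c p t) (\<Lambda> (\<Phi> t p))" using pull_inj[OF c] Lambda_tangent by (meson inj_on_subset subsetI)
    note fi = frame_image[OF fr U linear_pull inj]
    have "dim (curve c p t) = card ((\<lambda>i. pull c p t (V i (\<Phi> t p))) ` {..<n})"
      using dim_span_eq_card_independent[OF fi(2)] unfolding fi(3) curve_def .
    then show ?thesis using card_image[OF fi(1)] by simp
  qed
  show "s \<noteq> t \<Longrightarrow> curve c p s \<inter> curve c p t = {0}" for s t by (rule curve_transversal[OF c])
qed (rule curve_monotone[OF c])

section \<open>The limit distribution\<close>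

text \<open>Phrased with selections and all charts at p rather than with \<open>lim_L\<close> in a
  chosen chart, so that no choice of chart enters and the flow acts on it directly.\<close>

definition limit_distribution :: "'m \<Rightarrow> ('m, 'e) tvec set"
  where "limit_distribution p = {v \<in> tangent_space A p. \<exists>f. (\<forall>t. f t \<in> tangent_map A (\<Phi> (- t)) (\<Phi> t p) ` \<Lambda> (\<Phi> t p))
    \<and> (\<forall>c\<in>charts_at A p. ((\<lambda>t. f t c) \<longlongrightarrow> v c) at_top)}"

text \<open>One chart suffices to test convergence, because the change of chart at p is a fixed
  linear map.\<close>

lemma limit_distribution_coord:
  assumes c: "c \<in> charts_at A p"
  shows "limit_distribution p = coord_vec A c p ` monotone_lagrangian_curve.lim_L (curve c p)"
proof (intro equalityI subsetI)
  interpret monotone_lagrangian_curve "form_at c p" "curve c p" n by (rule monotone_curve[OF c])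
  fix v assume "v \<in> limit_distribution p"
  then obtain f where v: "v \<in> tangent_space A p"
    and f: "\<And>t. f t \<in> tangent_map A (\<Phi> (- t)) (\<Phi> t p) ` \<Lambda> (\<Phi> t p)" "((\<lambda>t. f t c) \<longlongrightarrow> v c) at_top"
    using c unfolding limit_distribution_def by blast
  have "f t c \<in> curve c p t" for t unfolding curve_image using f(1) by blast
  then have "v c \<in> lim_L" using f(2) unfolding lim_L_def by (intro CollectI exI[of _ "\<lambda>t. f t c"] conjI allI)
  then show "v \<in> coord_vec A c p ` lim_L" using coord_vec_of_coord[OF v c] by (metis imageI)
next
  interpret monotone_lagrangian_curve "form_at c p" "curve c p" n by (rule monotone_curve[OF c])
  fix v assume "v \<in> coord_vec A c p ` lim_L"
  then obtain e f where v: "v = coord_vec A c p e" and f: "\<And>t. f t \<in> curve c p t" "(f \<longlongrightarrow> e) at_top"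
    unfolding lim_L_def by blast
  have "coord_vec A c p (f t) \<in> tangent_map A (\<Phi> (- t)) (\<Phi> t p) ` \<Lambda> (\<Phi> t p)" for t
  proof -
    obtain u where u: "u \<in> tangent_map A (\<Phi> (- t)) (\<Phi> t p) ` \<Lambda> (\<Phi> t p)" "f t = u c"
      using f(1)[of t] unfolding curve_image by blast
    then have "u \<in> tangent_space A p" using lagrangian_subset[OF back_lagrangian] by blast
    then show ?thesis using u coord_vec_of_coord[OF _ c] by simp
  qed
  moreover have "((\<lambda>t. coord_vec A c p (f t) d) \<longlongrightarrow> v d) at_top" if d: "d \<in> charts_at A p" for d
  proof -
    have lin: "linear (Dflow c d 0 p)" using linear_Dflow[OF c, of d 0] d by (simp add: flow_0)
    show ?thesis unfolding v coord_vec_eq using d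
      by (simp add: bounded_linear.tendsto[OF linear_conv_bounded_linear[THEN iffD1, OF lin] f(2)])
  qed
  moreover have "v \<in> tangent_space A p" unfolding v by (rule coord_vec_tangent[OF c])
  ultimately show "v \<in> limit_distribution p"
    unfolding limit_distribution_def by (intro CollectI conjI exI[of _ "\<lambda>t. coord_vec A c p (f t)"] allI ballI)
qed

lemma limit_distribution_tangent: "v \<in> limit_distribution p \<Longrightarrow> v \<in> tangent_space A p"
  unfolding limit_distribution_def by blast

lemma lagrangian_of_coord:
  assumes M: "subspace M" "M = {e. \<forall>u\<in>M. form_at c p e u = 0}" and c: "c \<in> charts_at A p"
  shows "lagrangian_subspace A \<omega> p (coord_vec A c p ` M)"
  unfolding lagrangian_subspace_def
proof (intro conjI equalityI subsetI CollectI ballI)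
  show "subspace (coord_vec A c p ` M)" by (rule linear_subspace_image[OF linear_coord_vec[OF c] M(1)])
  show "v \<in> tangent_space A p" if "v \<in> coord_vec A c p ` M" for v
    using that coord_vec_tangent[OF c] by blast
  show "\<omega> p v w = 0" if v: "v \<in> coord_vec A c p ` M" and w: "w \<in> coord_vec A c p ` M" for v w
  proof -
    obtain e f where "e \<in> M" "f \<in> M" and vw: "v = coord_vec A c p e" "w = coord_vec A c p f" using v w by blast
    then have "form_at c p e f = 0" using M(2) by blast
    then show ?thesis unfolding vw form_at_def .
  qed
  fix v assume "v \<in> {v \<in> tangent_space A p. \<forall>w\<in>coord_vec A c p ` M. \<omega> p v w = 0}"
  then have v: "v \<in> tangent_space A p" and orth: "\<And>e. e \<in> M \<Longrightarrow> \<omega> p v (coord_vec A c p e) = 0" by auto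
  have "form_at c p (v c) e = 0" if "e \<in> M" for e
    using orth[OF that] unfolding form_at_def coord_vec_of_coord[OF v c] .
  then have "v c \<in> M" using M(2) by blast
  then show "v \<in> coord_vec A c p ` M" using coord_vec_of_coord[OF v c] by (metis imageI)
qed

lemma limit_distribution_lagrangian: "lagrangian_subspace A \<omega> p (limit_distribution p)"
proof -
  obtain c where c: "c \<in> charts_at A p" using some_chart by blast
  interpret monotone_lagrangian_curve "form_at c p" "curve c p" n by (rule monotone_curve[OF c])
  obtain R where "subspace lim_L" "lim_L = {v. \<forall>u\<in>lim_L. form_at c p v u = 0}"
    by (rule lim_L_structure[of "-1" 0]) auto
  then show ?thesis unfolding limit_distribution_coord[OF c] by (rule lagrangian_of_coord[OF _ _ c])
qed

lemma limit_distribution_push: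
  assumes v: "v \<in> limit_distribution p"
  shows "tangent_map A (\<Phi> s) p v \<in> limit_distribution (\<Phi> s p)"
proof -
  note vt = limit_distribution_tangent[OF v]
  obtain f where f: "\<And>t. f t \<in> tangent_map A (\<Phi> (- t)) (\<Phi> t p) ` \<Lambda> (\<Phi> t p)"
    "\<And>c. c \<in> charts_at A p \<Longrightarrow> ((\<lambda>t. f t c) \<longlongrightarrow> v c) at_top"
    using v unfolding limit_distribution_def by blast
  have ft: "f t \<in> tangent_space A p" for t using f(1) lagrangian_subset[OF back_lagrangian] by blast
  \<comment> \<open>The shift of the argument absorbs the extra flow time s, and it is harmless in a
    limit at infinity.\<close>
  define g where "g t = tangent_map A (\<Phi> s) p (f (s + t))" for t
  have "g t \<in> tangent_map A (\<Phi> (- t)) (\<Phi> t (\<Phi> s p)) ` \<Lambda> (\<Phi> t (\<Phi> s p))" for t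
  proof -
    have eq: "\<Phi> t (\<Phi> s p) = \<Phi> (s + t) p" by (simp add: flow_add[symmetric] add.commute)
    obtain u where u: "u \<in> \<Lambda> (\<Phi> (s + t) p)" "f (s + t) = tangent_map A (\<Phi> (- (s + t))) (\<Phi> (s + t) p) u"
      using f(1)[of "s + t"] by blast
    have "g t = tangent_map A (\<Phi> (- t)) (\<Phi> (s + t) p) u"
      using tangent_map_add[OF Lambda_tangent[OF u(1)], of s "- (s + t)"]
      unfolding g_def u(2) by (simp only: flow_minus) simp
    with u(1) show ?thesis unfolding eq by blast
  qed
  moreover have "((\<lambda>t. g t d) \<longlongrightarrow> tangent_map A (\<Phi> s) p v d) at_top" if d: "d \<in> charts_at A (\<Phi> s p)" for d
  proof -
    have "filterlim (\<lambda>t::real. s + t) at_top at_top"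
      by (rule filterlim_tendsto_add_at_top[OF tendsto_const filterlim_ident])
    then have "((\<lambda>t. f (s + t) (some_chart A p)) \<longlongrightarrow> v (some_chart A p)) at_top"
      by (rule filterlim_compose[OF f(2)[OF some_chart]])
    from bounded_linear.tendsto[OF linear_conv_bounded_linear[THEN iffD1, OF linear_Dflow[OF some_chart d]] this]
    show ?thesis unfolding g_def tangent_map_coord[OF ft some_chart d] tangent_map_coord[OF vt some_chart d] .
  qed
  ultimately show ?thesis using tangent_map_tangent[OF vt] unfolding limit_distribution_def by blast
qed

lemma limit_distribution_invariant: "invariant_distribution A \<Phi> limit_distribution"
  unfolding invariant_distribution_def
proof (intro allI equalityI subsetI)
  fix p t v
  show "v \<in> limit_distribution (\<Phi> t p)" if "v \<in> tangent_map A (\<Phi> t) p ` limit_distribution p"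
    using that limit_distribution_push by blast
  assume v: "v \<in> limit_distribution (\<Phi> t p)"
  have "tangent_map A (\<Phi> (- t)) (\<Phi> t p) v \<in> limit_distribution p"
    using limit_distribution_push[OF v, of "- t"] by (simp add: flow_minus)
  then show "v \<in> tangent_map A (\<Phi> t) p ` limit_distribution p"
    using tangent_map_minus'[OF limit_distribution_tangent[OF v]] by (metis imageI)
qed

section \<open>Continuity in the base point\<close>

lemma chart_map_tendsto:
  assumes "d \<in> charts_at A p" "(g \<longlongrightarrow> p) F"
  shows "((\<lambda>k. chart_map d (g k)) \<longlongrightarrow> chart_map d p) F" "\<forall>\<^sub>F k in F. d \<in> charts_at A (g k)"
proof -
  note dA = charts_atD[OF assms(1)]
  have ev: "\<forall>\<^sub>F k in F. g k \<in> chart_dom d" by (rule topological_tendstoD[OF assms(2) chartD(1)[OF dA(1)] dA(2)])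
  then show "\<forall>\<^sub>F k in F. d \<in> charts_at A (g k)" using dA(1) by (auto elim: eventually_mono intro: charts_atI)
  show "((\<lambda>k. chart_map d (g k)) \<longlongrightarrow> chart_map d p) F"
    by (rule continuous_on_tendsto_compose[OF chartD(3)[OF dA(1)] assms(2) dA(2) ev])
qed

lemma Dflow_tendsto:
  assumes c: "c \<in> charts_at A p" and d: "d \<in> charts_at A (\<Phi> t p)" and g: "(g \<longlongrightarrow> p) F" and e: "(e \<longlongrightarrow> e0) F"
  shows "((\<lambda>k. Dflow c d t (g k) (e k)) \<longlongrightarrow> Dflow c d t p e0) F"
proof (rule linear_pointwise_tendsto[OF _ _ linear_Dflow[OF c d] e])
  have ev: "\<forall>\<^sub>F k in F. c \<in> charts_at A (g k) \<and> d \<in> charts_at A (\<Phi> t (g k))"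
    using chart_map_tendsto(2)[OF c g] chart_map_tendsto(2)[OF d flow_tendsto[OF tendsto_const g]]
    by (rule eventually_conj)
  then show "\<forall>\<^sub>F k in F. linear (Dflow c d t (g k))" by eventually_elim (use linear_Dflow in blast)
  fix i :: 'e
  note cA = charts_atD[OF c] and dA = charts_atD[OF d]
  let ?D = "\<lambda>z. frechet_derivative (flow_coord c d) (at z) (0, i)"
  have "continuous_on (flow_dom c d) ?D"
    by (rule smooth_on_continuous[OF smooth_on_frechet_derivative[OF flow_coord_smooth[OF cA(1) dA(1)]]])
  then have "((\<lambda>k. ?D (t, chart_map c (g k))) \<longlongrightarrow> ?D (t, chart_map c p)) F"
    by (rule continuous_on_tendsto_compose[OF _ tendsto_Pair[OF tendsto_const chart_map_tendsto(1)[OF c g]] flow_dom_mem[OF c d]])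
       (use ev in eventually_elim, use flow_dom_mem in blast)
  then have "((\<lambda>k. ?D (t, chart_map c (g k))) \<longlongrightarrow> Dflow c d t p i) F"
    unfolding Dflow_has_derivative(2)[OF c d] .
  then show "((\<lambda>k. Dflow c d t (g k) i) \<longlongrightarrow> Dflow c d t p i) F"
    by (rule Lim_transform_eventually) (use ev in eventually_elim, use Dflow_has_derivative(2) in simp)
qed

lemma smooth_field_tendsto:
  assumes V: "smooth_vector_field_on A U V" and U: "open U" "q \<in> U" and d: "d \<in> charts_at A q" and g: "(g \<longlongrightarrow> q) F"
  shows "((\<lambda>k. V (g k) d) \<longlongrightarrow> V q d) F"
proof -
  note dA = charts_atD[OF d]
  let ?W = "chart_map d ` (chart_dom d \<inter> U)"
  have cont: "continuous_on ?W (\<lambda>x. V (chart_inv d x) d)"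
    using V dA(1) smooth_on_continuous unfolding smooth_vector_field_on_def by blast
  have ev: "\<forall>\<^sub>F k in F. g k \<in> chart_dom d \<inter> U"
    by (rule topological_tendstoD[OF g]) (use U dA chartD(1)[OF dA(1)] in auto)
  have "((\<lambda>k. V (chart_inv d (chart_map d (g k))) d) \<longlongrightarrow> V (chart_inv d (chart_map d q)) d) F"
    by (rule continuous_on_tendsto_compose[OF cont chart_map_tendsto(1)[OF d g]])
       (use U dA ev in \<open>auto elim: eventually_mono\<close>)
  then have "((\<lambda>k. V (chart_inv d (chart_map d (g k))) d) \<longlongrightarrow> V q d) F" using chartD(5)[OF dA] by simp
  then show ?thesis
    by (rule Lim_transform_eventually) (use ev in eventually_elim, use chartD(5)[OF dA(1)] in auto)
qed

lemma pull_tendsto: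
  assumes V: "smooth_vector_field_on A U V" and U: "open U" "\<Phi> t p \<in> U" and c: "c \<in> charts_at A p" and g: "(g \<longlongrightarrow> p) F"
  shows "((\<lambda>k. pull c (g k) t (V (\<Phi> t (g k)))) \<longlongrightarrow> pull c p t (V (\<Phi> t p))) F"
proof -
  define q where "q = \<Phi> t p"
  obtain d where d: "d \<in> charts_at A q" using some_chart by blast
  have g': "((\<lambda>k. \<Phi> t (g k)) \<longlongrightarrow> q) F" unfolding q_def by (rule flow_tendsto[OF tendsto_const g])
  have c': "c \<in> charts_at A (\<Phi> (- t) q)" using c by (simp add: q_def flow_minus)
  have eq: "pull c x t (V (\<Phi> t x)) = Dflow d c (- t) (\<Phi> t x) (V (\<Phi> t x) d)"
    if "c \<in> charts_at A x" "d \<in> charts_at A (\<Phi> t x)" "\<Phi> t x \<in> U" for x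
  proof -
    have "V (\<Phi> t x) \<in> tangent_space A (\<Phi> t x)" using V that unfolding smooth_vector_field_on_def by blast
    then show ?thesis unfolding pull_def
      by (rule tangent_map_coord) (use that in \<open>auto simp: flow_minus\<close>)
  qed
  have ev: "\<forall>\<^sub>F k in F. c \<in> charts_at A (g k) \<and> d \<in> charts_at A (\<Phi> t (g k)) \<and> \<Phi> t (g k) \<in> U"
    using chart_map_tendsto(2)[OF c g] chart_map_tendsto(2)[OF d g'] topological_tendstoD[OF g' U(1)] U(2)
    by (auto simp: q_def intro!: eventually_conj)
  have "((\<lambda>k. Dflow d c (- t) (\<Phi> t (g k)) (V (\<Phi> t (g k)) d)) \<longlongrightarrow> Dflow d c (- t) q (V q d)) F"
    by (rule Dflow_tendsto[OF d c' g' smooth_field_tendsto[OF V U(1) _ d g']]) (simp add: q_def U(2))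
  then have "((\<lambda>k. Dflow d c (- t) (\<Phi> t (g k)) (V (\<Phi> t (g k)) d)) \<longlongrightarrow> pull c p t (V (\<Phi> t p))) F"
    using eq[OF c _ U(2)] d by (simp add: q_def)
  then show ?thesis
    by (rule Lim_transform_eventually) (use ev in eventually_elim, use eq in simp)
qed

text \<open>A vector of the curve at p extends to a section of \<Lambda> near
  \<open>\<Phi> t p\<close>, whose pullbacks to nearby points converge to it. Through
  \<open>decomposition_tendsto\<close> this yields continuity of the projections in the base
  point.\<close>

lemma curve_lsc:
  assumes c: "c \<in> charts_at A p" and g: "(g \<longlongrightarrow> p) F" and v: "v \<in> curve c p t"
  shows "\<exists>f. (\<forall>\<^sub>F k in F. f k \<in> curve c (g k) t) \<and> (f \<longlongrightarrow> v) F"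
proof -
  obtain u where u: "u \<in> \<Lambda> (\<Phi> t p)" "v = pull c p t u" using v unfolding curve_def by blast
  obtain U V where U: "open U" "\<Phi> t p \<in> U" and V: "\<And>i. i < n \<Longrightarrow> smooth_vector_field_on A U (V i)"
    and fr: "frame_on n U V \<Lambda>" by (rule Lambda_frame[of "\<Phi> t p"]) (rule that)
  note fi = frame_image[OF fr U(2) linear_id inj_on_id, unfolded id_apply image_id]
  obtain \<kappa> where "\<And>x. x \<in> \<Lambda> (\<Phi> t p) \<Longrightarrow> (\<Sum>j<n. \<kappa> j x *\<^sub>R V j (\<Phi> t p)) = x"
    using coordinate_functionals[OF fi(1,2)] unfolding fi(3) by blast
  then have uW: "u = combination (\<lambda>j. \<kappa> j u) V (\<Phi> t p)" using u(1) by (simp add: combination_def)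
  let ?W = "combination (\<lambda>j. \<kappa> j u) V"
  have sec: "smooth_section_on A \<Lambda> U ?W" by (rule combination_section[OF U(1) V fr])
  then have W: "smooth_vector_field_on A U ?W" unfolding smooth_section_on_def by blast
  have "((\<lambda>k. pull c (g k) t (?W (\<Phi> t (g k)))) \<longlongrightarrow> v) F"
    using pull_tendsto[OF W U c g] by (simp add: u(2) uW[symmetric])
  moreover have "\<forall>\<^sub>F k in F. \<Phi> t (g k) \<in> U"
    by (rule topological_tendstoD[OF flow_tendsto[OF tendsto_const g] U])
  then have "\<forall>\<^sub>F k in F. pull c (g k) t (?W (\<Phi> t (g k))) \<in> curve c (g k) t"
    by eventually_elim (use sec in \<open>auto simp: curve_def smooth_section_on_def\<close>)
  ultimately show ?thesis by (intro exI[of _ "\<lambda>k. pull c (g k) t (?W (\<Phi> t (g k)))"] conjI)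
qed

definition curve_pr :: "('m, 'e) chart \<Rightarrow> real \<Rightarrow> real \<Rightarrow> 'm \<Rightarrow> 'e \<Rightarrow> 'e"
  where "curve_pr c s t p = monotone_lagrangian_curve.pr (curve c p) s t"

lemma curve_pr_tendsto:
  assumes c: "c \<in> charts_at A p" and g: "(g \<longlongrightarrow> p) F" and e: "(e \<longlongrightarrow> e0) F" and st: "s \<noteq> t"
  shows "((\<lambda>k. curve_pr c s t (g k) (e k)) \<longlongrightarrow> curve_pr c s t p e0) F"
proof -
  interpret P: monotone_lagrangian_curve "form_at c p" "curve c p" n by (rule monotone_curve[OF c])
  have ev: "\<forall>\<^sub>F k in F. c \<in> charts_at A (g k)" by (rule chart_map_tendsto(2)[OF c g])
  show ?thesis
  proof (rule decomposition_tendsto[OF P.sum_L[OF st] P.subspace_L P.subspace_L P.transversal[OF st]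
        curve_lsc[OF c g] curve_lsc[OF c g]])
    show "\<forall>\<^sub>F k in F. subspace (curve c (g k) s) \<and> subspace (curve c (g k) t) \<and> curve c (g k) s \<inter> curve c (g k) t = {0}"
      using ev
    proof eventually_elim
      case (elim k)
      interpret monotone_lagrangian_curve "form_at c (g k)" "curve c (g k)" n by (rule monotone_curve[OF elim])
      show ?case using subspace_L transversal[OF st] by blast
    qed
    show "\<forall>\<^sub>F k in F. curve_pr c s t (g k) (e k) \<in> curve c (g k) s \<and> e k - curve_pr c s t (g k) (e k) \<in> curve c (g k) t"
      using ev
    proof eventually_elim
      case (elim k)
      interpret monotone_lagrangian_curve "form_at c (g k)" "curve c (g k)" n by (rule monotone_curve[OF elim])
      show ?case unfolding curve_pr_def using pr_mem[OF st] by blast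
    qed
    show "curve_pr c s t p e0 \<in> curve c p s" "e0 - curve_pr c s t p e0 \<in> curve c p t"
      unfolding curve_pr_def using P.pr_mem[OF st] by blast+
    show "((\<lambda>k. curve_pr c s t (g k) (e k) + (e k - curve_pr c s t (g k) (e k)))
        \<longlongrightarrow> curve_pr c s t p e0 + (e0 - curve_pr c s t p e0)) F" using e by simp
  qed
qed

text \<open>For fixed times the projections are continuous in p, so their pointwise limit R is
  Borel. Applying \<open>x - R p x\<close> to a smooth frame of \<Lambda> gives a measurable frame
  of the limit.\<close>

lemma limit_distribution_measurable: "measurable_lagrangian_distribution n A \<omega> limit_distribution"
  unfolding measurable_lagrangian_distribution_def
proof (intro conjI allI limit_distribution_lagrangian)
  fix p0
  obtain c where c0: "c \<in> charts_at A p0" using some_chart by blast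
  note cA = charts_atD[OF c0]
  obtain U0 V where U0: "open U0" "p0 \<in> U0" and V: "\<And>i. i < n \<Longrightarrow> smooth_vector_field_on A U0 (V i)"
    and fr: "frame_on n U0 V \<Lambda>" by (rule Lambda_frame[of p0]) (rule that)
  define U where "U = U0 \<inter> chart_dom c"
  have U: "open U" "p0 \<in> U" using U0 cA chartD(1)[OF cA(1)] by (auto simp: U_def)
  have c: "c \<in> charts_at A p" if "p \<in> U" for p using that cA(1) by (auto simp: U_def intro: charts_atI)
  \<comment> \<open>Measurability passes to limits of sequences, so integer times are used. None of
    them equals -1, which makes every term continuous.\<close>
  define R where "R p x = lim (\<lambda>k. curve_pr c (- 1) (real k) p x)" for p x
  have R: "linear (R p) \<and> (\<forall>x. (\<lambda>k. curve_pr c (- 1) (real k) p x) \<longlonglongrightarrow> R p x)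
      \<and> monotone_lagrangian_curve.lim_L (curve c p) = (\<lambda>x. x - R p x) ` curve c p 0
      \<and> (\<forall>x\<in>curve c p 0. x - R p x = 0 \<longrightarrow> x = 0)" if p: "p \<in> U" for p
  proof -
    interpret monotone_lagrangian_curve "form_at c p" "curve c p" n by (rule monotone_curve[OF c[OF p]])
    obtain R' where R': "linear R'" "\<And>x. ((\<lambda>t. pr (- 1) t x) \<longlongrightarrow> R' x) at_top"
      "lim_L = (\<lambda>x. x - R' x) ` curve c p 0" "\<And>x. x \<in> curve c p 0 \<Longrightarrow> x - R' x = 0 \<Longrightarrow> x = 0"
      by (rule lim_L_structure[of "-1" 0]) auto
    have lim: "(\<lambda>k. curve_pr c (- 1) (real k) p x) \<longlonglongrightarrow> R' x" for x
      unfolding curve_pr_def by (rule filterlim_compose[OF R'(2) filterlim_real_sequentially])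
    then have "R p = R'" unfolding R_def by (intro ext limI)
    then show ?thesis using R' lim by simp
  qed
  define y where "y i p = V i p c - R p (V i p c)" for i p
  define Y where "Y i p = coord_vec A c p (y i p)" for i p
  \<comment> \<open>No transport takes place at time 0, so \<open>curve c p 0\<close> is \<Lambda>
    in the chart; hence the choice of 0 for the subspace over which the limit is a graph.\<close>
  have curve_0: "curve c p 0 = (\<lambda>v. v c) ` \<Lambda> p" for p
  proof -
    have "pull c p 0 v = v c" if "v \<in> \<Lambda> p" for v
      using tangent_map_0[OF Lambda_tangent[OF that]] unfolding pull_def by (simp add: flow_0)
    then show ?thesis unfolding curve_def by (simp add: flow_0)
  qed
  have frame: "frame_on n U Y limit_distribution"
    unfolding frame_on_def
  proof
    fix p assume p: "p \<in> U"
    let ?f = "\<lambda>v. coord_vec A c p (v c - R p (v c))"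
    have lin: "linear ?f"
      using linear_compose[OF linear_compose_sub[OF linear_coord linear_compose[OF linear_coord, of "R p"]]
          linear_coord_vec[OF c[OF p]]] R[OF p] by (simp add: o_def)
    have "inj_on ?f (\<Lambda> p)"
    proof (rule inj_onI)
      fix u v assume uv: "u \<in> \<Lambda> p" "v \<in> \<Lambda> p" "?f u = ?f v"
      have w: "u - v \<in> \<Lambda> p" using uv lagrangian_subspaceD[OF Lambda_lagrangian] by (intro subspace_diff)
      have "?f (u - v) = 0" using linear_diff[OF lin, of u v] uv(3) by simp
      then have "(u - v) c - R p ((u - v) c) = 0" using coord_vec_coord[OF c[OF p]] by (metis zero_fun_apply)
      moreover have "(u - v) c \<in> curve c p 0" unfolding curve_0 using w by (rule imageI)
      ultimately have "(u - v) c = 0" using R[OF p] by blast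
      then have "(u - v) c = (0 :: ('m, 'e) tvec) c" by (simp only: zero_fun_apply)
      then have "u - v = 0"
        using tangent_eqI[OF Lambda_tangent[OF w] subspace_0[OF subspace_tangent] c[OF p]] by blast
      then show "u = v" by simp
    qed
    moreover have "p \<in> U0" using p by (simp add: U_def)
    moreover have "?f ` \<Lambda> p = limit_distribution p"
      unfolding limit_distribution_coord[OF c[OF p]] using R[OF p] by (simp add: curve_0 image_image)
    ultimately show "inj_on (\<lambda>i. Y i p) {..<n} \<and> independent ((\<lambda>i. Y i p) ` {..<n}) \<and>
        span ((\<lambda>i. Y i p) ` {..<n}) = limit_distribution p"
      using frame_image[OF fr _ lin] unfolding Y_def y_def by simp
  qed
  have y_meas: "y i \<in> borel_measurable (restrict_space borel U)" if i: "i < n" for i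
  proof (rule borel_measurable_LIMSEQ_metric)
    show "(\<lambda>p. V i p c - curve_pr c (- 1) (real k) p (V i p c)) \<in> borel_measurable (restrict_space borel U)" for k
    proof (rule borel_measurable_continuous_on_restrict)
      show "continuous_on U (\<lambda>p. V i p c - curve_pr c (- 1) (real k) p (V i p c))"
        unfolding continuous_on_def
      proof
        fix p assume p: "p \<in> U"
        have "((\<lambda>x. V i x c) \<longlongrightarrow> V i p c) (at p within U)"
          by (rule smooth_field_tendsto[OF V[OF i] U0(1) _ c[OF p] tendsto_ident_at]) (use p U_def in blast)
        then show "((\<lambda>p. V i p c - curve_pr c (- 1) (real k) p (V i p c)) \<longlongrightarrow> V i p c - curve_pr c (- 1) (real k) p (V i p c)) (at p within U)"
          by (intro tendsto_diff curve_pr_tendsto[OF c[OF p] tendsto_ident_at]) auto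
      qed
    qed
    show "(\<lambda>k. V i p c - curve_pr c (- 1) (real k) p (V i p c)) \<longlonglongrightarrow> y i p" if "p \<in> space (restrict_space borel U)" for p
      unfolding y_def using R[of p] that by (intro tendsto_diff tendsto_const) (auto simp: space_restrict_space)
  qed
  have Y_meas: "measurable_vector_field_on A U (Y i)" if i: "i < n" for i
    unfolding measurable_vector_field_on_def
  proof (intro conjI ballI)
    show "Y i p \<in> tangent_space A p" if "p \<in> U" for p unfolding Y_def by (rule coord_vec_tangent[OF c[OF that]])
    fix d assume d: "d \<in> A"
    let ?M = "restrict_space borel (chart_dom d \<inter> U)"
    have dp: "d \<in> charts_at A p" if "p \<in> chart_dom d \<inter> U" for p using that d by (auto intro: charts_atI)
    \<comment> \<open>In another chart the frame is the image of \<open>y i p\<close> under a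
      transition derivative that varies with p. Expanding over \<open>Basis\<close> reduces its
      measurability to that of finitely many products.\<close>
    have D: "(\<lambda>p. Dflow c d 0 p b) \<in> borel_measurable ?M" for b
    proof (rule borel_measurable_continuous_on_restrict)
      show "continuous_on (chart_dom d \<inter> U) (\<lambda>p. Dflow c d 0 p b)"
        unfolding continuous_on_def
        using Dflow_tendsto[of c _ d 0, OF c _ tendsto_ident_at tendsto_const] dp by (auto simp: flow_0)
    qed
    have "y i \<in> borel_measurable ?M"
      using measurable_restrict_space1[OF y_meas[OF i], of "chart_dom d"] U(1) chartD(1)[OF d]
      by (simp add: restrict_restrict_space Int_commute[of U])
    then have "(\<lambda>p. \<Sum>b\<in>Basis. (y i p \<bullet> b) *\<^sub>R Dflow c d 0 p b) \<in> borel_measurable ?M"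
      by (intro borel_measurable_sum borel_measurable_scaleR borel_measurable_inner D) auto
    moreover have "(\<Sum>b\<in>Basis. (y i p \<bullet> b) *\<^sub>R Dflow c d 0 p b) = Y i p d" if "p \<in> space ?M" for p
    proof -
      have p: "p \<in> chart_dom d \<inter> U" using that by (simp add: space_restrict_space)
      then have lin: "linear (Dflow c d 0 p)" using linear_Dflow[OF c, of p d 0] dp by (simp add: flow_0)
      have "(\<Sum>b\<in>Basis. (y i p \<bullet> b) *\<^sub>R Dflow c d 0 p b) = Dflow c d 0 p (\<Sum>b\<in>Basis. (y i p \<bullet> b) *\<^sub>R b)"
        unfolding linear_sum[OF lin] linear_scale[OF lin] ..
      also have "\<dots> = Y i p d" unfolding Y_def coord_vec_eq euclidean_representation using dp[OF p] by simp
      finally show ?thesis .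
    qed
    ultimately show "(\<lambda>p. Y i p d) \<in> borel_measurable ?M" by (simp cong: measurable_cong)
  qed
  show "\<exists>U X. open U \<and> p0 \<in> U \<and> (\<forall>i<n. measurable_vector_field_on A U (X i)) \<and> frame_on n U X limit_distribution"
    using U Y_meas frame by blast
qed

end

theorem theorem1p1:
  fixes n :: nat
    and A :: "('m::{t2_space, second_countable_topology}, 'e::euclidean_space) chart set"
    and \<omega> :: "'m \<Rightarrow> ('m, 'e) tvec \<Rightarrow> ('m, 'e) tvec \<Rightarrow> real"
    and \<Lambda> :: "'m \<Rightarrow> ('m, 'e) tvec set"
    and H :: "'m \<Rightarrow> real"
    and X :: "'m \<Rightarrow> ('m, 'e) tvec"
    and \<Phi> :: "real \<Rightarrow> 'm \<Rightarrow> 'm"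
  assumes dim: "DIM('e) = 2 * n"
    and manifold: "smooth_atlas A"
    and symplectic: "symplectic_form A \<omega>"
    and lagrangian: "smooth_lagrangian_distribution n A \<omega> \<Lambda>"
    and smooth_H: "smooth_function A H"
    and hamiltonian: "hamiltonian_vector_field A \<omega> H X"
    and flow: "complete_flow A X \<Phi>"
    and monotone: "monotone_field A \<omega> \<Lambda> X"
    and no_conj: "no_conjugate_points A \<Lambda> \<Phi>"
  shows "\<exists>\<Delta>p \<Delta>m. measurable_lagrangian_distribution n A \<omega> \<Delta>p
           \<and> measurable_lagrangian_distribution n A \<omega> \<Delta>m
           \<and> invariant_distribution A \<Phi> \<Delta>p \<and> invariant_distribution A \<Phi> \<Delta>m"
proof -
  interpret monotone_flow A X \<Phi> \<omega> H n \<Lambda>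
    using assms by unfold_locales
  show ?thesis using limit_distribution_measurable limit_distribution_invariant by blast
qed

end
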